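(* Let $k,m\in\mathbb{N}$, let $d\ge0$ be an integer with $d\le m$, and let $\mu$ be a finite Borel measure on $\mathbb{R}^k$ with $\dim_T(\mu)\ge d$. Then the set $$\{f\in\mathrm{Lip}_1(\mathbb{R}^k,\mathbb{R}^m):\ \dim_H(f_\#\mu)\ge d\}$$ has non-empty interior in $\mathrm{Lip}_1(\mathbb{R}^k,\mathbb{R}^m)$.
   Context: Euclidean spaces carry the Euclidean norm. $\mathrm{Lip}_1(\mathbb{R}^k,\mathbb{R}^m)$ is the space of all bounded $1$-Lipschitz maps with the supremum metric. $f_\#\mu(A)=\mu(f^{-1}(A))$. For a Borel measure $\nu$ on a metric space $Y$, $\dim_H\nu$ is the infimum of those $s\in[0,\infty)$ for which there is a $\nu$-null set $N$ with $\mathcal{H}^s(Y\setminus N)<\infty$. Curve fragments: for a metric space $X$, $\Gamma(X)$ is the set of all Lipschitz maps $\gamma\colon\operatorname{Dom}\gamma\to X$ with $\operatorname{Dom}\gamma\subset[0,1]$ non-empty and compact. For a Lipschitz map $F\colon X\to\mathbb{R}^n$, $(F\circ\gamma)'(t)$ denotes the derivative (relative to $\operatorname{Dom}\gamma$), which exists for $\mathcal{H}^1$-a.e. $t\in\operatorname{Dom}\gamma$. Weak tangent fields: let $S\subset X$ be Borel, $F\colon X\to\mathbb{R}^n$ Lipschitz and $0\le d\le n$ an integer. A Borel map $\tau$ from $S$ to the Grassmannian of $d$-dimensional linear subspaces of $\mathbb{R}^n$ is a $d$-dimensional weak tangent field to $S$ with respect to $F$ if for every $\gamma\in\Gamma(X)$,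 $(F\circ\gamma)'(t)\in\tau(\gamma(t))$ for $\mathcal{H}^1$-a.e. $t\in\gamma^{-1}(S)$. The set $S$ admits a $d$-dimensional weak tangent field if for every $n\in\mathbb{N}$ with $n\ge d$ and every Lipschitz $F\colon X\to\mathbb{R}^n$ there exists a $d$-dimensional weak tangent field to $S$ with respect to $F$. Tangential dimension: $\dim_T(S)$ is the least integer $d\ge0$ such that $S$ admits a $d$-dimensional weak tangent field ($\infty$ if there is none). For a Borel measure $\mu$ on $X$, $\dim_T\mu$ is the least integer $d\ge 0$ for which there is a Borel $N\subset X$ with $\mu(N)=0$ and $\dim_T(X\setminus N)\le d$ ($\infty$ if there is none). *)

theory Defs
  imports "HOL-Analysis.Analysis" "HOL-Library.Extended_Nat"
begin

section \<open>Euclidean spaces of variable dimension\<close>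

text \<open>
  Admitting a weak tangent field quantifies over all n and all Lipschitz maps into
  the n-dimensional Euclidean space inside one definition, so n cannot be a type.
  The type \<open>rseq\<close> consists of the finitely supported real sequences with the
  standard inner product. The set \<open>Rn n\<close> of sequences supported in \<open>{..<n}\<close>
  is Euclidean n-space: see \<open>norm_Rn\<close>, \<open>subspace_Rn\<close> and \<open>dim_Rn\<close>.
\<close>

typedef rseq = "{x :: nat \<Rightarrow> real. finite {i. x i \<noteq> 0}}"
  morphisms coord Abs_rseq
  by (rule exI[of _ "\<lambda>_. 0"]) simp

setup_lifting type_definition_rseq

lemma finite_supp [simp]: "finite {i. coord x i \<noteq> 0}"
  using coord[of x] by simp

lemma rseq_eqI: "(\<And>i. coord x i = coord y i) \<Longrightarrow> x = y"
  by (metis coord_inject ext)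

instantiation rseq :: real_vector
begin

lift_definition zero_rseq :: rseq is "\<lambda>_. 0" by simp

lift_definition plus_rseq :: "rseq \<Rightarrow> rseq \<Rightarrow> rseq" is "\<lambda>x y i. x i + y i"
  subgoal for x y
    by (rule finite_subset[of _ "{i. x i \<noteq> 0} \<union> {i. y i \<noteq> 0}"]) auto
  done

lift_definition minus_rseq :: "rseq \<Rightarrow> rseq \<Rightarrow> rseq" is "\<lambda>x y i. x i - y i"
  subgoal for x y
    by (rule finite_subset[of _ "{i. x i \<noteq> 0} \<union> {i. y i \<noteq> 0}"]) auto
  done

lift_definition uminus_rseq :: "rseq \<Rightarrow> rseq" is "\<lambda>x i. - x i" by simp

lift_definition scaleR_rseq :: "real \<Rightarrow> rseq \<Rightarrow> rseq" is "\<lambda>c x i. c * x i"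
  subgoal for c x
    by (rule finite_subset[of _ "{i. x i \<noteq> 0}"]) auto
  done

instance
  by standard (rule rseq_eqI; transfer; simp add: algebra_simps)+

end

lemma coord_zero [simp]: "coord 0 i = 0"
  and coord_plus [simp]: "coord (x + y) i = coord x i + coord y i"
  and coord_minus [simp]: "coord (x - y) i = coord x i - coord y i"
  and coord_uminus [simp]: "coord (- x) i = - coord x i"
  and coord_scaleR [simp]: "coord (c *\<^sub>R x) i = c * coord x i"
  by (transfer; simp)+

instantiation rseq :: real_inner
begin

definition inner_rseq :: "rseq \<Rightarrow> rseq \<Rightarrow> real" where
  "inner_rseq x y = (\<Sum>i | coord x i \<noteq> 0. coord x i * coord y i)"

definition norm_rseq :: "rseq \<Rightarrow> real" where
  "norm_rseq x = sqrt (inner x x)"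

definition sgn_rseq :: "rseq \<Rightarrow> rseq" where
  "sgn_rseq x = x /\<^sub>R norm x"

definition dist_rseq :: "rseq \<Rightarrow> rseq \<Rightarrow> real" where
  "dist_rseq x y = norm (x - y)"

definition uniformity_rseq :: "(rseq \<times> rseq) filter" where
  "uniformity_rseq = (INF e\<in>{0 <..}. principal {(x, y). dist x y < e})"

definition open_rseq :: "rseq set \<Rightarrow> bool" where
  "open_rseq U \<longleftrightarrow> (\<forall>x\<in>U. \<forall>\<^sub>F (x', y) in uniformity. x' = x \<longrightarrow> y \<in> U)"

lemma inner_rseq_superset:
  assumes "finite A" "{i. coord x i \<noteq> 0} \<subseteq> A"
  shows "inner x y = (\<Sum>i\<in>A. coord x i * coord y i)"
  unfolding inner_rseq_def by (rule sum.mono_neutral_left) (use assms in auto)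

instance
proof
  fix x y z :: rseq and r :: real
  let ?A = "{i. coord x i \<noteq> 0} \<union> {i. coord y i \<noteq> 0}"
  have A: "finite ?A" by simp
  show "inner x y = inner y x"
    by (subst (1 2) inner_rseq_superset[OF A]) (auto simp: mult.commute)
  have *: "{i. coord (x + y) i \<noteq> 0} \<subseteq> ?A" by auto
  show "inner (x + y) z = inner x z + inner y z"
    by (subst inner_rseq_superset[OF A *], subst (1 2) inner_rseq_superset[OF A])
       (auto simp: algebra_simps sum.distrib)
  have **: "{i. coord (r *\<^sub>R x) i \<noteq> 0} \<subseteq> ?A" by auto
  show "inner (r *\<^sub>R x) y = r * inner x y"
    by (subst inner_rseq_superset[OF A **], subst inner_rseq_superset[OF A])
       (auto simp: algebra_simps sum_distrib_left)
  show "0 \<le> inner x x"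
    unfolding inner_rseq_def by (rule sum_nonneg) simp
  show "(inner x x = 0) = (x = 0)"
  proof
    assume "inner x x = 0"
    then have "\<forall>i\<in>{i. coord x i \<noteq> 0}. coord x i * coord x i = 0"
      unfolding inner_rseq_def by (subst (asm) sum_nonneg_eq_0_iff) auto
    then show "x = 0" by (intro rseq_eqI) auto
  qed (simp add: inner_rseq_def)
qed (simp_all add: norm_rseq_def sgn_rseq_def dist_rseq_def uniformity_rseq_def open_rseq_def)

end

definition Rn :: "nat \<Rightarrow> rseq set" where
  "Rn n = {x. \<forall>i\<ge>n. coord x i = 0}"

lemma norm_Rn: "x \<in> Rn n \<Longrightarrow> norm x = sqrt (\<Sum>i<n. (coord x i)\<^sup>2)"
  unfolding norm_rseq_def
  by (subst inner_rseq_superset[of "{..<n}"]) (auto simp: Rn_def power2_eq_square not_less[symmetric])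

lemma subspace_Rn: "subspace (Rn n)"
  by (auto simp: subspace_def Rn_def)

lift_definition unit_rseq :: "nat \<Rightarrow> rseq" is "\<lambda>j i. if i = j then 1 else 0"
  by simp

lemma coord_unit [simp]: "coord (unit_rseq j) i = (if i = j then 1 else 0)"
  by transfer simp

lemma coord_sum: "coord (sum f A) i = (\<Sum>a\<in>A. coord (f a) i)"
  by (induction A rule: infinite_finite_induct) auto

lemma Rn_subset_span: "Rn n \<subseteq> span (unit_rseq ` {..<n})"
proof
  fix x assume x: "x \<in> Rn n"
  have "x = (\<Sum>j<n. coord x j *\<^sub>R unit_rseq j)"
  proof (rule rseq_eqI)
    fix i
    show "coord x i = coord (\<Sum>j<n. coord x j *\<^sub>R unit_rseq j) i"
      using x by (simp add: coord_sum Rn_def if_distrib sum.delta' cong: if_cong)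
  qed
  also have "\<dots> \<in> span (unit_rseq ` {..<n})"
    by (intro span_sum span_scale span_base) auto
  finally show "x \<in> span (unit_rseq ` {..<n})" .
qed

lemma dim_Rn: "dim (Rn n) = n"
proof (rule dim_unique)
  show "unit_rseq ` {..<n} \<subseteq> Rn n" by (auto simp: Rn_def)
  show "Rn n \<subseteq> span (unit_rseq ` {..<n})" by (rule Rn_subset_span)
  have orth: "inner (unit_rseq i) (unit_rseq j) = 0" if "i \<noteq> j" for i j
    using that by (simp add: inner_rseq_def)
  have nz: "unit_rseq i \<noteq> 0" for i
    by (metis coord_unit coord_zero zero_neq_one)
  show "independent (unit_rseq ` {..<n})"
    by (rule pairwise_orthogonal_independent)
       (auto simp: pairwise_def orthogonal_def nz[symmetric] intro!: orth)
  have "inj unit_rseq"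
    by (rule injI) (metis coord_unit zero_neq_one)
  then show "card (unit_rseq ` {..<n}) = n"
    by (simp add: card_image inj_on_subset[of _ UNIV])
qed


section \<open>The Grassmannian and its Borel sets\<close>

definition Grassmannian :: "nat \<Rightarrow> nat \<Rightarrow> rseq set set" where
  "Grassmannian d n = {V. subspace V \<and> V \<subseteq> Rn n \<and> dim V = d}"

text \<open>
  The usual topology is metrised by the Hausdorff distance of the closed unit balls A of V and
  B of W. Here it is written as the supremum of the differences of the distance functions of A
  and B, taken over the ambient unit ball (which contains A and B).
\<close>

definition grass_dist :: "rseq set \<Rightarrow> rseq set \<Rightarrow> real" where
  "grass_dist V W =
     (SUP x\<in>cball 0 1. \<bar>infdist x (V \<inter> cball 0 1) - infdist x (W \<inter> cball 0 1)\<bar>)"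

lemma finite_basis_Rn:
  assumes "subspace V" "V \<subseteq> Rn n"
  obtains B where "finite B" "span B = V"
proof -
  obtain B where B: "B \<subseteq> V" "independent B" "V \<subseteq> span B"
    using basis_exists[of V] by metis
  have "finite (unit_rseq ` {..<n})" by simp
  moreover have "B \<subseteq> span (unit_rseq ` {..<n})"
    using B(1) assms(2) Rn_subset_span by blast
  ultimately have "finite B"
    using independent_span_bound[OF _ B(2)] by blast
  moreover have "span B = V"
    using B assms(1) by (metis span_subspace)
  ultimately show ?thesis using that by blast
qed

lemma orthogonal_projection_exists:
  fixes v :: "'v::real_inner"
  assumes "finite B"
  shows "\<exists>p\<in>span B. \<forall>b\<in>span B. inner (v - p) b = 0"
  using assms
proof (induction B arbitrary: v rule: finite_induct)
  case empty
  then show ?case by simp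
next
  case (insert a B)
  obtain q where q: "q \<in> span B" "\<And>b. b \<in> span B \<Longrightarrow> inner (a - q) b = 0"
    using insert.IH[of a] by blast
  obtain p where p: "p \<in> span B" "\<And>b. b \<in> span B \<Longrightarrow> inner (v - p) b = 0"
    using insert.IH[of v] by blast
  define e where "e = a - q"
  define c where "c = (if e = 0 then 0 else inner v e / inner e e)"
  define r where "r = p + c *\<^sub>R e"
  have sub: "x \<in> span (insert a B)" if "x \<in> span B" for x
    using that span_mono[of B "insert a B"] by blast
  have e_in: "e \<in> span (insert a B)"
    unfolding e_def using q(1) by (simp add: span_diff sub span_base)
  have pe: "inner p e = 0"
    using q(2)[OF p(1)] by (simp add: e_def inner_commute)
  have r1: "inner (v - r) b = 0" if "b \<in> span B" for b
    using p(2)[OF that] q(2)[OF that]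
    by (simp add: r_def e_def inner_diff_left inner_add_left)
  have r2: "inner (v - r) e = 0"
    by (simp add: r_def c_def inner_diff_left inner_add_left pe)
  show ?case
  proof (intro bexI ballI)
    show "r \<in> span (insert a B)"
      unfolding r_def by (intro span_add span_scale e_in sub p)
    fix b assume "b \<in> span (insert a B)"
    then obtain k where k: "b - k *\<^sub>R a \<in> span B"
      by (auto simp: span_insert)
    have "b - k *\<^sub>R e = (b - k *\<^sub>R a) + k *\<^sub>R q"
      by (simp add: e_def algebra_simps)
    also have "\<dots> \<in> span B" by (intro span_add span_scale k q)
    finally have "inner (v - r) (b - k *\<^sub>R e) = 0" by (rule r1)
    then show "inner (v - r) b = 0"
      by (simp add: inner_diff_right r2)
  qed
qed

lemma infdist_ball_le:
  fixes x :: rseq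
  assumes "x \<in> cball 0 1"
  shows "infdist x (V \<inter> cball 0 1) \<le> 2"
proof (cases "V \<inter> cball 0 1 = {}")
  case False
  then obtain v where v: "v \<in> V \<inter> cball 0 1" by blast
  have "dist x v \<le> 2"
    using dist_triangle2[of x v 0] assms v by (simp add: dist_norm)
  with v show ?thesis by (rule infdist_le2)
qed (simp add: infdist_def)

lemma grass_dist_upper:
  assumes "x \<in> cball 0 1"
  shows "\<bar>infdist x (V \<inter> cball 0 1) - infdist x (W \<inter> cball 0 1)\<bar> \<le> grass_dist V W"
  unfolding grass_dist_def
proof (rule cSUP_upper[OF assms bdd_aboveI2])
  fix x :: rseq assume "x \<in> cball 0 1"
  then show "\<bar>infdist x (V \<inter> cball 0 1) - infdist x (W \<inter> cball 0 1)\<bar> \<le> 2"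
    using infdist_ball_le[of x V] infdist_ball_le[of x W]
      infdist_nonneg[of x "V \<inter> cball 0 1"] infdist_nonneg[of x "W \<inter> cball 0 1"]
    by linarith
qed

lemma grass_dist_leI:
  assumes "\<And>x. x \<in> cball 0 1 \<Longrightarrow>
    \<bar>infdist x (V \<inter> cball 0 1) - infdist x (W \<inter> cball 0 1)\<bar> \<le> r"
  shows "grass_dist V W \<le> r"
  unfolding grass_dist_def by (rule cSUP_least) (use assms in auto)

lemma grass_dist_nonneg: "0 \<le> grass_dist V W"
  using grass_dist_upper[of 0 V W] by simp

lemma grass_dist_commute: "grass_dist V W = grass_dist W V"
  by (simp add: grass_dist_def abs_minus_commute)

lemma grass_dist_0_imp_subset:
  assumes V: "subspace V" and W: "subspace W" "W \<subseteq> Rn n"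
    and 0: "grass_dist V W = 0"
  shows "V \<subseteq> W"
proof
  fix v assume v: "v \<in> V"
  define u where "u = v /\<^sub>R norm v"
  have u: "u \<in> V" "norm u \<le> 1"
    using v V by (auto simp: u_def subspace_scale divide_simps)
  then have iu: "infdist u (V \<inter> cball 0 1) = 0" by simp
  obtain B where B: "finite B" "span B = W" using finite_basis_Rn[OF W] .
  obtain p where p: "p \<in> W" "\<And>b. b \<in> W \<Longrightarrow> inner (u - p) b = 0"
    using orthogonal_projection_exists[OF B(1), of u] B(2) by blast
  have ne: "W \<inter> cball 0 1 \<noteq> {}"
    using W(1) subspace_0[of W] by force
  have "norm (u - p) \<le> dist u w" if "w \<in> W" for w
  proof -
    have "p - w \<in> W" using p(1) that W(1) by (simp add: subspace_diff)
    then have "orthogonal (u - p) (p - w)" using p(2) by (simp add: orthogonal_def)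
    then have "(norm ((u - p) + (p - w)))\<^sup>2 = (norm (u - p))\<^sup>2 + (norm (p - w))\<^sup>2"
      by (rule norm_add_Pythagorean)
    then have "(norm (u - p))\<^sup>2 \<le> (norm (u - w))\<^sup>2" by simp
    then show ?thesis by (simp add: dist_norm)
  qed
  then have "norm (u - p) \<le> infdist u (W \<inter> cball 0 1)"
    using ne by (auto simp: infdist_def intro: cINF_greatest)
  also have "\<dots> \<le> 0" using grass_dist_upper[of u V W] u(2) 0 iu by simp
  finally have "u \<in> W" using p(1) by simp
  moreover have "v = norm v *\<^sub>R u" by (cases "v = 0") (simp_all add: u_def)
  ultimately show "v \<in> W" using W(1) by (metis subspace_scale)
qed

lemma Metric_space_Grassmannian: "Metric_space (Grassmannian d n) grass_dist"
proof
  fix V W U :: "rseq set"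
  show "0 \<le> grass_dist V W" by (rule grass_dist_nonneg)
  show "grass_dist V W = grass_dist W V" by (rule grass_dist_commute)
  show "grass_dist V U \<le> grass_dist V W + grass_dist W U"
  proof (rule grass_dist_leI)
    fix x :: rseq assume "x \<in> cball 0 1"
    then show "\<bar>infdist x (V \<inter> cball 0 1) - infdist x (U \<inter> cball 0 1)\<bar>
        \<le> grass_dist V W + grass_dist W U"
      using grass_dist_upper[of x V W] grass_dist_upper[of x W U] by linarith
  qed
  assume "V \<in> Grassmannian d n" "W \<in> Grassmannian d n"
  then have V: "subspace V" "V \<subseteq> Rn n" and W: "subspace W" "W \<subseteq> Rn n"
    by (auto simp: Grassmannian_def)
  show "grass_dist V W = 0 \<longleftrightarrow> V = W"
  proof
    assume 0: "grass_dist V W = 0"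
    then show "V = W"
      using grass_dist_0_imp_subset[OF V(1) W] grass_dist_0_imp_subset[OF W(1) V]
      by (simp add: grass_dist_commute)
  next
    assume "V = W"
    then show "grass_dist V W = 0"
      by (simp add: grass_dist_def)
  qed
qed

definition Grassmannian_topology :: "nat \<Rightarrow> nat \<Rightarrow> rseq set topology" where
  "Grassmannian_topology d n = Metric_space.mtopology (Grassmannian d n) grass_dist"

definition borel_of :: "'a topology \<Rightarrow> 'a measure" where
  "borel_of T = sigma (topspace T) {U. openin T U}"


section \<open>Hausdorff measure and dimension\<close>

text \<open>
  The convention is that the diameter of a set to the power 0 is 1 for a nonempty set and
  0 for the empty set; note that \<open>0 powr 0 = 0\<close> in HOL. The measure is not normalised.
\<close>

definition diam_powr :: "real \<Rightarrow> 'a::metric_space set \<Rightarrow> ennreal" where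
  "diam_powr s E =
     (if E = {} then 0 else if s = 0 then 1 else ennreal (diameter E powr s))"

definition Hausdorff_content :: "real \<Rightarrow> real \<Rightarrow> 'a::metric_space set \<Rightarrow> ennreal" where
  "Hausdorff_content \<delta> s A =
     (INF E \<in> {E :: nat \<Rightarrow> 'a set. A \<subseteq> (\<Union>i. E i) \<and> (\<forall>i. bounded (E i) \<and> diameter (E i) \<le> \<delta>)}.
        \<Sum>i. diam_powr s (E i))"

definition Hausdorff_measure :: "real \<Rightarrow> 'a::metric_space set \<Rightarrow> ennreal" where
  "Hausdorff_measure s A = (SUP \<delta>\<in>{0<..}. Hausdorff_content \<delta> s A)"

definition Hausdorff_dim :: "'a::metric_space measure \<Rightarrow> ennreal" where
  "Hausdorff_dim \<nu> =
     Inf {ennreal s | s. 0 \<le> s \<and> (\<exists>N\<in>null_sets \<nu>. Hausdorff_measure s (UNIV - N) < \<infinity>)}"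


section \<open>Weak tangent fields and tangential dimension\<close>

text \<open>A curve fragment is its domain together with a map; values off the domain are irrelevant.\<close>

definition curve_fragments :: "(real set \<times> (real \<Rightarrow> 'a::metric_space)) set" where
  "curve_fragments =
     {(D, \<gamma>). D \<noteq> {} \<and> compact D \<and> D \<subseteq> {0..1} \<and> (\<exists>L. L-lipschitz_on D \<gamma>)}"

text \<open>
  At an isolated point of the domain every vector is a derivative relative to the domain. There
  are only countably many such points, so they do not affect the almost everywhere condition.
\<close>

definition weak_tangent_field ::
  "nat \<Rightarrow> nat \<Rightarrow> 'a::metric_space set \<Rightarrow> ('a \<Rightarrow> rseq) \<Rightarrow> ('a \<Rightarrow> rseq set) \<Rightarrow> bool" where
  "weak_tangent_field d n S F \<tau> \<longleftrightarrow>
     \<tau> \<in> measurable (restrict_space borel S) (borel_of (Grassmannian_topology d n)) \<and>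
     (\<forall>(D, \<gamma>) \<in> curve_fragments.
        Hausdorff_measure 1
          {t \<in> D. \<gamma> t \<in> S \<and>
             \<not> (\<exists>v \<in> \<tau> (\<gamma> t). ((F \<circ> \<gamma>) has_vector_derivative v) (at t within D))} = 0)"

definition admits_weak_tangent_field :: "nat \<Rightarrow> 'a::metric_space set \<Rightarrow> bool" where
  "admits_weak_tangent_field d S \<longleftrightarrow>
     (\<forall>n\<ge>d. \<forall>F :: 'a \<Rightarrow> rseq.
        range F \<subseteq> Rn n \<and> (\<exists>L. L-lipschitz_on UNIV F) \<longrightarrow>
        (\<exists>\<tau>. weak_tangent_field d n S F \<tau>))"

definition tangential_dim_set :: "'a::metric_space set \<Rightarrow> enat" where
  "tangential_dim_set S = Inf {enat d | d. admits_weak_tangent_field d S}"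

definition tangential_dim :: "'a::metric_space measure \<Rightarrow> enat" where
  "tangential_dim \<mu> =
     Inf {enat d | d. \<exists>N\<in>sets borel. emeasure \<mu> N = 0 \<and> tangential_dim_set (UNIV - N) \<le> enat d}"


section \<open>The space of bounded 1-Lipschitz maps\<close>

text \<open>The distance of \<open>bcontfun\<close> is the supremum metric.\<close>

definition Lip1 :: "('a::metric_space \<Rightarrow>\<^sub>C 'b::metric_space) set" where
  "Lip1 = {f. 1-lipschitz_on UNIV (apply_bcontfun f)}"

end

theory Submission
  imports Defs
begin

text \<open>
  Suppose the interior is empty. Then every 1-Lipschitz linear map that is isometric on the span of
  given independent vectors \<open>v\<^sub>0, \<dots>, v\<^bsub>d-1\<^esub>\<close> is a locally uniform limit of 1-Lipschitz maps whose
  images of \<open>\<mu>\<close> live on sets of dimension below \<open>d\<close>. Such a set is covered by \<open>d\<close> sets, the \<open>i\<close>-th of which is null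
  on all curve fragments moving roughly in the \<open>i\<close>-th of \<open>d\<close> independent directions: on a
  \<open>K\<close>-adic grid, the product of the \<open>d\<close> conditional probabilities with which a cell selects the
  coordinates of its child is large along the set, so one factor is large, but a curve steep in the
  \<open>i\<close>-th direction spends little time where the \<open>i\<close>-th factor is large. The preimages of these
  sets have small measure on fragments with velocity near \<open>v\<^sub>i\<close>. By Mazur's lemma, convex
  combinations of their indicators converge \<open>\<mu>\<close>-almost everywhere, so off a \<open>\<mu>\<close>-null set the
  space is covered by \<open>d\<close> sets, the \<open>i\<close>-th of which is null for fragments with velocity
  near \<open>v\<^sub>i\<close>.

  A Lipschitz map \<open>F\<close> into \<open>n\<close>-space can have \<open>d\<close> independent directional derivatives along
  dependent vectors \<open>v\<^sub>i\<close> only if it is not additive on the polygon with sides \<open>c\<^sub>i v\<^sub>i\<close>, and this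
  again gives a cover by \<open>d\<close> sets that are null in the respective directions. Countably
  many rational frames suffice. Hence off a \<open>\<mu>\<close>-null set independent of \<open>F\<close> the velocities
  of \<open>F \<circ> \<gamma>\<close> that are not excluded at a point span at most \<open>d - 1\<close> dimensions, and a measurable
  selection among the subspaces containing them is a weak tangent field.
\<close>

section \<open>Differentiation on the line\<close>

text \<open>The maps that approximate a linear map \<open>J\<close> do so only uniformly, so nothing
  controls the derivative of \<open>f \<circ> \<gamma>\<close> directly. The control comes from
  rigidity: \<open>f\<close> is 1-Lipschitz and \<open>J\<close> preserves the length of the
  velocity \<open>v\<close>, so \<open>f \<circ> \<gamma>\<close> can achieve almost the
  displacement of \<open>J \<circ> \<gamma>\<close> only if its derivative is close to
  \<open>J v\<close> outside a set of small measure. Hence \<open>J\<close> has to be isometric on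
  the span of the frame, which needs \<open>d \<le> CARD('m)\<close>, and preimages come out small
  rather than null on fragments. Smallness must be proportional to the length of the time interval,
  so that a density argument survives the passage to the limit.

  The dimensions of the images may tend to \<open>d\<close> along the approximating sequence, so the
  covers of the images need cones whose opening depends on the frame alone.

  The exceptional \<open>\<mu>\<close>-null set must be found before \<open>F\<close> is known.
  Therefore \<open>\<mu>\<close> enters only for independent frames in the domain; dependent
  directions are settled at every point, by a cover of the whole space.\<close>

lemma thin_imp_null:
  fixes E :: "real set"
  assumes E: "E \<in> sets borel" "emeasure lborel E < \<infinity>" and k: "0 < \<kappa>"
    and thin: "\<And>t e. t \<in> E \<Longrightarrow> 0 < e \<Longrightarrow>
      \<exists>c r. 0 < r \<and> r < e \<and> t \<in> cball c r \<and> emeasure lborel (E \<inter> cball c r) \<le> ennreal ((1 - \<kappa>) * (2 * r))"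
  shows "E \<in> null_sets lborel"
proof (rule ccontr)
  \<comment> \<open>With \<open>k \<le> 1\<close> the factor \<open>1 - k\<close> is nonnegative and
    passes through \<open>ennreal\<close>.\<close>
  define k where "k = min \<kappa> 1"
  have k01: "0 < k" "k \<le> 1" using k by (auto simp: k_def)
  define m where "m = measure lborel E"
  have Em: "emeasure lborel E = ennreal m"
    using E(2) by (simp add: m_def emeasure_eq_ennreal_measure top.not_eq_extremum)
  assume "E \<notin> null_sets lborel"
  then have m: "0 < m" using E(1) Em by (auto simp: null_sets_def zero_less_measure_iff m_def)
  obtain U where U: "open U" "E \<subseteq> U" "emeasure lborel (U - E) < ennreal (k * m)"
    using outer_regular_lborel[OF E(1), of "k * m"] m k01 by auto
  have Um: "emeasure lborel U \<le> ennreal (m + k * m)"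
  proof -
    have "emeasure lborel U = emeasure lborel (E \<union> (U - E))" using U(2) by (intro arg_cong[where f="emeasure lborel"]) auto
    also have "\<dots> \<le> emeasure lborel E + emeasure lborel (U - E)"
      using E(1) U(1) by (intro emeasure_subadditive) auto
    also have "\<dots> \<le> ennreal m + ennreal (k * m)" using U(3) Em by (intro add_mono) auto
    also have "\<dots> = ennreal (m + k * m)" using m k01 by (simp add: ennreal_plus)
    finally show ?thesis .
  qed
  \<comment> \<open>The balls of a Vitali cover stay inside \<open>U\<close>, whose measure is at
    most \<open>(1 + k) * m\<close>, and \<open>E\<close> fills at most the fraction
    \<open>1 - k\<close> of each. So \<open>m \<le> (1 - k) * (1 + k) * m\<close>, which is
    impossible for positive \<open>m\<close>.\<close>
  define K where "K = {(c, r). 0 < r \<and> cball c r \<subseteq> U \<and> emeasure lborel (E \<inter> cball c r) \<le> ennreal ((1 - \<kappa>) * (2 * r))}"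
  have ex: "\<exists>i. i \<in> K \<and> t \<in> cball (fst i) (snd i) \<and> snd i < e" if t: "t \<in> E" and e: "0 < e" for t e
  proof -
    obtain e0 where e0: "e0 > 0" "ball t e0 \<subseteq> U" using U(1,2) t open_contains_ball by blast
    obtain c r where cr: "0 < r" "r < min e (e0/2)" "t \<in> cball c r"
      "emeasure lborel (E \<inter> cball c r) \<le> ennreal ((1 - \<kappa>) * (2 * r))"
      using thin[OF t, of "min e (e0/2)"] e e0 by auto
    have "cball c r \<subseteq> ball t e0"
      using cr(2,3) by (auto simp: dist_real_def)
    then show ?thesis using cr e0 by (intro exI[of _ "(c, r)"]) (auto simp: K_def)
  qed
  obtain C where C: "countable C" "C \<subseteq> K"
     "pairwise (\<lambda>i j. disjnt (cball (fst i) (snd i)) (cball (fst j) (snd j))) C"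
     "negligible (E - (\<Union>i \<in> C. cball (fst i) (snd i)))"
  proof (rule Vitali_covering_theorem_cballs[of K snd E fst])
    show "0 < snd i" if "i \<in> K" for i using that by (auto simp: K_def)
    show "\<exists>i. i \<in> K \<and> t \<in> cball (fst i) (snd i) \<and> snd i < e" if "t \<in> E" "0 < e" for t e
      by (rule ex[OF that])
  qed (rule that)
  let ?B = "\<lambda>i. cball (fst i) (snd i) :: real set"
  have disj: "disjoint_family_on ?B C" "disjoint_family_on (\<lambda>i. E \<inter> ?B i) C"
  proof -
    show "disjoint_family_on ?B C"
      using C(3) by (simp add: disjoint_family_on_def pairwise_def disjnt_def)
    then show "disjoint_family_on (\<lambda>i. E \<inter> ?B i) C"
      by (rule disjoint_family_on_bisimulation) auto
  qed
  have UB: "(\<Union>i\<in>C. ?B i) \<in> sets borel"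
    using C(1) by (intro sets.countable_UN') auto
  have "emeasure lborel E \<le> emeasure lborel (E \<inter> (\<Union>i\<in>C. ?B i)) + emeasure lborel (E - (\<Union>i\<in>C. ?B i))"
    using E(1) UB by (subst plus_emeasure) (auto intro!: emeasure_mono)
  also have "emeasure lborel (E - (\<Union>i\<in>C. ?B i)) = 0"
  proof -
    have "E - (\<Union>i\<in>C. ?B i) \<in> null_sets lebesgue" using C(4) by (simp add: negligible_iff_null_sets)
    then show ?thesis using E(1) UB by auto
  qed
  also have "emeasure lborel (E \<inter> (\<Union>i\<in>C. ?B i)) = emeasure lborel (\<Union>i\<in>C. E \<inter> ?B i)"
    by (rule arg_cong[where f="emeasure lborel"]) auto
  also have "\<dots> = (\<integral>\<^sup>+ i. emeasure lborel (E \<inter> ?B i) \<partial>count_space C)"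
    using C(1) E(1) disj by (intro emeasure_UN_countable) auto
  also have "\<dots> \<le> (\<integral>\<^sup>+ i. ennreal (1 - k) * emeasure lborel (?B i) \<partial>count_space C)"
  proof (rule nn_integral_mono)
    fix i assume "i \<in> space (count_space C)"
    then have i: "i \<in> K" using C(2) by auto
    have "emeasure lborel (?B i) = ennreal (2 * snd i)"
      using i by (simp add: K_def case_prod_beta cball_eq_atLeastAtMost)
    moreover have "emeasure lborel (E \<inter> ?B i) \<le> ennreal ((1 - k) * (2 * snd i))"
    proof (rule order_trans)
      show "emeasure lborel (E \<inter> ?B i) \<le> ennreal ((1 - \<kappa>) * (2 * snd i))"
        using i by (simp add: K_def case_prod_beta)
      show "ennreal ((1 - \<kappa>) * (2 * snd i)) \<le> ennreal ((1 - k) * (2 * snd i))"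
        using i by (intro ennreal_leI mult_right_mono) (auto simp: k_def K_def)
    qed
    ultimately show "emeasure lborel (E \<inter> ?B i) \<le> ennreal (1 - k) * emeasure lborel (?B i)"
      using k01 i by (simp add: ennreal_mult K_def case_prod_beta)
  qed
  also have "\<dots> = ennreal (1 - k) * (\<integral>\<^sup>+ i. emeasure lborel (?B i) \<partial>count_space C)"
    by (rule nn_integral_cmult) auto
  also have "(\<integral>\<^sup>+ i. emeasure lborel (?B i) \<partial>count_space C) = emeasure lborel (\<Union>i\<in>C. ?B i)"
    using C(1) disj by (intro emeasure_UN_countable[symmetric]) auto
  also have "\<dots> \<le> emeasure lborel U"
    using C(2) U(1) by (intro emeasure_mono) (force simp: K_def)+
  also have "\<dots> \<le> ennreal (m + k * m)" by (rule Um)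
  finally have "ennreal m \<le> ennreal (1 - k) * ennreal (m + k * m)"
    by (simp add: Em mult_left_mono)
  also have "\<dots> = ennreal ((1 - k) * (m + k * m))" using k01 m by (simp add: ennreal_mult)
  finally have "m \<le> (1 - k) * (m + k * m)" using k01 m by (subst (asm) ennreal_le_iff) auto
  then have "0 \<le> - (k * k) * m" by (simp add: algebra_simps)
  then show False using k01 m by (simp add: mult_le_0_iff zero_le_mult_iff)
qed

text \<open>Disjoint intervals with increment at least \<open>q\<close> times their length exhaust
  \<open>E\<close> up to a null set, by Vitali. The increments of a monotone function over disjoint
  intervals add up to at most the total increment; this is countable additivity of
  \<open>interval_measure h\<close>.\<close>

lemma slope_measure_bound:
  fixes h :: "real \<Rightarrow> real"
  assumes E: "E \<in> sets borel" "E \<subseteq> {a..b}" and q: "0 \<le> q" and mh: "mono h" and ch: "continuous_on UNIV h"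
    and slope: "\<And>t e. t \<in> E \<Longrightarrow> 0 < e \<Longrightarrow> \<exists>s. s \<noteq> 0 \<and> \<bar>s\<bar> < e \<and> q \<le> (h (t + s) - h t) / s"
    and ab: "a \<le> b"
  shows "ennreal q * emeasure lborel E \<le> ennreal (h b - h a)"
proof -
  \<comment> \<open>Away from the end points a short interval between \<open>t\<close> and
    \<open>t + s\<close> stays in \<open>{a..b}\<close>, on whichever side of \<open>t\<close> it
    lies.\<close>
  define E' where "E' = E - {a, b}"
  have E': "E' \<in> sets borel" using E(1) by (simp add: E'_def)
  define K where "K = {(c, r). 0 < r \<and> cball c r \<subseteq> {a..b} \<and> q * (2 * r) \<le> h (c + r) - h (c - r)}"
  have ex: "\<exists>i. i \<in> K \<and> t \<in> cball (fst i) (snd i) \<and> snd i < e" if t: "t \<in> E'" and e: "0 < e" for t e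
  proof -
    have t': "t \<in> E" "a < t" "t < b" using t E(2) by (force simp: E'_def)+
    obtain s where s: "s \<noteq> 0" "\<bar>s\<bar> < min e (min (t - a) (b - t))" "q \<le> (h (t + s) - h t) / s"
      using slope[OF t'(1), of "min e (min (t - a) (b - t))"] t' e by auto
    define i where "i = (t + s / 2, \<bar>s\<bar> / 2)"
    have "q * \<bar>s\<bar> \<le> h (fst i + snd i) - h (fst i - snd i)"
    proof (cases "s > 0")
      case True
      then have e: "fst i + snd i = t + s" "fst i - snd i = t" "\<bar>s\<bar> = s" by (simp_all add: i_def)
      show ?thesis unfolding e using s(3) True by (simp add: pos_le_divide_eq)
    next
      case False
      then have s0: "s < 0" and e: "fst i + snd i = t" "fst i - snd i = t + s" "\<bar>s\<bar> = - s" using s(1) by (simp_all add: i_def)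
      show ?thesis unfolding e using s(3) s0 by (simp add: neg_le_divide_eq)
    qed
    moreover have "cball (fst i) (snd i) \<subseteq> {a..b}" "t \<in> cball (fst i) (snd i)"
      using s(2) by (auto simp: i_def cball_eq_atLeastAtMost dist_real_def abs_if split: if_splits)
    ultimately have "i \<in> K" "t \<in> cball (fst i) (snd i)" using s(1) by (auto simp: K_def i_def)
    moreover have "snd i < e" using s(2) e by (simp add: i_def)
    ultimately show ?thesis by blast
  qed
  obtain C where C: "countable C" "C \<subseteq> K"
     "pairwise (\<lambda>i j. disjnt (cball (fst i) (snd i)) (cball (fst j) (snd j))) C"
     "negligible (E' - (\<Union>i \<in> C. cball (fst i) (snd i)))"
  proof (rule Vitali_covering_theorem_cballs[of K snd E' fst])
    show "0 < snd i" if "i \<in> K" for i using that by (auto simp: K_def)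
    show "\<exists>i. i \<in> K \<and> t \<in> cball (fst i) (snd i) \<and> snd i < e" if "t \<in> E'" "0 < e" for t e
      by (rule ex[OF that])
  qed (rule that)
  let ?B = "\<lambda>i. cball (fst i) (snd i) :: real set"
  let ?I = "\<lambda>i. {fst i - snd i<..fst i + snd i} :: real set"
  let ?M = "interval_measure h"
  have Ioc: "emeasure ?M {x<..y} = ennreal (h y - h x)" if "x \<le> y" for x y
    using that mh ch by (intro emeasure_interval_measure_Ioc)
      (auto simp: mono_def continuous_on_eq_continuous_within intro: continuous_within_subset)
  have disj: "disjoint_family_on ?B C" "disjoint_family_on ?I C"
    using C(3) by (fastforce simp: disjoint_family_on_def pairwise_def disjnt_def cball_eq_atLeastAtMost)+
  have UB: "(\<Union>i\<in>C. ?B i) \<in> sets borel"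
    using C(1) by (intro sets.countable_UN') auto
  have "emeasure lborel E \<le> emeasure lborel (\<Union>i\<in>C. ?B i) + emeasure lborel (E' - (\<Union>i\<in>C. ?B i)) + emeasure lborel {a, b}"
  proof -
    have "emeasure lborel E \<le> emeasure lborel (((\<Union>i\<in>C. ?B i) \<union> (E' - (\<Union>i\<in>C. ?B i))) \<union> {a, b})"
      using UB E E' by (intro emeasure_mono) (auto simp: E'_def)
    also have "\<dots> \<le> emeasure lborel ((\<Union>i\<in>C. ?B i) \<union> (E' - (\<Union>i\<in>C. ?B i))) + emeasure lborel {a, b}"
      using UB E' by (intro emeasure_subadditive) auto
    also have "\<dots> \<le> emeasure lborel (\<Union>i\<in>C. ?B i) + emeasure lborel (E' - (\<Union>i\<in>C. ?B i)) + emeasure lborel {a, b}"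
      using UB E' by (intro add_mono emeasure_subadditive) auto
    finally show ?thesis .
  qed
  also have "emeasure lborel (E' - (\<Union>i\<in>C. ?B i)) = 0"
  proof -
    have "E' - (\<Union>i\<in>C. ?B i) \<in> null_sets lebesgue" using C(4) by (simp add: negligible_iff_null_sets)
    then show ?thesis using E' UB by auto
  qed
  also have "emeasure lborel {a, b} = 0" by (simp add: emeasure_lborel_countable)
  also have "emeasure lborel (\<Union>i\<in>C. ?B i) = (\<integral>\<^sup>+ i. emeasure lborel (?B i) \<partial>count_space C)"
    using C(1) disj by (intro emeasure_UN_countable) auto
  finally have "ennreal q * emeasure lborel E \<le> ennreal q * (\<integral>\<^sup>+ i. emeasure lborel (?B i) \<partial>count_space C)"
    by (simp add: mult_left_mono)
  also have "\<dots> = (\<integral>\<^sup>+ i. ennreal q * emeasure lborel (?B i) \<partial>count_space C)"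
    by (rule nn_integral_cmult[symmetric]) auto
  also have "\<dots> \<le> (\<integral>\<^sup>+ i. emeasure ?M (?I i) \<partial>count_space C)"
  proof (rule nn_integral_mono)
    fix i assume "i \<in> space (count_space C)"
    then have i: "i \<in> K" using C(2) by auto
    have "emeasure lborel (?B i) = ennreal (2 * snd i)"
      using i by (simp add: K_def case_prod_beta cball_eq_atLeastAtMost)
    then have "ennreal q * emeasure lborel (?B i) = ennreal (q * (2 * snd i))"
      using q i by (simp add: ennreal_mult K_def case_prod_beta)
    also have "\<dots> \<le> emeasure ?M (?I i)"
      using i by (subst Ioc) (auto simp: K_def case_prod_beta intro!: ennreal_leI)
    finally show "ennreal q * emeasure lborel (?B i) \<le> emeasure ?M (?I i)" .
  qed
  also have "\<dots> = emeasure ?M (\<Union>i\<in>C. ?I i)"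
    using C(1) disj by (intro emeasure_UN_countable[symmetric]) auto
  also have "\<dots> \<le> emeasure ?M {a<..b}"
  proof (rule emeasure_mono)
    show "(\<Union>i\<in>C. ?I i) \<subseteq> {a<..b}"
    proof
      fix x assume "x \<in> (\<Union>i\<in>C. ?I i)"
      then obtain i where i: "i \<in> K" "x \<in> ?I i" using C(2) by auto
      then have "fst i - snd i \<in> ?B i" "fst i + snd i \<in> ?B i" "?B i \<subseteq> {a..b}"
        by (auto simp: K_def case_prod_beta dist_real_def)
      then have "fst i - snd i \<in> {a..b}" "fst i + snd i \<in> {a..b}" by blast+
      then show "x \<in> {a<..b}" using i(2) by auto
    qed
  qed auto
  also have "\<dots> = ennreal (h b - h a)" using ab by (rule Ioc)
  finally show ?thesis .
qed

text \<open>Lebesgue's argument. Where the quotients oscillate between \<open>p\<close> and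
  \<open>q\<close>, each point has arbitrarily short intervals with increment at most
  \<open>p\<close> times their length, while the oscillating set inside such an interval forces an
  increment of at least \<open>q\<close> times its own measure. It thus fills at most the fraction
  \<open>p / q\<close> of the interval and is null by \<open>thin_imp_null\<close>.\<close>

lemma lipschitz_real_differentiable_AE:
  fixes h :: "real \<Rightarrow> real"
  assumes L: "L-lipschitz_on UNIV h"
  shows "\<exists>N\<in>null_sets lborel. \<forall>t. t \<notin> N \<longrightarrow> (\<exists>D. (h has_real_derivative D) (at t))"
proof -
  \<comment> \<open>The added slope \<open>L + 1\<close> puts all difference quotients between
    \<open>1\<close> and \<open>2 * L + 1\<close>. So \<open>g\<close> is monotone, and it suffices
    to consider levels with \<open>0 < p < q\<close>, for which \<open>p / q < 1\<close>.\<close>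
  define g where "g t = h t + (L + 1) * t" for t
  have L0: "0 \<le> L" using L by (rule lipschitz_on_nonneg)
  have hb: "\<bar>h x - h y\<bar> \<le> L * \<bar>x - y\<bar>" for x y
    using lipschitz_onD[OF L, of x y] by (simp add: dist_real_def)
  have cg: "continuous_on UNIV g"
    unfolding g_def by (intro continuous_intros lipschitz_on_continuous_on[OF L])
  have quot: "1 \<le> (g (t + s) - g t) / s \<and> (g (t + s) - g t) / s \<le> 2 * L + 1" if "s \<noteq> 0" for s t
  proof -
    have "\<bar>(h (t + s) - h t) / s\<bar> \<le> L"
      using hb[of "t + s" t] that by (simp add: divide_simps)
    moreover have "(g (t + s) - g t) / s = (h (t + s) - h t) / s + (L + 1)"
      using that by (simp add: g_def field_simps)
    ultimately show ?thesis by linarith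
  qed
  have mg: "mono g"
  proof (rule monoI)
    fix x y :: real assume "x \<le> y"
    then show "g x \<le> g y"
    proof (cases "x = y")
      case False
      with \<open>x \<le> y\<close> have "0 < y - x" by simp
      moreover have "1 \<le> (g y - g x) / (y - x)" using quot[of "y - x" x] False by simp
      ultimately show ?thesis by (simp add: pos_le_divide_eq)
    qed simp
  qed
  define E where "E p q = (\<Inter>n. {t. \<exists>s. s \<noteq> 0 \<and> \<bar>s\<bar> < inverse (Suc n) \<and> (g (t + s) - g t) / s < p}) \<inter>
     (\<Inter>n. {t. \<exists>s. s \<noteq> 0 \<and> \<bar>s\<bar> < inverse (Suc n) \<and> q < (g (t + s) - g t) / s})" for p q
  have op: "open {t. \<exists>s. s \<noteq> 0 \<and> \<bar>s\<bar> < inverse (Suc n) \<and> (g (t + s) - g t) / s < p}"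
       "open {t. \<exists>s. s \<noteq> 0 \<and> \<bar>s\<bar> < inverse (Suc n) \<and> q < (g (t + s) - g t) / s}" for n p q
  proof -
    have c: "continuous_on UNIV (\<lambda>t. (g (t + s) - g t) / s)" if "s \<noteq> 0" for s
      using that by (intro continuous_intros continuous_on_compose2[OF cg]) auto
    have eq: "{t. \<exists>s. s \<noteq> 0 \<and> \<bar>s\<bar> < inverse (Suc n) \<and> P s t} = (\<Union>s\<in>{s. s \<noteq> 0 \<and> \<bar>s\<bar> < inverse (Suc n)}. {t. P s t})" for P :: "real \<Rightarrow> real \<Rightarrow> bool"
      by auto
    show "open {t. \<exists>s. s \<noteq> 0 \<and> \<bar>s\<bar> < inverse (Suc n) \<and> (g (t + s) - g t) / s < p}"
      unfolding eq using c by (intro open_UN ballI open_Collect_less) (auto intro: continuous_on_const)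
    show "open {t. \<exists>s. s \<noteq> 0 \<and> \<bar>s\<bar> < inverse (Suc n) \<and> q < (g (t + s) - g t) / s}"
      unfolding eq using c by (intro open_UN ballI open_Collect_less) (auto intro: continuous_on_const)
  qed
  have Eb: "E p q \<in> sets borel" for p q
    unfolding E_def by (intro sets.Int sets.countable_INT'' borel_open[OF op(1)] borel_open[OF op(2)]) auto
  have Es: "\<exists>s. s \<noteq> 0 \<and> \<bar>s\<bar> < e \<and> (g (t + s) - g t) / s < p" "\<exists>s. s \<noteq> 0 \<and> \<bar>s\<bar> < e \<and> q < (g (t + s) - g t) / s"
    if "t \<in> E p q" "e > 0" for t p q e
  proof -
    obtain n where n: "inverse (Suc n) < e" using reals_Archimedean[OF \<open>e > 0\<close>] by auto
    show "\<exists>s. s \<noteq> 0 \<and> \<bar>s\<bar> < e \<and> (g (t + s) - g t) / s < p" "\<exists>s. s \<noteq> 0 \<and> \<bar>s\<bar> < e \<and> q < (g (t + s) - g t) / s"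
    proof -
      have "t \<in> {t. \<exists>s. s \<noteq> 0 \<and> \<bar>s\<bar> < inverse (Suc n) \<and> (g (t + s) - g t) / s < p}"
        "t \<in> {t. \<exists>s. s \<noteq> 0 \<and> \<bar>s\<bar> < inverse (Suc n) \<and> q < (g (t + s) - g t) / s}"
        using that(1) unfolding E_def by blast+
      then obtain s s' where "s \<noteq> 0" "\<bar>s\<bar> < inverse (Suc n)" "(g (t + s) - g t) / s < p"
         "s' \<noteq> 0" "\<bar>s'\<bar> < inverse (Suc n)" "q < (g (t + s') - g t) / s'" by blast
      with n show "\<exists>s. s \<noteq> 0 \<and> \<bar>s\<bar> < e \<and> (g (t + s) - g t) / s < p" "\<exists>s. s \<noteq> 0 \<and> \<bar>s\<bar> < e \<and> q < (g (t + s) - g t) / s"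
        by (meson less_trans)+
    qed
  qed
  have null: "E p q \<inter> {-m..m} \<in> null_sets lborel" if pq: "0 < p" "p < q" for p q m
  proof (rule thin_imp_null[where \<kappa> = "1 - p / q"])
    show "E p q \<inter> {-m..m} \<in> sets borel" using Eb by simp
    have "emeasure lborel (E p q \<inter> {-m..m}) \<le> emeasure lborel {-m..m}"
      by (intro emeasure_mono) auto
    also have "\<dots> < \<infinity>" using emeasure_compact_finite[of "{-m..m}"] by simp
    finally show "emeasure lborel (E p q \<inter> {-m..m}) < \<infinity>" .
    show "0 < 1 - p / q" using pq by simp
    fix t e :: real assume t: "t \<in> E p q \<inter> {-m..m}" and e: "0 < e"
    obtain s where s: "s \<noteq> 0" "\<bar>s\<bar> < e" "(g (t + s) - g t) / s < p" using Es(1) t e by blast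
    define c where "c = t + s / 2"
    define r where "r = \<bar>s\<bar> / 2"
    have I: "g (c + r) - g (c - r) \<le> p * (2 * r)"
    proof (cases "s > 0")
      case True
      then have e: "c + r = t + s" "c - r = t" "2 * r = s" by (simp_all add: c_def r_def)
      show ?thesis unfolding e using s(3) True by (simp add: pos_divide_less_eq)
    next
      case False
      then have s0: "s < 0" and e: "c + r = t" "c - r = t + s" "2 * r = - s" using s(1) by (simp_all add: c_def r_def)
      show ?thesis unfolding e using s(3) s0 by (simp add: neg_divide_less_eq)
    qed
    let ?F = "E p q \<inter> {-m..m} \<inter> cball c r"
    have "ennreal q * emeasure lborel ?F \<le> ennreal (g (c + r) - g (c - r))"
    proof (rule slope_measure_bound[where h = g])
      show "?F \<in> sets borel" using Eb by simp
      show "?F \<subseteq> {c - r..c + r}" by (auto simp: cball_eq_atLeastAtMost)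
      show "\<exists>s. s \<noteq> 0 \<and> \<bar>s\<bar> < e \<and> q \<le> (g (t + s) - g t) / s" if "t \<in> ?F" "0 < e" for t e
        using Es(2)[of t p q e] that by (meson IntE less_imp_le)
      show "0 \<le> q" "mono g" "continuous_on UNIV g" "c - r \<le> c + r"
        using pq mg cg by (simp_all add: r_def)
    qed
    also have "\<dots> \<le> ennreal (p * (2 * r))" using I by (rule ennreal_leI)
    finally have "ennreal (1/q) * (ennreal q * emeasure lborel ?F) \<le> ennreal (1/q) * ennreal (p * (2 * r))"
      by (rule mult_left_mono) auto
    then have "emeasure lborel ?F \<le> ennreal (p / q * (2 * r))"
      using pq by (simp add: mult.assoc[symmetric] ennreal_mult[symmetric] r_def)
    moreover have "t \<in> cball c r" "0 < r" "r < e"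
      using s by (auto simp: c_def r_def dist_real_def)
    ultimately show "\<exists>c r. 0 < r \<and> r < e \<and> t \<in> cball c r \<and> emeasure lborel (E p q \<inter> {- m..m} \<inter> cball c r) \<le> ennreal ((1 - (1 - p / q)) * (2 * r))"
      by auto
  qed
  define N where "N = (\<Union>p\<in>\<rat> \<inter> {0<..}. \<Union>q\<in>\<rat> \<inter> {p<..}. \<Union>m::nat. E p q \<inter> {-real m..real m})"
  have cr: "countable (\<rat> :: real set)"
    unfolding Rats_def by (intro countable_image countableI_type)
  have "N \<in> null_sets lborel"
    unfolding N_def using null cr
    by (intro null_sets_UN' countable_Int1) auto
  moreover have "\<exists>D. (h has_real_derivative D) (at t)" if t: "t \<notin> N" for t
  proof -
    have nE: "t \<notin> E p q" if pq: "p \<in> \<rat>" "q \<in> \<rat>" "0 < p" "p < q" for p q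
    proof
      assume "t \<in> E p q"
      moreover obtain m :: nat where "\<bar>t\<bar> \<le> real m" using real_arch_simple by blast
      ultimately have "t \<in> E p q \<inter> {-real m..real m}" by auto
      then have "t \<in> N" unfolding N_def using pq by blast
      with t show False by blast
    qed
    let ?f = "\<lambda>s. (g (t + s) - g t) / s"
    \<comment> \<open>\<open>Inf Q\<close> is the upper limit of the quotients. A smaller lower
      limit would leave room for rational \<open>p < q\<close> between the two and put
      \<open>t\<close> into \<open>E p q\<close>.\<close>
    define Q where "Q = {q \<in> \<rat>. eventually (\<lambda>s. ?f s \<le> q) (at 0)}"
    have Q1: "1 \<le> q" if qQ: "q \<in> Q" for q
    proof -
      obtain e where e: "e > 0" "\<And>s. s \<noteq> 0 \<Longrightarrow> \<bar>s\<bar> < e \<Longrightarrow> ?f s \<le> q"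
      proof -
        have "eventually (\<lambda>s. ?f s \<le> q) (at 0)" using qQ by (simp add: Q_def)
        then obtain e where "e > 0" "\<forall>s. s \<noteq> 0 \<and> dist s 0 < e \<longrightarrow> ?f s \<le> q"
          unfolding eventually_at by auto
        then show ?thesis by (intro that[of e]) auto
      qed
      have "?f (e / 2) \<le> q" using e(1) by (intro e(2)) auto
      moreover have "1 \<le> ?f (e / 2)" using quot[of "e / 2" t] e(1) by auto
      ultimately show "1 \<le> q" by linarith
    qed
    then have bb: "bdd_below Q" by (rule bdd_belowI)
    have ne: "Q \<noteq> {}"
    proof -
      obtain q where q: "q \<in> \<rat>" "2 * L + 1 < q" using Rats_dense_in_real[of "2 * L + 1" "2 * L + 2"] by auto
      have "eventually (\<lambda>s. ?f s \<le> q) (at 0)"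
      proof -
        have "?f s \<le> q" if "s \<noteq> 0" for s
          using quot[OF that, of t] q(2) by linarith
        then show ?thesis by (auto simp: eventually_at_filter)
      qed
      then show ?thesis using q(1) by (auto simp: Q_def)
    qed
    define l where "l = Inf Q"
    have l1: "1 \<le> l" unfolding l_def using ne Q1 by (intro cInf_greatest) auto
    have lim: "(?f \<longlongrightarrow> l) (at 0)"
    proof (rule order_tendstoI)
      fix a assume "l < a"
      then obtain q where q: "q \<in> Q" "q < a" unfolding l_def using cInf_less_iff[OF ne bb] by blast
      then show "eventually (\<lambda>s. ?f s < a) (at 0)" by (auto simp: Q_def elim: eventually_mono)
    next
      fix a assume "a < l"
      then obtain p where p: "p \<in> \<rat>" "max a 0 < p" "p < l" using Rats_dense_in_real[of "max a 0" l] l1 by auto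
      obtain q where q: "q \<in> \<rat>" "p < q" "q < l" using Rats_dense_in_real[OF p(3)] by auto
      have "q \<notin> Q" using q(3) cInf_lower[OF _ bb] unfolding l_def by force
      then have nq: "\<not> eventually (\<lambda>s. ?f s \<le> q) (at 0)" using q by (simp add: Q_def)
      have "\<exists>s. s \<noteq> 0 \<and> \<bar>s\<bar> < e \<and> q < ?f s" if "e > 0" for e
      proof (rule ccontr)
        assume "\<not> ?thesis"
        then have "\<forall>s. s \<noteq> 0 \<and> dist s 0 < e \<longrightarrow> ?f s \<le> q" by force
        then show False using nq that unfolding eventually_at by blast
      qed
      moreover have "t \<notin> E p q" using nE p q by simp
      ultimately have "\<not> (\<forall>n. \<exists>s. s \<noteq> 0 \<and> \<bar>s\<bar> < inverse (Suc n) \<and> ?f s < p)"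
        unfolding E_def by auto
      then obtain n where "\<forall>s. s \<noteq> 0 \<and> \<bar>s\<bar> < inverse (Suc n) \<longrightarrow> p \<le> ?f s" by force
      then have "eventually (\<lambda>s. p \<le> ?f s) (at 0)"
        unfolding eventually_at by (intro exI[of _ "inverse (Suc n)"]) auto
      then show "eventually (\<lambda>s. a < ?f s) (at 0)" by (rule eventually_mono) (use p in auto)
    qed
    then have "(g has_real_derivative l) (at t)" unfolding DERIV_def .
    then have "((\<lambda>t. g t - (L + 1) * t) has_real_derivative (l - (L + 1))) (at t)"
      by (auto intro!: derivative_eq_intros)
    then show ?thesis by (auto simp: g_def)
  qed
  ultimately show ?thesis by blast
qed

text \<open>Meant for contraposition: a non-null \<open>P\<close> contains a \<open>t\<close> such
  that at every small scale \<open>s\<close> some point of \<open>P\<close> lies within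
  \<open>\<rho> * s\<close> of \<open>t + c * s\<close>. The ball assumed to be missed by
  \<open>P\<close> occupies the fraction \<open>\<rho> / (\<bar>c\<bar> + \<rho>)\<close> of a ball
  about \<open>t\<close>.\<close>

lemma density_points_AE:
  fixes P :: "real set"
  assumes P: "P \<in> sets borel" and \<rho>: "0 < \<rho>"
    and bd: "emeasure lborel P < \<infinity>"
    and bad: "\<And>t s0. t \<in> P \<Longrightarrow> 0 < s0 \<Longrightarrow> \<exists>s. 0 < s \<and> s < s0 \<and> P \<inter> cball (t + c * s) (\<rho> * s) = {}"
  shows "P \<in> null_sets lborel"
proof (rule thin_imp_null[OF P bd, where \<kappa> = "\<rho> / (\<bar>c\<bar> + \<rho>)"])
  let ?R = "\<bar>c\<bar> + \<rho>"
  have R: "0 < ?R" using \<rho> by auto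
  show "0 < \<rho> / ?R" using \<rho> R by simp
  fix t e :: real assume t: "t \<in> P" and e: "0 < e"
  obtain s where s: "0 < s" "s < e / ?R" "P \<inter> cball (t + c * s) (\<rho> * s) = {}"
    using bad[OF t, of "e / ?R"] e R by auto
  let ?r = "?R * s"
  have sub: "cball (t + c * s) (\<rho> * s) \<subseteq> cball t ?r"
  proof
    fix x assume "x \<in> cball (t + c * s) (\<rho> * s)"
    then have "\<bar>t + c * s - x\<bar> \<le> \<rho> * s" by (simp add: dist_real_def)
    moreover have "\<bar>c * s\<bar> = \<bar>c\<bar> * s" using s(1) by (simp add: abs_mult)
    ultimately have "\<bar>t - x\<bar> \<le> \<bar>c\<bar> * s + \<rho> * s" by linarith
    then show "x \<in> cball t ?r" by (simp add: dist_real_def algebra_simps)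
  qed
  have "emeasure lborel (P \<inter> cball t ?r) \<le> emeasure lborel (cball t ?r - cball (t + c * s) (\<rho> * s))"
    using s(3) by (intro emeasure_mono) auto
  also have "\<dots> = emeasure lborel (cball t ?r) - emeasure lborel (cball (t + c * s) (\<rho> * s))"
    using emeasure_lborel_cball_finite[of "t + c * s" "\<rho> * s"]
    by (intro emeasure_Diff[OF _ _ _ sub]) auto
  also have "\<dots> = ennreal (2 * ?r - 2 * (\<rho> * s))"
    using R s(1) \<rho> by (simp add: cball_eq_atLeastAtMost ennreal_minus)
  also have "2 * ?r - 2 * (\<rho> * s) = (1 - \<rho> / ?R) * (2 * ?r)"
    using R by (simp add: field_simps)
  finally have "emeasure lborel (P \<inter> cball t ?r) \<le> ennreal ((1 - \<rho> / ?R) * (2 * ?r))" .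
  moreover have "0 < ?r" "?r < e" using R s(1,2) by (simp_all add: pos_less_divide_eq mult.commute)
  moreover from this have "t \<in> cball t ?r" by simp
  ultimately show "\<exists>c r. 0 < r \<and> r < e \<and> t \<in> cball c r \<and> emeasure lborel (P \<inter> cball c r) \<le> ennreal ((1 - \<rho> / ?R) * (2 * r))"
    by blast
qed

section \<open>Grid trees and steep curves\<close>

lemma emeasure_le_diam:
  fixes A :: "real set"
  assumes "A \<in> sets borel" "\<And>s t. s \<in> A \<Longrightarrow> t \<in> A \<Longrightarrow> \<bar>s - t\<bar> \<le> r"
  shows "emeasure lborel A \<le> ennreal r"
proof (cases "A = {}")
  case False
  then obtain a where a: "a \<in> A" by blast
  have bb: "bdd_below A"
  proof (rule bdd_belowI)
    fix t assume "t \<in> A"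
    then show "a - r \<le> t" using assms(2)[OF a] by (smt (verit))
  qed
  have r: "0 \<le> r" using assms(2)[OF a a] by simp
  have "A \<subseteq> {Inf A..Inf A + r}"
  proof
    fix t assume t: "t \<in> A"
    have "t - r \<le> Inf A"
      using False assms(2)[OF t] by (intro cInf_greatest) (auto simp: abs_le_iff diff_le_eq algebra_simps)
    then show "t \<in> {Inf A..Inf A + r}" using cInf_lower[OF t bb] by auto
  qed
  then have "emeasure lborel A \<le> emeasure lborel {Inf A..Inf A + r}"
    by (intro emeasure_mono) auto
  then show ?thesis using r by simp
qed simp

definition cell :: "nat \<Rightarrow> nat \<Rightarrow> nat \<Rightarrow> (nat \<Rightarrow> real) \<Rightarrow> int list" where
  "cell d K n u = map (\<lambda>i. \<lfloor>real K ^ n * u i\<rfloor>) [0..<d]"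

lemma length_cell [simp]: "length (cell d K n u) = d"
  and nth_cell [simp]: "i < d \<Longrightarrow> cell d K n u ! i = \<lfloor>real K ^ n * u i\<rfloor>"
  by (simp_all add: cell_def)

lemma cell_eq_iff: "cell d K n u = cell d K n v \<longleftrightarrow> (\<forall>i<d. \<lfloor>real K ^ n * u i\<rfloor> = \<lfloor>real K ^ n * v i\<rfloor>)"
  by (auto simp: list_eq_iff_nth_eq)

lemma floor_power_coarsen:
  assumes "1 \<le> K" "l \<le> n"
  shows "\<lfloor>real K ^ l * x\<rfloor> = \<lfloor>real K ^ n * x\<rfloor> div int (K ^ (n - l))"
proof -
  have "real K ^ n = real K ^ l * real K ^ (n - l)"
    using assms by (simp add: power_add[symmetric])
  then have "real K ^ l * x = (real K ^ n * x) / real_of_int (int (K ^ (n - l)))"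
    using assms by simp
  then show ?thesis by (simp only: floor_divide_real_eq_div of_nat_0_le_iff)
qed

lemma cell_coarsen:
  assumes "1 \<le> K" "l \<le> n" "cell d K n u = cell d K n v"
  shows "cell d K l u = cell d K l v"
  using assms(3) by (simp add: cell_eq_iff floor_power_coarsen[OF assms(1,2)])

lemma cell_measurable:
  assumes "\<And>i. (\<lambda>t. u t i) \<in> borel_measurable M"
  shows "(\<lambda>t. cell d K n (u t)) \<in> measurable M (count_space UNIV)"
proof -
  have pre: "(\<lambda>t. cell d K n (u t)) -` {q} \<inter> space M \<in> sets M" for q :: "int list"
  proof -
  have eq: "(\<lambda>t. cell d K n (u t)) -` {q} \<inter> space M =
    (if length q = d then {t \<in> space M. \<forall>i\<in>{..<d}. \<lfloor>real K ^ n * u t i\<rfloor> = q ! i} else {})"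
    by (auto simp: list_eq_iff_nth_eq)
  have m: "(\<lambda>t. \<lfloor>real K ^ n * u t i\<rfloor>) \<in> measurable M (count_space UNIV)" for i
    by (intro measurable_compose[OF _ measurable_real_floor] borel_measurable_times assms borel_measurable_const)
  have A: "{t \<in> space M. \<lfloor>real K ^ n * u t i\<rfloor> = q ! i} \<in> sets M" for i
  proof -
    have "{t \<in> space M. \<lfloor>real K ^ n * u t i\<rfloor> = q ! i} = (\<lambda>t. \<lfloor>real K ^ n * u t i\<rfloor>) -` {q ! i} \<inter> space M" by auto
    then show ?thesis using measurable_sets[OF m, of "{q ! i}" i] by (simp del: vimage_singleton_eq)
  qed
  have A': "{t \<in> space M. \<forall>i\<in>{..<d}. \<lfloor>real K ^ n * u t i\<rfloor> = q ! i} \<in> sets M"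
    by (rule sets.sets_Collect_finite_All[OF A finite_lessThan])
  show ?thesis
    by (subst eq, cases "length q = d", simp_all only: if_True if_False A' sets.empty_sets simp_thms)
  qed
  then show ?thesis
    by (intro measurable_count_space_eq2_countable[THEN iffD2] conjI ballI) simp_all
qed

text \<open>An index \<open>i\<close> is a leaf: the grid cube of level \<open>lv i\<close> that
  contains \<open>pt i\<close>, with weight \<open>M {i}\<close>. The leaves come from a cover by
  cubes of varying size; several leaves may be the same cube or be nested.\<close>

locale grid_tree =
  fixes d K :: nat and M :: "'i measure" and lv :: "'i \<Rightarrow> nat" and pt :: "'i \<Rightarrow> nat \<Rightarrow> real"
  assumes d: "1 \<le> d" and K: "2 \<le> K" and fin: "finite_measure M" and sets_M: "sets M = UNIV"
begin

abbreviation "cl \<equiv> cell d K"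

text \<open>Passing from a cube of level \<open>l\<close> to a child is split into \<open>d\<close>
  choices, one per coordinate; this is the mass that has made the same first \<open>j\<close>
  choices as \<open>x\<close>. Hence \<open>branch (Suc j) l x / branch j l x\<close> is the
  conditional probability of the choice in coordinate \<open>j\<close>.\<close>

definition branch :: "nat \<Rightarrow> nat \<Rightarrow> (nat \<Rightarrow> real) \<Rightarrow> real" where
  "branch j l x = measure M {i. l < lv i \<and> cl l (pt i) = cl l x \<and>
     (\<forall>j'<j. cl (Suc l) (pt i) ! j' = cl (Suc l) x ! j')}"

text \<open>The normalisation makes the ratios over the children met by a steep curve add up to at
  most \<open>K\<close>. As the side of a child is \<open>1 / K\<close> of that of its parent,
  \<open>gain j\<close> behaves like a nonnegative supermartingale in time along the curve.\<close>

definition ratio :: "nat \<Rightarrow> nat \<Rightarrow> (nat \<Rightarrow> real) \<Rightarrow> real" where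
  "ratio j l x = real K / 2 ^ (d - 1) * (branch (Suc j) l x / branch j l x)"

definition gain :: "nat \<Rightarrow> nat \<Rightarrow> (nat \<Rightarrow> real) \<Rightarrow> real" where
  "gain j n x = (\<Prod>l<n. ratio j l x)"

definition mass :: "nat \<Rightarrow> (nat \<Rightarrow> real) \<Rightarrow> real" where
  "mass n x = measure M {i. n \<le> lv i \<and> cl n (pt i) = cl n x}"

lemma M_mono: "A \<subseteq> B \<Longrightarrow> measure M A \<le> measure M B"
  by (rule finite_measure.finite_measure_mono[OF fin]) (simp_all add: sets_M)

lemma coarsen: "l \<le> n \<Longrightarrow> cl n u = cl n v \<Longrightarrow> cl l u = cl l v"
  using K by (intro cell_coarsen[of K l n]) simp_all

lemma branch_d: "branch d l x = mass (Suc l) x"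
proof -
  have "(l < lv i \<and> cl l (pt i) = cl l x \<and> (\<forall>j'<d. cl (Suc l) (pt i) ! j' = cl (Suc l) x ! j')) \<longleftrightarrow>
    (Suc l \<le> lv i \<and> cl (Suc l) (pt i) = cl (Suc l) x)" for i
  proof -
    have "(\<forall>j'<d. cl (Suc l) (pt i) ! j' = cl (Suc l) x ! j') \<longleftrightarrow> cl (Suc l) (pt i) = cl (Suc l) x"
      by (simp add: list_eq_iff_nth_eq del: nth_cell)
    then show ?thesis using coarsen[of l "Suc l" "pt i" x] by (metis Suc_leD Suc_le_eq le_Suc_eq)
  qed
  then show ?thesis unfolding branch_def mass_def by presburger
qed

text \<open>The inequality can be strict: a leaf that ends at level \<open>l\<close> contributes to
  \<open>mass l x\<close> but has no child to choose.\<close>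

lemma branch_0: "branch 0 l x \<le> mass l x"
  unfolding branch_def mass_def by (rule M_mono) auto

lemma branch_nonneg: "0 \<le> branch j l x"
  by (simp add: branch_def)

lemma ratio_nonneg: "0 \<le> ratio j l x"
  by (simp add: ratio_def branch_nonneg)

lemma gain_nonneg: "0 \<le> gain j n x"
  by (simp add: gain_def prod_nonneg ratio_nonneg)

lemma gain_cong:
  assumes "cl n x = cl n y"
  shows "gain j n x = gain j n y"
  unfolding gain_def
proof (rule prod.cong[OF refl])
  fix l assume "l \<in> {..<n}"
  then have "cl l x = cl l y" "cl (Suc l) x = cl (Suc l) y"
    using coarsen[of l n x y] coarsen[of "Suc l" n x y] assms by auto
  then show "ratio j l x = ratio j l y" by (simp add: ratio_def branch_def)
qed

lemma prod_telescope:
  fixes f :: "nat \<Rightarrow> real"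
  assumes "\<And>j. j \<le> m \<Longrightarrow> f j \<noteq> 0"
  shows "(\<Prod>j<m. c * (f (Suc j) / f j)) = c ^ m * (f m / f 0)"
  using assms by (induction m) (auto simp: field_simps)

text \<open>Over \<open>j\<close> the conditional probabilities telescope to the mass of the child
  divided by the mass strictly below the parent, so one level contributes this quotient times
  \<open>(K / 2 ^ (d - 1)) ^ d\<close>. The choice of \<open>K\<close> makes the latter at least
  \<open>K powr s\<close>, and the resulting growth \<open>K powr (s * lv i)\<close> cancels against
  the lower bound on the weight of the leaf. The reciprocal of the total mass remains.\<close>

lemma gain_lower:
  assumes s: "real (2 ^ (d * (d - 1))) \<le> real K powr (real d - s)"
    and w: "real K powr (- s * lv i) \<le> measure M {i}"
    and tot: "measure M UNIV \<le> \<eta>" and \<eta>: "0 < \<eta>"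
    and x: "cl (lv i) x = cl (lv i) (pt i)"
  shows "1 / \<eta> \<le> (\<Prod>j<d. gain j (lv i) x)"
proof -
  have K0: "0 < real K" using K by simp
  have pos: "0 < measure M {i}" by (rule less_le_trans[OF _ w]) (use K0 in simp)
  have bpos: "0 < branch j l x" if "l < lv i" "j \<le> d" for j l
  proof -
    have "cl l (pt i) = cl l x" "cl (Suc l) (pt i) = cl (Suc l) x"
      using x that coarsen[of l "lv i" x "pt i"] coarsen[of "Suc l" "lv i" x "pt i"] by auto
    then have "{i} \<subseteq> {i. l < lv i \<and> cl l (pt i) = cl l x \<and>
     (\<forall>j'<j. cl (Suc l) (pt i) ! j' = cl (Suc l) x ! j')}" using that(1) by (simp del: nth_cell)
    then show ?thesis unfolding branch_def by (rule less_le_trans[OF pos M_mono])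
  qed
  have c: "real K powr s \<le> (real K / 2 ^ (d - 1)) ^ d"
  proof -
    have "real K ^ d = real K powr (real d - s) * real K powr s"
      using K0 by (simp add: powr_add[symmetric] powr_realpow)
    moreover have "2 ^ (d * (d - 1)) * real K powr s \<le> real K powr (real d - s) * real K powr s"
      using s by (intro mult_right_mono) auto
    ultimately have "2 ^ (d * (d - 1)) * real K powr s \<le> real K ^ d" by simp
    then have "real K powr s \<le> real K ^ d / 2 ^ (d * (d - 1))"
      by (simp add: pos_le_divide_eq mult.commute)
    also have "\<dots> = (real K / 2 ^ (d - 1)) ^ d"
      by (simp add: power_divide power_mult[symmetric] mult.commute)
    finally show ?thesis .
  qed
  have main: "n \<le> lv i \<Longrightarrow> real K powr (s * n) * mass n x / \<eta> \<le> (\<Prod>j<d. gain j n x)" for n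
  proof (induction n)
    case 0
    have "mass 0 x \<le> \<eta>" unfolding mass_def using M_mono[of _ UNIV] tot by (meson order_trans subset_UNIV)
    then show ?case using \<eta> K0 by (simp add: gain_def)
  next
    case (Suc n)
    have b0: "0 < branch 0 n x" using bpos Suc.prems by auto
    have "real K powr (s * Suc n) * mass (Suc n) x / \<eta>
        = (real K powr (s * n) * branch 0 n x / \<eta>) * (real K powr s * (mass (Suc n) x / branch 0 n x))"
      using b0 K0 by (simp add: powr_add[symmetric] algebra_simps)
    also have "\<dots> \<le> (real K powr (s * n) * mass n x / \<eta>) * ((real K / 2 ^ (d - 1)) ^ d * (mass (Suc n) x / branch 0 n x))"
      using c \<eta> b0 branch_0[of n x]
      by (intro mult_mono divide_right_mono mult_left_mono) (auto simp: mass_def)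
    also have "(real K / 2 ^ (d - 1)) ^ d * (mass (Suc n) x / branch 0 n x) = (\<Prod>j<d. ratio j n x)"
      unfolding ratio_def using bpos[of n] Suc.prems
      by (subst prod_telescope) (force simp: branch_d)+
    also have "(real K powr (s * n) * mass n x / \<eta>) * (\<Prod>j<d. ratio j n x) \<le> (\<Prod>j<d. gain j n x) * (\<Prod>j<d. ratio j n x)"
      using Suc by (intro mult_right_mono prod_nonneg ratio_nonneg) auto
    also have "\<dots> = (\<Prod>j<d. gain j (Suc n) x)"
      by (simp add: gain_def prod.distrib[symmetric])
    finally show ?case .
  qed
  have "1 = real K powr (s * lv i) * real K powr (- s * lv i)"
    using K0 by (simp add: powr_add[symmetric])
  also have "\<dots> \<le> real K powr (s * lv i) * measure M {i}"
    using w by (intro mult_left_mono) auto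
  also have "\<dots> \<le> real K powr (s * lv i) * mass (lv i) x"
    unfolding mass_def using x by (intro mult_left_mono M_mono) auto
  finally have "1 / \<eta> \<le> real K powr (s * lv i) * mass (lv i) x / \<eta>"
    using \<eta> by (intro divide_right_mono) auto
  also have "\<dots> \<le> (\<Prod>j<d. gain j (lv i) x)" by (rule main) simp
  finally show ?thesis .
qed

lemma gain_measurable:
  assumes "\<And>i. (\<lambda>t. u t i) \<in> borel_measurable N"
  shows "(\<lambda>t. gain j n (u t)) \<in> borel_measurable N"
proof -
  have "gain j n (u t) = (\<lambda>q. gain j n (SOME x. cl n x = q)) (cl n (u t))" for t
    by (rule gain_cong) (metis (mono_tags, lifting) someI)
  moreover have "(\<lambda>t. (\<lambda>q. gain j n (SOME x. cl n x = q)) (cl n (u t))) \<in> borel_measurable N"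
    by (rule measurable_compose[OF cell_measurable[OF assms]]) simp
  ultimately show ?thesis by simp
qed

text \<open>A set that is steep in direction \<open>j\<close> meets at most \<open>2 ^ (d - 1)\<close> of the lines of children
  parallel to the \<open>j\<close>-th axis, and on each of these lines the ratios are conditional probabilities,
  scaled by \<open>K / 2 ^ (d - 1)\<close>.\<close>

lemma sum_ratio_le:
  assumes j: "j < d" and fQ: "finite Q" and Q: "\<And>q. q \<in> Q \<Longrightarrow> cl (Suc l) (r q) = q \<and> cl l (r q) = cl l x"
    and near: "\<And>q q' i. q \<in> Q \<Longrightarrow> q' \<in> Q \<Longrightarrow> i < d \<Longrightarrow> i \<noteq> j \<Longrightarrow> \<bar>q ! i - q' ! i\<bar> \<le> 1"
  shows "(\<Sum>q\<in>Q. ratio j l (r q)) \<le> real K"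
proof -
  let ?p = "\<lambda>q :: int list. q[j := 0]"
  let ?c = "real K / 2 ^ (d - 1)"
  have len: "length q = d" if "q \<in> Q" for q using Q[OF that] by (metis length_cell)
  \<comment> \<open>A fibre of \<open>?p\<close> is a line of children parallel to the axis
    \<open>j\<close>. Its members share the denominator \<open>branch j\<close>, and the events
    behind the numerators are disjoint subsets of the event behind the denominator.\<close>
  have fiber: "(\<Sum>q\<in>{q \<in> Q. ?p q = y}. ratio j l (r q)) \<le> ?c" if y: "y \<in> ?p ` Q" for y
  proof -
    let ?F = "{q \<in> Q. ?p q = y}"
    obtain q0 where q0: "q0 \<in> ?F" using y by auto
    have agree: "q ! i = q0 ! i" if "q \<in> ?F" "i < d" "i \<noteq> j" for q i
      using that q0 by (metis (mono_tags, lifting) mem_Collect_eq nth_list_update_neq)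
    define Ev where "Ev q = {i. l < lv i \<and> cl l (pt i) = cl l x \<and> (\<forall>j'<Suc j. cl (Suc l) (pt i) ! j' = q ! j')}" for q
    define B where "B = branch j l (r q0)"
    have b1: "branch (Suc j) l (r q) = measure M (Ev q)" if "q \<in> ?F" for q
      using that Q[of q] by (simp add: branch_def Ev_def)
    have b0: "branch j l (r q) = B" if "q \<in> ?F" for q
    proof -
      have "\<forall>j'<j. q ! j' = q0 ! j'" using agree[OF that] j by auto
      then show ?thesis using that q0 Q[of q] Q[of q0] by (simp add: B_def branch_def)
    qed
    have disj: "disjoint_family_on Ev ?F"
      unfolding disjoint_family_on_def
    proof (intro ballI impI)
      fix q q' assume q: "q \<in> ?F" "q' \<in> ?F" "q \<noteq> q'"
      have "q ! j \<noteq> q' ! j"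
      proof
        assume "q ! j = q' ! j"
        then have "q ! i = q' ! i" if "i < d" for i using agree[OF q(1) that] agree[OF q(2) that] by (cases "i = j") auto
        then have "q = q'" using len q by (auto intro!: nth_equalityI)
        with q show False by simp
      qed
      then show "Ev q \<inter> Ev q' = {}" unfolding Ev_def by (auto simp del: nth_cell)
    qed
    have "(\<Sum>q\<in>?F. branch (Suc j) l (r q)) = (\<Sum>q\<in>?F. measure M (Ev q))"
      by (rule sum.cong) (auto simp: b1)
    also have "\<dots> = measure M (\<Union>q\<in>?F. Ev q)"
      using fQ disj by (intro finite_measure.finite_measure_finite_Union[OF fin, symmetric]) (auto simp: sets_M)
    also have "\<dots> \<le> B"
      unfolding B_def branch_def
    proof (rule M_mono, rule UN_least)
      fix q assume q: "q \<in> ?F"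
      have "\<forall>j'<j. q ! j' = cl (Suc l) (r q0) ! j'" using agree[OF q] j Q[of q0] q0 by auto
      then show "Ev q \<subseteq> {i. l < lv i \<and> cl l (pt i) = cl l (r q0) \<and>
          (\<forall>j'<j. cl (Suc l) (pt i) ! j' = cl (Suc l) (r q0) ! j')}"
        using Q[of q0] q0 unfolding Ev_def by (auto simp del: nth_cell)
    qed
    finally have sumB: "(\<Sum>q\<in>?F. branch (Suc j) l (r q)) \<le> B" .
    have B0: "0 \<le> B" by (simp add: B_def branch_nonneg)
    have "(\<Sum>q\<in>?F. ratio j l (r q)) = (\<Sum>q\<in>?F. ?c * (branch (Suc j) l (r q) / B))"
      by (rule sum.cong) (auto simp: ratio_def b0)
    also have "\<dots> = ?c * ((\<Sum>q\<in>?F. branch (Suc j) l (r q)) / B)"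
      by (simp add: sum_distrib_left sum_divide_distrib)
    also have "\<dots> \<le> ?c * 1"
      using sumB B0 by (intro mult_left_mono) (auto simp: divide_le_eq_1)
    finally show ?thesis by simp
  qed
  \<comment> \<open>In a transverse coordinate the indices differ by at most one, so only the
    minimum \<open>m i\<close> and its successor occur. A line is thus determined by a subset of the
    \<open>d - 1\<close> transverse coordinates.\<close>
  have card: "card (?p ` Q) \<le> 2 ^ (d - 1)"
  proof -
    define m where "m i = Min ((\<lambda>q. q ! i) ` Q)" for i
    have m: "q ! i = m i \<or> q ! i = m i + 1" if "q \<in> Q" "i < d" "i \<noteq> j" for q i
    proof -
      have "m i \<in> (\<lambda>q. q ! i) ` Q" unfolding m_def using fQ that by (intro Min_in) auto
      then obtain q' where "q' \<in> Q" "m i = q' ! i" by auto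
      moreover have "m i \<le> q ! i" unfolding m_def using fQ that by (intro Min_le) auto
      ultimately show ?thesis using near[of q q' i] that by auto
    qed
    let ?\<phi> = "\<lambda>y. {i. i < d \<and> i \<noteq> j \<and> y ! i = m i + 1}"
    have "inj_on ?\<phi> (?p ` Q)"
    proof (rule inj_onI)
      fix y y' assume y: "y \<in> ?p ` Q" "y' \<in> ?p ` Q" and eq: "?\<phi> y = ?\<phi> y'"
      then obtain q q' where q: "q \<in> Q" "q' \<in> Q" "y = ?p q" "y' = ?p q'" by auto
      show "y = y'"
      proof (rule nth_equalityI)
        show "length y = length y'" using q len by simp
        fix i assume "i < length y"
        then have i: "i < d" using q len by simp
        show "y ! i = y' ! i"
        proof (cases "i = j")
          case True then show ?thesis using q len i by simp
        next
          case False
          then have "y ! i = q ! i" "y' ! i = q' ! i" using q by auto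
          moreover have "y ! i = m i + 1 \<longleftrightarrow> y' ! i = m i + 1" using eq i False by blast
          ultimately show ?thesis using m[OF q(1) i False] m[OF q(2) i False] by auto
        qed
      qed
    qed
    moreover have "?\<phi> ` (?p ` Q) \<subseteq> Pow ({..<d} - {j})" by auto
    ultimately have "card (?p ` Q) \<le> card (Pow ({..<d} - {j}))"
      by (rule card_inj_on_le) auto
    then show ?thesis using j by (simp add: card_Pow)
  qed
  have "(\<Sum>q\<in>Q. ratio j l (r q)) = (\<Sum>y\<in>?p ` Q. \<Sum>q\<in>{q \<in> Q. ?p q = y}. ratio j l (r q))"
    using fQ by (rule sum.image_gen)
  also have "\<dots> \<le> (\<Sum>y\<in>?p ` Q. ?c)" by (rule sum_mono) (rule fiber)
  also have "\<dots> = real (card (?p ` Q)) * ?c" by simp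
  also have "\<dots> \<le> 2 ^ (d - 1) * ?c"
    using card by (intro mult_right_mono) (auto simp: numeral_power_le_of_nat_cancel_iff of_nat_le_numeral_power_cancel_iff)
  also have "\<dots> = real K" by simp
  finally show ?thesis .
qed

text \<open>Doob's maximal inequality, by induction on the number \<open>N - l\<close> of remaining
  levels. Once \<open>gain j l x\<close> has reached \<open>\<tau>\<close>, it is enough that a
  steep curve spends time at most \<open>C / K ^ l\<close> in a cube of level \<open>l\<close>.
  Otherwise the estimates for the children are summed, and the bound \<open>K\<close> of
  \<open>sum_ratio_le\<close> turns \<open>K ^ Suc l\<close> in their denominators back into
  \<open>K ^ l\<close>.\<close>

lemma gain_upper:
  assumes j: "j < d" and D: "D \<in> sets borel" and u: "\<And>i. (\<lambda>t. u t i) \<in> borel_measurable borel"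
    and C: "0 \<le> C" "\<And>s t. s \<in> D \<Longrightarrow> t \<in> D \<Longrightarrow> \<bar>s - t\<bar> \<le> C * \<bar>u s j - u t j\<bar>"
    and cone: "\<And>s t i. s \<in> D \<Longrightarrow> t \<in> D \<Longrightarrow> i < d \<Longrightarrow> i \<noteq> j \<Longrightarrow> \<bar>u s i - u t i\<bar> \<le> \<bar>u s j - u t j\<bar> / real K"
    and \<tau>: "0 < \<tau>" and "l \<le> N"
  shows "emeasure lborel {t \<in> D. cl l (u t) = cl l x \<and> (\<exists>n. l \<le> n \<and> n \<le> N \<and> \<tau> \<le> gain j n (u t))}
    \<le> ennreal (C * gain j l x / (\<tau> * real K ^ l))"
  using \<open>l \<le> N\<close>
proof (induction "N - l" arbitrary: l x)
  have K0: "0 < real K" using K by simp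
  have meas: "{t \<in> D. cl l (u t) = cl l x \<and> (\<exists>n. l \<le> n \<and> n \<le> N \<and> \<tau> \<le> gain j n (u t))} \<in> sets borel"
    and measD: "{t \<in> D. cl l (u t) = cl l x} \<in> sets borel" for l x
  proof -
    have A: "{t. cl l (u t) = cl l x} \<in> sets borel"
      using measurable_sets[OF cell_measurable[OF u], of "{cl l x}" d K l] by (simp add: vimage_def)
    have B: "{t. \<tau> \<le> gain j n (u t)} \<in> sets borel" for n
      using gain_measurable[OF u, of j n] by measurable
    have "{t \<in> D. cl l (u t) = cl l x \<and> (\<exists>n. l \<le> n \<and> n \<le> N \<and> \<tau> \<le> gain j n (u t))} =
        D \<inter> {t. cl l (u t) = cl l x} \<inter> (\<Union>n\<in>{l..N}. {t. \<tau> \<le> gain j n (u t)})" by auto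
    then show "{t \<in> D. cl l (u t) = cl l x \<and> (\<exists>n. l \<le> n \<and> n \<le> N \<and> \<tau> \<le> gain j n (u t))} \<in> sets borel"
      using A B D by (metis (no_types, lifting) sets.Int sets.finite_UN finite_atLeastAtMost)
    have "{t \<in> D. cl l (u t) = cl l x} = D \<inter> {t. cl l (u t) = cl l x}" by auto
    then show "{t \<in> D. cl l (u t) = cl l x} \<in> sets borel" using A D by simp
  qed
  have large: "emeasure lborel {t \<in> D. cl l (u t) = cl l x \<and> (\<exists>n. l \<le> n \<and> n \<le> N \<and> \<tau> \<le> gain j n (u t))}
    \<le> ennreal (C * gain j l x / (\<tau> * real K ^ l))" if g: "\<tau> \<le> gain j l x" for l x
  proof -
    have "emeasure lborel {t \<in> D. cl l (u t) = cl l x \<and> (\<exists>n. l \<le> n \<and> n \<le> N \<and> \<tau> \<le> gain j n (u t))}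
      \<le> emeasure lborel {t \<in> D. cl l (u t) = cl l x}"
      by (rule emeasure_mono) (auto simp only: sets_lborel intro: measD)
    also have "\<dots> \<le> ennreal (C / real K ^ l)"
    proof (rule emeasure_le_diam[OF measD])
      fix s t assume st: "s \<in> {t \<in> D. cl l (u t) = cl l x}" "t \<in> {t \<in> D. cl l (u t) = cl l x}"
      then have "\<lfloor>real K ^ l * u s j\<rfloor> = \<lfloor>real K ^ l * u t j\<rfloor>" using j by (simp add: cell_eq_iff)
      then have "\<bar>real K ^ l * u s j - real K ^ l * u t j\<bar> \<le> 1" by linarith
      then have "real K ^ l * \<bar>u s j - u t j\<bar> \<le> 1"
        by (simp add: right_diff_distrib[symmetric] abs_mult)
      then have "\<bar>u s j - u t j\<bar> \<le> 1 / real K ^ l" using K0 by (simp add: field_simps)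
      then have "C * \<bar>u s j - u t j\<bar> \<le> C * (1 / real K ^ l)" by (rule mult_left_mono[OF _ C(1)])
      then show "\<bar>s - t\<bar> \<le> C / real K ^ l" using C(2)[of s t] st by simp
    qed
    also have "\<dots> \<le> ennreal (C * gain j l x / (\<tau> * real K ^ l))"
    proof (rule ennreal_leI)
      have "C * 1 \<le> C * (gain j l x / \<tau>)" using g \<tau> C(1) by (intro mult_left_mono) auto
      then have "C / real K ^ l \<le> C * (gain j l x / \<tau>) / real K ^ l" by (intro divide_right_mono) auto
      then show "C / real K ^ l \<le> C * gain j l x / (\<tau> * real K ^ l)" by simp
    qed
    finally show ?thesis .
  qed
  {
    case (0 l x)
    show ?case
    proof (cases "\<tau> \<le> gain j l x")
      case False
      have "l = N" using 0 by simp
      have "\<not> \<tau> \<le> gain j n (u t)" if "cl l (u t) = cl l x" "l \<le> n" "n \<le> N" for t n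
      proof -
        have "n = l" using that \<open>l = N\<close> by simp
        then show ?thesis using False gain_cong[OF that(1), of j] by simp
      qed
      then have "{t \<in> D. cl l (u t) = cl l x \<and> (\<exists>n. l \<le> n \<and> n \<le> N \<and> \<tau> \<le> gain j n (u t))} = {}"
        by blast
      then show ?thesis by (simp only: emeasure_empty zero_le)
    qed (rule large)
  next
    case (Suc m l x)
    show ?case
    proof (cases "\<tau> \<le> gain j l x")
      case False
      let ?A = "\<lambda>l x. {t \<in> D. cl l (u t) = cl l x \<and> (\<exists>n. l \<le> n \<and> n \<le> N \<and> \<tau> \<le> gain j n (u t))}"
      define Dl where "Dl = {t \<in> D. cl l (u t) = cl l x}"
      define Q where "Q = (\<lambda>t. cl (Suc l) (u t)) ` Dl"
      define r where "r q = u (SOME t. t \<in> Dl \<and> cl (Suc l) (u t) = q)" for q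
      have r: "cl (Suc l) (r q) = q \<and> cl l (r q) = cl l x" if "q \<in> Q" for q
      proof -
        have "\<exists>t. t \<in> Dl \<and> cl (Suc l) (u t) = q" using that by (auto simp: Q_def)
        from someI_ex[OF this] show ?thesis by (simp add: r_def Dl_def)
      qed
      have sc: "\<bar>real K ^ l * u s j - real K ^ l * u t j\<bar> \<le> 1" if "s \<in> Dl" "t \<in> Dl" for s t
      proof -
        have "\<lfloor>real K ^ l * u s j\<rfloor> = \<lfloor>real K ^ l * u t j\<rfloor>" using j that by (simp add: cell_eq_iff Dl_def)
        then show ?thesis by linarith
      qed
      have fQ: "finite Q"
      proof (rule finite_subset)
        let ?S = "\<Union>i<d. {int K * \<lfloor>real K ^ l * x i\<rfloor>..int K * \<lfloor>real K ^ l * x i\<rfloor> + int K}"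
        show "Q \<subseteq> {q. set q \<subseteq> ?S \<and> length q = d}"
        proof safe
          fix q z assume "q \<in> Q" "z \<in> set q"
          then obtain t i where t: "t \<in> Dl" "i < d" "z = \<lfloor>real K ^ Suc l * u t i\<rfloor>"
            by (auto simp: Q_def in_set_conv_nth simp del: power_Suc)
          have fl: "\<lfloor>real K ^ l * u t i\<rfloor> = \<lfloor>real K ^ l * x i\<rfloor>" using t by (simp add: Dl_def cell_eq_iff)
          have "\<lfloor>real K ^ l * u t i\<rfloor> = z div int K"
            using floor_power_coarsen[of K l "Suc l" "u t i"] t(3) K by simp
          then have "int K * \<lfloor>real K ^ l * x i\<rfloor> = z - z mod int K"
            using fl by (simp add: minus_mod_eq_mult_div)
          moreover have "0 \<le> z mod int K" "z mod int K < int K" using K by simp_all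
          ultimately have "z \<in> {int K * \<lfloor>real K ^ l * x i\<rfloor>..int K * \<lfloor>real K ^ l * x i\<rfloor> + int K}" by simp
          then show "z \<in> ?S" using t(2) by blast
        qed (auto simp: Q_def)
        show "finite {q. set q \<subseteq> ?S \<and> length q = d}"
          by (intro finite_lists_length_eq) auto
      qed
      \<comment> \<open>Inside a cube of level \<open>l\<close> the coordinate \<open>j\<close>
        varies by at most \<open>1 / K ^ l\<close>, so by \<open>cone\<close> the others vary by at
        most \<open>1 / K ^ Suc l\<close>, the side of a child.\<close>
      have near: "\<bar>q ! i - q' ! i\<bar> \<le> 1" if q: "q \<in> Q" "q' \<in> Q" and i: "i < d" "i \<noteq> j" for q q' i
      proof -
        obtain s t where st: "s \<in> Dl" "t \<in> Dl" "q ! i = \<lfloor>real K ^ Suc l * u s i\<rfloor>" "q' ! i = \<lfloor>real K ^ Suc l * u t i\<rfloor>"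
          using q i by (auto simp: Q_def simp del: power_Suc)
        have "\<bar>real K ^ Suc l * u s i - real K ^ Suc l * u t i\<bar> = real K ^ Suc l * \<bar>u s i - u t i\<bar>"
          by (simp add: right_diff_distrib[symmetric] abs_mult del: power_Suc)
        also have "\<dots> \<le> real K ^ Suc l * (\<bar>u s j - u t j\<bar> / real K)"
          using st i by (intro mult_left_mono cone) (auto simp: Dl_def)
        also have "\<dots> = \<bar>real K ^ l * u s j - real K ^ l * u t j\<bar>"
          using K0 by (simp add: right_diff_distrib[symmetric] abs_mult)
        also have "\<dots> \<le> 1" by (rule sc[OF st(1,2)])
        finally have "\<bar>real K ^ Suc l * u s i - real K ^ Suc l * u t i\<bar> \<le> 1" .
        then show ?thesis unfolding st(3,4) by linarith
      qed
      have sub: "?A l x \<subseteq> (\<Union>q\<in>Q. ?A (Suc l) (r q))"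
      proof
        fix t assume t: "t \<in> ?A l x"
        then obtain n where n: "l \<le> n" "n \<le> N" "\<tau> \<le> gain j n (u t)" by auto
        have "n \<noteq> l" using n(3) False gain_cong[of l "u t" x j] t by auto
        then have "Suc l \<le> n" using n(1) by simp
        moreover have tD: "t \<in> Dl" using t by (simp add: Dl_def)
        moreover have qQ: "cl (Suc l) (u t) \<in> Q" using tD by (simp add: Q_def)
        moreover have "cl (Suc l) (u t) = cl (Suc l) (r (cl (Suc l) (u t)))" using r[OF qQ] by simp
        moreover have "t \<in> D" using t by simp
        ultimately have "t \<in> ?A (Suc l) (r (cl (Suc l) (u t)))" using n(2,3)
          by (intro CollectI conjI exI[of _ n])
        then show "t \<in> (\<Union>q\<in>Q. ?A (Suc l) (r q))" by (rule UN_I[OF qQ])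
      qed
      have "emeasure lborel (?A l x) \<le> emeasure lborel (\<Union>q\<in>Q. ?A (Suc l) (r q))"
        by (rule emeasure_mono[OF sub]) (unfold sets_lborel, intro sets.finite_UN fQ meas)
      also have "\<dots> \<le> (\<Sum>q\<in>Q. emeasure lborel (?A (Suc l) (r q)))"
        by (rule emeasure_subadditive_finite[OF fQ]) (unfold sets_lborel, rule image_subsetI, rule meas)
      also have "\<dots> \<le> (\<Sum>q\<in>Q. ennreal (C * gain j (Suc l) (r q) / (\<tau> * real K ^ Suc l)))"
        using Suc.hyps(2) by (intro sum_mono Suc.hyps(1)) auto
      also have "\<dots> = ennreal (\<Sum>q\<in>Q. C * gain j (Suc l) (r q) / (\<tau> * real K ^ Suc l))"
        using C \<tau> by (intro sum_ennreal) (auto intro!: divide_nonneg_nonneg mult_nonneg_nonneg gain_nonneg)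
      also have "(\<Sum>q\<in>Q. C * gain j (Suc l) (r q) / (\<tau> * real K ^ Suc l))
          = (C * gain j l x / (\<tau> * real K ^ Suc l)) * (\<Sum>q\<in>Q. ratio j l (r q))"
      proof -
        have "gain j (Suc l) (r q) = gain j l x * ratio j l (r q)" if "q \<in> Q" for q
          using gain_cong[of l "r q" x j] r[OF that] by (simp add: gain_def)
        then show ?thesis by (simp add: sum_distrib_left mult.assoc mult.left_commute)
      qed
      also have "\<dots> \<le> (C * gain j l x / (\<tau> * real K ^ Suc l)) * real K"
        using C(1) \<tau> sum_ratio_le[OF j fQ r near]
        by (intro mult_left_mono) (auto intro!: divide_nonneg_nonneg mult_nonneg_nonneg gain_nonneg)
      also have "\<dots> = C * gain j l x / (\<tau> * real K ^ l)" using K0 \<tau> by (simp add: field_simps)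
      finally show ?thesis by (simp add: ennreal_leI)
    qed (rule large)
  }
qed

text \<open>\<open>gain_upper\<close> started at level 0, where the gain is the empty product 1, and
  continuity of the measure as \<open>N\<close> grows. The estimate is one per cube of level 0,
  whence \<open>one\<close>.\<close>

lemma gain_upper_unbounded:
  assumes j: "j < d" and D: "D \<in> sets borel" and u: "\<And>i. (\<lambda>t. u t i) \<in> borel_measurable borel"
    and C: "0 \<le> C" "\<And>s t. s \<in> D \<Longrightarrow> t \<in> D \<Longrightarrow> \<bar>s - t\<bar> \<le> C * \<bar>u s j - u t j\<bar>"
    and cone: "\<And>s t i. s \<in> D \<Longrightarrow> t \<in> D \<Longrightarrow> i < d \<Longrightarrow> i \<noteq> j \<Longrightarrow> \<bar>u s i - u t i\<bar> \<le> \<bar>u s j - u t j\<bar> / real K"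
    and \<tau>: "0 < \<tau>" and one: "\<And>t. t \<in> D \<Longrightarrow> cl 0 (u t) = q"
  shows "emeasure lborel {t \<in> D. \<exists>n. \<tau> \<le> gain j n (u t)} \<le> ennreal (C / \<tau>)"
proof (cases "D = {}")
  case False
  then obtain t0 where t0: "t0 \<in> D" by blast
  let ?A = "\<lambda>N. {t \<in> D. \<exists>n\<le>N. \<tau> \<le> gain j n (u t)}"
  have B: "{t. \<tau> \<le> gain j n (u t)} \<in> sets borel" for n
    using gain_measurable[OF u, of j n] by measurable
  have "?A N = D \<inter> (\<Union>n\<in>{..N}. {t. \<tau> \<le> gain j n (u t)})" for N by auto
  then have meas: "?A N \<in> sets borel" for N using B D by (metis (no_types, lifting) sets.Int sets.finite_UN finite_atMost)
  have "emeasure lborel (?A N) \<le> ennreal (C / \<tau>)" for N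
  proof -
    have "?A N = {t \<in> D. cl 0 (u t) = cl 0 (u t0) \<and> (\<exists>n. 0 \<le> n \<and> n \<le> N \<and> \<tau> \<le> gain j n (u t))}"
      using one t0 by auto
    moreover have "emeasure lborel {t \<in> D. cl 0 (u t) = cl 0 (u t0) \<and> (\<exists>n. 0 \<le> n \<and> n \<le> N \<and> \<tau> \<le> gain j n (u t))}
        \<le> ennreal (C * gain j 0 (u t0) / (\<tau> * real K ^ 0))"
      by (rule gain_upper) (fact j D u C cone \<tau> le0)+
    ultimately show ?thesis by (simp add: gain_def[of j 0])
  qed
  then have "(SUP N. emeasure lborel (?A N)) \<le> ennreal (C / \<tau>)" by (intro SUP_least)
  also have "(SUP N. emeasure lborel (?A N)) = emeasure lborel (\<Union>N. ?A N)"
  proof (rule SUP_emeasure_incseq)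
    show "range ?A \<subseteq> sets lborel" unfolding sets_lborel by (rule image_subsetI) (rule meas)
    show "incseq ?A"
    proof (rule incseq_SucI, rule subsetI)
      fix N t assume "t \<in> ?A N"
      then obtain n where "t \<in> D" "n \<le> N" "\<tau> \<le> gain j n (u t)" by blast
      then show "t \<in> ?A (Suc N)" by (intro CollectI conjI exI[of _ n]) simp_all
    qed
  qed
  also have "(\<Union>N. ?A N) = {t \<in> D. \<exists>n. \<tau> \<le> gain j n (u t)}"
  proof (intro set_eqI iffI)
    fix t assume "t \<in> {t \<in> D. \<exists>n. \<tau> \<le> gain j n (u t)}"
    then obtain n where "t \<in> ?A n" by auto
    then show "t \<in> (\<Union>N. ?A N)" by (rule UN_I[OF UNIV_I])
  qed auto
  finally show ?thesis .
qed simp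

end

section \<open>Sets null for fragments in a given direction\<close>

text \<open>\<open>\<Phi>\<close> will be the identity or the graph map of some \<open>F\<close>; in
  the second case \<open>v\<close> is a pair that prescribes the velocities of
  \<open>\<gamma>\<close> and \<open>F \<circ> \<gamma>\<close> together. The condition is on
  increments, so that it passes to compact subsets of \<open>D\<close> without exceptional
  sets.\<close>

definition dir_frag :: "('x::topological_space \<Rightarrow> 'y::real_normed_vector) \<Rightarrow> 'y \<Rightarrow> real \<Rightarrow> real set \<Rightarrow> (real \<Rightarrow> 'x) \<Rightarrow> bool" where
  "dir_frag \<Phi> v \<rho> D \<gamma> \<longleftrightarrow> compact D \<and> continuous_on D \<gamma> \<and>
     (\<forall>s\<in>D. \<forall>t\<in>D. norm (\<Phi> (\<gamma> t) - \<Phi> (\<gamma> s) - (t - s) *\<^sub>R v) \<le> \<rho> * \<bar>t - s\<bar>)"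

definition dir_null :: "('x::topological_space \<Rightarrow> 'y::real_normed_vector) \<Rightarrow> 'y \<Rightarrow> real \<Rightarrow> 'x set \<Rightarrow> bool" where
  "dir_null \<Phi> v \<rho> A \<longleftrightarrow> A \<in> sets borel \<and>
     (\<forall>D \<gamma>. dir_frag \<Phi> v \<rho> D \<gamma> \<longrightarrow> {t \<in> D. \<gamma> t \<in> A} \<in> null_sets lborel)"

lemma continuous_on_preimage_borel:
  assumes "compact D" "continuous_on D \<gamma>" "A \<in> sets borel"
  shows "{t \<in> D. \<gamma> t \<in> A} \<in> sets (borel :: real measure)"
proof -
  have D: "D \<in> sets borel" using assms(1) by (rule borel_compact)
  have "\<gamma> -` A \<inter> space (restrict_space borel D) \<in> sets (restrict_space borel D)"
    by (rule measurable_sets[OF borel_measurable_continuous_on_restrict[OF assms(2)] assms(3)])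
  moreover have "\<gamma> -` A \<inter> space (restrict_space borel D) = {t \<in> D. \<gamma> t \<in> A}"
    by (auto simp: space_restrict_space)
  ultimately show ?thesis using D by (simp add: sets_restrict_space_iff)
qed

lemma dir_frag_subset: "dir_frag \<Phi> v \<rho> D \<gamma> \<Longrightarrow> D' \<subseteq> D \<Longrightarrow> compact D' \<Longrightarrow> dir_frag \<Phi> v \<rho> D' \<gamma>"
  unfolding dir_frag_def by (meson continuous_on_subset subsetD)

text \<open>Nullity passes between nearby directions at the price of a smaller radius. This reduces
  all directions to countably many.\<close>

lemma dir_null_mono:
  assumes "dir_null \<Phi> v \<rho> A" "dist v v' + \<rho>' \<le> \<rho>"
  shows "dir_null \<Phi> v' \<rho>' A"
proof -
  have "dir_frag \<Phi> v \<rho> D \<gamma>" if f: "dir_frag \<Phi> v' \<rho>' D \<gamma>" for D \<gamma>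
    unfolding dir_frag_def
  proof (intro conjI ballI)
    fix s t assume st: "s \<in> D" "t \<in> D"
    have "norm (\<Phi> (\<gamma> t) - \<Phi> (\<gamma> s) - (t - s) *\<^sub>R v)
        = norm ((\<Phi> (\<gamma> t) - \<Phi> (\<gamma> s) - (t - s) *\<^sub>R v') + (t - s) *\<^sub>R (v' - v))"
      by (simp add: algebra_simps)
    also have "\<dots> \<le> \<rho>' * \<bar>t - s\<bar> + \<bar>t - s\<bar> * dist v v'"
      using f st by (intro order_trans[OF norm_triangle_ineq] add_mono)
        (auto simp: dir_frag_def dist_norm norm_minus_commute)
    also have "\<dots> = (dist v v' + \<rho>') * \<bar>t - s\<bar>" by (simp add: algebra_simps)
    also have "\<dots> \<le> \<rho> * \<bar>t - s\<bar>" using assms(2) by (intro mult_right_mono) auto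
    finally show "norm (\<Phi> (\<gamma> t) - \<Phi> (\<gamma> s) - (t - s) *\<^sub>R v) \<le> \<rho> * \<bar>t - s\<bar>" .
  qed (use f in \<open>auto simp: dir_frag_def\<close>)
  then show ?thesis using assms(1) unfolding dir_null_def by blast
qed

lemma dir_null_UN:
  assumes "countable I" "\<And>i. i \<in> I \<Longrightarrow> dir_null \<Phi> v \<rho> (A i)"
  shows "dir_null \<Phi> v \<rho> (\<Union>i\<in>I. A i)"
  unfolding dir_null_def
proof (intro conjI allI impI)
  show "(\<Union>i\<in>I. A i) \<in> sets borel"
    using assms by (intro sets.countable_UN') (auto simp: dir_null_def)
  fix D \<gamma> assume "dir_frag \<Phi> v \<rho> D \<gamma>"
  then have "(\<Union>i\<in>I. {t \<in> D. \<gamma> t \<in> A i}) \<in> null_sets lborel"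
    using assms by (intro null_sets_UN') (auto simp: dir_null_def)
  moreover have "(\<Union>i\<in>I. {t \<in> D. \<gamma> t \<in> A i}) = {t \<in> D. \<gamma> t \<in> (\<Union>i\<in>I. A i)}" by auto
  ultimately show "{t \<in> D. \<gamma> t \<in> (\<Union>i\<in>I. A i)} \<in> null_sets lborel" by simp
qed

lemma has_vector_derivative_withinD:
  assumes "(f has_vector_derivative v) (at t within D)" "0 < e"
  obtains \<delta> where "0 < \<delta>" "\<And>s. s \<in> D \<Longrightarrow> \<bar>s - t\<bar> < \<delta> \<Longrightarrow> norm (f s - f t - (s - t) *\<^sub>R v) \<le> e * \<bar>s - t\<bar>"
  using assms unfolding has_vector_derivative_def has_derivative_within_alt by (auto simp: real_norm_def)

text \<open>If the derivative at \<open>t\<close> lies in the open ball about \<open>v\<close>, the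
  increment bound of \<open>dir_frag\<close> holds from \<open>t\<close> at scales depending on
  \<open>t\<close>. Countably many compact pieces, each with a common scale, make up all such
  times.\<close>

lemma dir_null_deriv:
  assumes A: "dir_null \<Phi> v \<rho> A" and D: "compact D" and \<gamma>: "continuous_on D \<gamma>" and \<Phi>: "continuous_on UNIV \<Phi>"
  shows "\<exists>N\<in>null_sets lborel. {t \<in> D. \<gamma> t \<in> A \<and>
     (\<exists>v'. dist v' v < \<rho> \<and> ((\<lambda>t. \<Phi> (\<gamma> t)) has_vector_derivative v') (at t within D))} \<subseteq> N"
proof -
  have c\<Phi>: "continuous_on D (\<lambda>t. \<Phi> (\<gamma> t))"
    by (rule continuous_on_compose2[OF \<Phi> \<gamma>]) auto
  define P where "P m t s \<longleftrightarrow> \<bar>s - t\<bar> < 1 / real (Suc m) \<longrightarrow> norm (\<Phi> (\<gamma> s) - \<Phi> (\<gamma> t) - (s - t) *\<^sub>R v) \<le> \<rho> * \<bar>s - t\<bar>" for m t s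
  define E where "E m = {t \<in> D. \<forall>s\<in>D. P m t s}" for m
  \<comment> \<open>The length \<open>1 / (2 * Suc m)\<close> is below the scale
    \<open>1 / Suc m\<close> of \<open>E m\<close>, so the estimate applies to any two times in one
    piece.\<close>
  define I where "I m k = {real_of_int k / real (2 * Suc m)..(real_of_int k + 1) / real (2 * Suc m)}" for m k
  have cE: "closed (E m)" for m
  proof -
    have "closed {t \<in> D. P m t s}" if "s \<in> D" for s
    proof -
      have "{t \<in> D. P m t s} = {t \<in> D. 1 / real (Suc m) \<le> \<bar>s - t\<bar>} \<union> {t \<in> D. norm (\<Phi> (\<gamma> s) - \<Phi> (\<gamma> t) - (s - t) *\<^sub>R v) \<le> \<rho> * \<bar>s - t\<bar>}"
        by (auto simp: P_def not_less)
      also have "closed \<dots>"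
        by (intro closed_Un continuous_on_closed_Collect_le continuous_intros c\<Phi> compact_imp_closed D)
      finally show ?thesis .
    qed
    then have "closed (D \<inter> (\<Inter>s\<in>D. {t \<in> D. P m t s}))"
      using compact_imp_closed[OF D] by (intro closed_Int closed_INT ballI)
    moreover have "D \<inter> (\<Inter>s\<in>D. {t \<in> D. P m t s}) = E m" by (auto simp: E_def)
    ultimately show ?thesis by simp
  qed
  have frag: "dir_frag \<Phi> v \<rho> (E m \<inter> I m k) \<gamma>" for m k
    unfolding dir_frag_def
  proof (intro conjI ballI)
    have "compact (D \<inter> (E m \<inter> I m k))"
      using D cE by (intro compact_Int_closed closed_Int) (auto simp: I_def)
    moreover have "D \<inter> (E m \<inter> I m k) = E m \<inter> I m k" by (auto simp: E_def)
    ultimately show "compact (E m \<inter> I m k)" by simp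
    show "continuous_on (E m \<inter> I m k) \<gamma>" by (rule continuous_on_subset[OF \<gamma>]) (auto simp: E_def)
    fix s t assume st: "s \<in> E m \<inter> I m k" "t \<in> E m \<inter> I m k"
    have "\<bar>t - s\<bar> \<le> (real_of_int k + 1) / real (2 * Suc m) - real_of_int k / real (2 * Suc m)"
      using st by (auto simp: I_def abs_le_iff)
    also have "\<dots> = 1 / real (2 * Suc m)" by (simp add: diff_divide_distrib[symmetric])
    also have "\<dots> < 1 / real (Suc m)" by (simp add: field_simps)
    finally show "norm (\<Phi> (\<gamma> t) - \<Phi> (\<gamma> s) - (t - s) *\<^sub>R v) \<le> \<rho> * \<bar>t - s\<bar>"
      using st by (auto simp: E_def P_def)
  qed
  define N where "N = (\<Union>m. \<Union>k. {t \<in> E m \<inter> I m k. \<gamma> t \<in> A})"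
  have "N \<in> null_sets lborel"
    unfolding N_def using A frag unfolding dir_null_def by (intro null_sets_UN') blast+
  moreover have "{t \<in> D. \<gamma> t \<in> A \<and>
     (\<exists>v'. dist v' v < \<rho> \<and> ((\<lambda>t. \<Phi> (\<gamma> t)) has_vector_derivative v') (at t within D))} \<subseteq> N"
  proof safe
    fix t v' assume t: "t \<in> D" "\<gamma> t \<in> A" and v': "dist v' v < \<rho>"
      and der: "((\<lambda>t. \<Phi> (\<gamma> t)) has_vector_derivative v') (at t within D)"
    obtain \<delta> where \<delta>: "0 < \<delta>" "\<And>s. s \<in> D \<Longrightarrow> \<bar>s - t\<bar> < \<delta> \<Longrightarrow>
        norm (\<Phi> (\<gamma> s) - \<Phi> (\<gamma> t) - (s - t) *\<^sub>R v') \<le> (\<rho> - dist v' v) * \<bar>s - t\<bar>"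
      using has_vector_derivative_withinD[OF der, of "\<rho> - dist v' v"] v' by auto
    obtain m where m: "1 / real (Suc m) < \<delta>" using nat_approx_posE[OF \<delta>(1)] by (metis inverse_eq_divide of_nat_Suc)
    define k where "k = \<lfloor>t * real (2 * Suc m)\<rfloor>"
    have "t \<in> E m"
      unfolding E_def P_def
    proof (intro CollectI conjI ballI impI)
      fix s assume s: "s \<in> D" "\<bar>s - t\<bar> < 1 / real (Suc m)"
      have "norm (\<Phi> (\<gamma> s) - \<Phi> (\<gamma> t) - (s - t) *\<^sub>R v)
          = norm ((\<Phi> (\<gamma> s) - \<Phi> (\<gamma> t) - (s - t) *\<^sub>R v') + (s - t) *\<^sub>R (v' - v))"
        by (simp add: algebra_simps)
      also have "\<dots> \<le> (\<rho> - dist v' v) * \<bar>s - t\<bar> + \<bar>s - t\<bar> * dist v' v"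
        using \<delta>(2)[OF s(1)] s(2) m by (intro order_trans[OF norm_triangle_ineq] add_mono) (auto simp: dist_norm)
      also have "\<dots> = \<rho> * \<bar>s - t\<bar>" by (simp add: algebra_simps)
      finally show "norm (\<Phi> (\<gamma> s) - \<Phi> (\<gamma> t) - (s - t) *\<^sub>R v) \<le> \<rho> * \<bar>s - t\<bar>" .
    qed (rule t)
    moreover have "t \<in> I m k"
    proof -
      have "real_of_int k \<le> t * real (2 * Suc m)" "t * real (2 * Suc m) \<le> real_of_int k + 1"
        unfolding k_def by linarith+
      moreover have "0 < real (2 * Suc m)" by simp
      ultimately show ?thesis unfolding I_def by (simp only: atLeastAtMost_iff pos_divide_le_eq pos_le_divide_eq)
    qed
    ultimately show "t \<in> N" using t unfolding N_def by blast
  qed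
  ultimately show ?thesis by blast
qed

section \<open>Almost everywhere differentiability of Lipschitz maps on subsets of the line\<close>

lemma lipschitz_real_extension:
  fixes h :: "real \<Rightarrow> real"
  assumes h: "L-lipschitz_on D h" and ne: "D \<noteq> {}"
  obtains g where "L-lipschitz_on UNIV g" "\<And>t. t \<in> D \<Longrightarrow> g t = h t"
proof -
  have L0: "0 \<le> L" using h by (rule lipschitz_on_nonneg)
  have hb: "\<bar>h s - h t\<bar> \<le> L * \<bar>s - t\<bar>" if "s \<in> D" "t \<in> D" for s t
    using lipschitz_onD[OF h that] by (simp add: dist_real_def)
  \<comment> \<open>McShane's extension: the largest \<open>L\<close>-Lipschitz function that agrees
    with \<open>h\<close> on \<open>D\<close>.\<close>
  define g where "g t = (INF s\<in>D. h s + L * \<bar>t - s\<bar>)" for t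
  obtain a where a: "a \<in> D" using ne by blast
  have bb: "bdd_below ((\<lambda>s. h s + L * \<bar>t - s\<bar>) ` D)" for t
  proof (rule bdd_belowI2)
    fix s assume s: "s \<in> D"
    have "L * \<bar>a - s\<bar> \<le> L * (\<bar>t - a\<bar> + \<bar>t - s\<bar>)" using L0 by (intro mult_left_mono) auto
    then show "h a - L * \<bar>t - a\<bar> \<le> h s + L * \<bar>t - s\<bar>"
      using hb[OF a s] by (simp add: algebra_simps)
  qed
  have half: "g t - L * \<bar>t - t'\<bar> \<le> g t'" for t t'
    unfolding g_def[of t']
  proof (rule cINF_greatest[OF ne])
    fix s assume s: "s \<in> D"
    have "g t \<le> h s + L * \<bar>t - s\<bar>" unfolding g_def by (rule cINF_lower[OF bb s])
    also have "L * \<bar>t - s\<bar> \<le> L * (\<bar>t - t'\<bar> + \<bar>t' - s\<bar>)" using L0 by (intro mult_left_mono) auto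
    finally show "g t - L * \<bar>t - t'\<bar> \<le> h s + L * \<bar>t' - s\<bar>" by (simp add: algebra_simps)
  qed
  have "L-lipschitz_on UNIV g"
  proof (rule lipschitz_onI)
    fix t t' show "dist (g t) (g t') \<le> L * dist t t'"
      using half[of t t'] half[of t' t] by (simp add: dist_real_def abs_le_iff abs_minus_commute)
  qed (rule L0)
  moreover have "g t = h t" if t: "t \<in> D" for t
  proof (rule antisym)
    show "g t \<le> h t" unfolding g_def using cINF_lower[OF bb t, of t] by simp
    show "h t \<le> g t" unfolding g_def
    proof (rule cINF_greatest[OF ne])
      fix s assume "s \<in> D"
      then show "h t \<le> h s + L * \<bar>t - s\<bar>" using hb[OF t, of s] by (simp add: abs_le_iff)
    qed
  qed
  ultimately show thesis using that by blast
qed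

lemma lipschitz_real_on_differentiable_AE:
  fixes h :: "real \<Rightarrow> real"
  assumes "L-lipschitz_on D h"
  shows "\<exists>N\<in>null_sets lborel. \<forall>t\<in>D - N. \<exists>y. (h has_vector_derivative y) (at t within D)"
proof (cases "D = {}")
  case False
  obtain g where g: "L-lipschitz_on UNIV g" "\<And>t. t \<in> D \<Longrightarrow> g t = h t"
    using lipschitz_real_extension[OF assms False] by blast
  obtain N where N: "N \<in> null_sets lborel" "\<And>t. t \<notin> N \<Longrightarrow> \<exists>y. (g has_real_derivative y) (at t)"
    using lipschitz_real_differentiable_AE[OF g(1)] by blast
  have "\<exists>y. (h has_vector_derivative y) (at t within D)" if t: "t \<in> D - N" for t
  proof -
    obtain y where "(g has_real_derivative y) (at t)" using N(2) t by blast
    then have "(g has_vector_derivative y) (at t within D)"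
      by (simp add: has_real_derivative_iff_has_vector_derivative has_vector_derivative_at_within)
    then have "(h has_vector_derivative y) (at t within D)"
      by (rule has_vector_derivative_transform[of t D h g, rotated 2]) (use t g(2) in simp_all)
    then show ?thesis by blast
  qed
  then show ?thesis using N(1) by blast
qed auto

text \<open>Working with coordinate functions covers, besides the class
  \<open>euclidean_space\<close>, maps into \<open>Rn n\<close> inside \<open>rseq\<close>, expanded
  along \<open>unit_rseq\<close>.\<close>

lemma lipschitz_sum_differentiable_AE:
  fixes c :: "'i \<Rightarrow> real \<Rightarrow> real" and b :: "'i \<Rightarrow> 'a::real_normed_vector"
  assumes fin: "finite I" and lip: "\<And>i. i \<in> I \<Longrightarrow> \<exists>L. L-lipschitz_on D (c i)"
    and u: "\<And>t. t \<in> D \<Longrightarrow> u t = (\<Sum>i\<in>I. c i t *\<^sub>R b i)"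
  shows "\<exists>N\<in>null_sets lborel. \<forall>t\<in>D - N. \<exists>y. (u has_vector_derivative (\<Sum>i\<in>I. y i *\<^sub>R b i)) (at t within D)"
proof -
  have "\<forall>i\<in>I. \<exists>N\<in>null_sets lborel. \<forall>t\<in>D - N. \<exists>y. (c i has_vector_derivative y) (at t within D)"
    using lip lipschitz_real_on_differentiable_AE by blast
  then obtain N where N: "\<And>i. i \<in> I \<Longrightarrow> N i \<in> null_sets lborel"
    "\<And>i t. i \<in> I \<Longrightarrow> t \<in> D - N i \<Longrightarrow> \<exists>y. (c i has_vector_derivative y) (at t within D)"
    by metis
  have "(\<Union>i\<in>I. N i) \<in> null_sets lborel" using fin N(1) by (intro null_sets_UN' countable_finite)
  moreover have "\<exists>y. (u has_vector_derivative (\<Sum>i\<in>I. y i *\<^sub>R b i)) (at t within D)"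
    if t: "t \<in> D - (\<Union>i\<in>I. N i)" for t
  proof -
    have "\<forall>i\<in>I. \<exists>y. (c i has_vector_derivative y) (at t within D)" using N(2) t by blast
    then obtain y where y: "\<And>i. i \<in> I \<Longrightarrow> (c i has_vector_derivative y i) (at t within D)" by metis
    have "((\<lambda>t. c i t *\<^sub>R b i) has_vector_derivative y i *\<^sub>R b i) (at t within D)" if "i \<in> I" for i
    proof -
      have "(c i has_real_derivative y i) (at t within D)"
        using y[OF that] by (simp add: has_real_derivative_iff_has_vector_derivative)
      from has_vector_derivative_scaleR[OF this has_vector_derivative_const] show ?thesis by simp
    qed
    then have "((\<lambda>t. \<Sum>i\<in>I. c i t *\<^sub>R b i) has_vector_derivative (\<Sum>i\<in>I. y i *\<^sub>R b i)) (at t within D)"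
      by (rule has_vector_derivative_sum)
    then have "(u has_vector_derivative (\<Sum>i\<in>I. y i *\<^sub>R b i)) (at t within D)"
      using t u by (intro has_vector_derivative_transform[of t D u]) auto
    then show ?thesis by blast
  qed
  ultimately show ?thesis by blast
qed

lemma lipschitz_euclidean_differentiable_AE:
  fixes u :: "real \<Rightarrow> 'a::euclidean_space"
  assumes "L-lipschitz_on D u"
  shows "\<exists>N\<in>null_sets lborel. \<forall>t\<in>D - N. \<exists>y. (u has_vector_derivative y) (at t within D)"
proof -
  have "\<exists>L. L-lipschitz_on D (\<lambda>t. u t \<bullet> b)" if "b \<in> Basis" for b
  proof
    show "L-lipschitz_on D (\<lambda>t. u t \<bullet> b)"
    proof (rule lipschitz_onI)
      fix s t assume "s \<in> D" "t \<in> D"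
      then have "norm (u s - u t) \<le> L * dist s t" using lipschitz_onD[OF assms] by (simp add: dist_norm)
      then show "dist (u s \<bullet> b) (u t \<bullet> b) \<le> L * dist s t"
        using Basis_le_norm[OF that, of "u s - u t"] by (simp add: dist_real_def inner_diff_left)
    qed (rule lipschitz_on_nonneg[OF assms])
  qed
  then have "\<exists>N\<in>null_sets lborel. \<forall>t\<in>D - N. \<exists>y. (u has_vector_derivative (\<Sum>b\<in>Basis. y b *\<^sub>R b)) (at t within D)"
    by (intro lipschitz_sum_differentiable_AE[where c = "\<lambda>b t. u t \<bullet> b"]) (auto simp: euclidean_representation)
  then show ?thesis by blast
qed

lemma has_vector_derivative_isolated:
  "\<not> t islimpt D \<Longrightarrow> (f has_vector_derivative v) (at t within D)"
  by (simp add: trivial_limit_within[symmetric] has_vector_derivative_def has_derivative_def bounded_linear_scaleR_left)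

lemma has_vector_derivative_norm_bound:
  assumes der: "(u has_vector_derivative v) (at t within D)" and t: "t \<in> D" "t islimpt D"
    and b: "\<And>s. s \<in> D \<Longrightarrow> norm (u s - u t - (s - t) *\<^sub>R e) \<le> \<sigma> * \<bar>s - t\<bar>"
  shows "norm (v - e) \<le> \<sigma>"
proof (rule field_le_epsilon)
  fix \<epsilon> :: real assume "0 < \<epsilon>"
  then obtain \<delta> where \<delta>: "0 < \<delta>" "\<And>s. s \<in> D \<Longrightarrow> \<bar>s - t\<bar> < \<delta> \<Longrightarrow> norm (u s - u t - (s - t) *\<^sub>R v) \<le> \<epsilon> * \<bar>s - t\<bar>"
    using has_vector_derivative_withinD[OF der] by blast
  obtain s where s: "s \<in> D" "s \<noteq> t" "dist s t < \<delta>"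
    using t(2) \<delta>(1) unfolding islimpt_approachable by blast
  have "\<bar>s - t\<bar> * norm (v - e) = norm ((u s - u t - (s - t) *\<^sub>R e) - (u s - u t - (s - t) *\<^sub>R v))"
  proof -
    have "(u s - u t - (s - t) *\<^sub>R e) - (u s - u t - (s - t) *\<^sub>R v) = (s - t) *\<^sub>R (v - e)"
      by (simp add: scaleR_diff_right)
    then show ?thesis by simp
  qed
  also have "\<dots> \<le> \<sigma> * \<bar>s - t\<bar> + \<epsilon> * \<bar>s - t\<bar>"
  proof (rule order_trans[OF norm_triangle_ineq4], rule add_mono)
    show "norm (u s - u t - (s - t) *\<^sub>R e) \<le> \<sigma> * \<bar>s - t\<bar>" by (rule b[OF s(1)])
    show "norm (u s - u t - (s - t) *\<^sub>R v) \<le> \<epsilon> * \<bar>s - t\<bar>" using s(1,3) by (intro \<delta>(2)) (auto simp: dist_real_def)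
  qed
  finally have "norm (v - e) * \<bar>s - t\<bar> \<le> (\<sigma> + \<epsilon>) * \<bar>s - t\<bar>" by (simp add: algebra_simps)
  then show "norm (v - e) \<le> \<sigma> + \<epsilon>" using s(2) by simp
qed

lemma dir_frag_lipschitz:
  assumes "dir_frag \<Phi> v \<rho> D \<gamma>" "0 \<le> \<rho>"
  shows "(norm v + \<rho>)-lipschitz_on D (\<lambda>t. \<Phi> (\<gamma> t))"
proof (rule lipschitz_onI)
  fix s t assume st: "s \<in> D" "t \<in> D"
  have "norm (\<Phi> (\<gamma> t) - \<Phi> (\<gamma> s)) \<le> norm (\<Phi> (\<gamma> t) - \<Phi> (\<gamma> s) - (t - s) *\<^sub>R v) + norm ((t - s) *\<^sub>R v)"
    using norm_triangle_ineq[of "\<Phi> (\<gamma> t) - \<Phi> (\<gamma> s) - (t - s) *\<^sub>R v" "(t - s) *\<^sub>R v"] by simp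
  also have "\<dots> \<le> \<rho> * \<bar>t - s\<bar> + \<bar>t - s\<bar> * norm v"
    using assms(1) st by (intro add_mono) (auto simp: dir_frag_def)
  finally show "dist (\<Phi> (\<gamma> s)) (\<Phi> (\<gamma> t)) \<le> (norm v + \<rho>) * dist s t"
    by (simp add: dist_norm norm_minus_commute abs_minus_commute algebra_simps)
qed (use assms in auto)

text \<open>At a limit point of \<open>D\<close> the bound on increments passes to the derivative.
  At an isolated point every vector is a derivative, and \<open>e\<close> itself is taken.\<close>

lemma dir_frag_derivative_AE:
  fixes u :: "real \<Rightarrow> 'a::euclidean_space"
  assumes f: "dir_frag (\<lambda>x. x) e \<sigma> D u" and \<sigma>: "0 \<le> \<sigma>"
  shows "\<exists>N\<in>null_sets lborel. \<forall>t\<in>D - N. \<exists>y. norm (y - e) \<le> \<sigma> \<and> (u has_vector_derivative y) (at t within D)"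
proof -
  obtain N where N: "N \<in> null_sets lborel" "\<And>t. t \<in> D - N \<Longrightarrow> \<exists>y. (u has_vector_derivative y) (at t within D)"
    using lipschitz_euclidean_differentiable_AE[OF dir_frag_lipschitz[OF f \<sigma>]] by blast
  have "\<exists>y. norm (y - e) \<le> \<sigma> \<and> (u has_vector_derivative y) (at t within D)" if t: "t \<in> D - N" for t
  proof (cases "t islimpt D")
    case True
    obtain y where y: "(u has_vector_derivative y) (at t within D)" using N(2) t by blast
    have "norm (y - e) \<le> \<sigma>"
      using t f by (intro has_vector_derivative_norm_bound[OF y _ True]) (auto simp: dir_frag_def)
    then show ?thesis using y by blast
  next
    case False
    then show ?thesis using has_vector_derivative_isolated[OF False, of u e] \<sigma> by (intro exI[of _ e]) auto
  qed
  then show ?thesis using N(1) by blast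
qed

section \<open>Dual vectors of a frame\<close>

lemma span_image_sum:
  assumes "finite I" "p \<in> span (e ` I)"
  shows "\<exists>a. p = (\<Sum>i\<in>I. a i *\<^sub>R e i)"
proof -
  let ?V = "{p. \<exists>a. p = (\<Sum>i\<in>I. a i *\<^sub>R e i)}"
  have sub: "subspace ?V"
  proof (rule subspaceI)
    show "0 \<in> ?V" by (auto intro!: exI[of _ "\<lambda>_. 0"])
    fix x y assume "x \<in> ?V" "y \<in> ?V"
    then obtain a b where "x = (\<Sum>i\<in>I. a i *\<^sub>R e i)" "y = (\<Sum>i\<in>I. b i *\<^sub>R e i)" by blast
    then have "x + y = (\<Sum>i\<in>I. (a i + b i) *\<^sub>R e i)" by (simp add: scaleR_add_left sum.distrib)
    then show "x + y \<in> ?V" by (intro CollectI exI)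
  next
    fix c x assume "x \<in> ?V"
    then obtain a where "x = (\<Sum>i\<in>I. a i *\<^sub>R e i)" by blast
    then have "c *\<^sub>R x = (\<Sum>i\<in>I. (c * a i) *\<^sub>R e i)" by (simp add: scaleR_sum_right)
    then show "c *\<^sub>R x \<in> ?V" by (intro CollectI exI)
  qed
  have inc: "e ` I \<subseteq> ?V"
  proof
    fix x assume "x \<in> e ` I"
    then obtain j where j: "j \<in> I" "x = e j" by blast
    have "x = (\<Sum>i\<in>I. (if i = j then 1 else 0) *\<^sub>R e i)"
      using assms(1) j by (simp add: if_distrib[of "\<lambda>c. c *\<^sub>R _"] sum.delta cong: if_cong)
    then show "x \<in> ?V" by (intro CollectI exI)
  qed
  show ?thesis using span_minimal[OF inc sub] assms(2) by (rule subsetD[THEN CollectD])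
qed

text \<open>\<open>r\<close> is \<open>e i\<close> minus its projection to the span of the other
  vectors. For independent vectors the coefficient \<open>a i = 1\<close> shows that
  \<open>r\<close> is nonzero, and \<open>r\<close> divided by its squared norm is the
  \<open>i\<close>-th dual vector.\<close>

lemma orthogonal_residual:
  fixes e :: "nat \<Rightarrow> 'a::real_inner"
  assumes i: "i < d"
  shows "\<exists>r a. r = (\<Sum>j<d. a j *\<^sub>R e j) \<and> a i = 1 \<and> inner r (e i) = (norm r)\<^sup>2 \<and>
    (\<forall>j<d. j \<noteq> i \<longrightarrow> inner r (e j) = 0)"
proof -
  let ?I = "{..<d} - {i}"
  obtain p where p: "p \<in> span (e ` ?I)" "\<And>b. b \<in> span (e ` ?I) \<Longrightarrow> inner (e i - p) b = 0"
    using orthogonal_projection_exists[of "e ` ?I" "e i"] by auto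
  obtain a where a: "p = (\<Sum>j\<in>?I. a j *\<^sub>R e j)" using span_image_sum[OF _ p(1)] by blast
  define r where "r = e i - p"
  define a' where "a' j = (if j = i then 1 else - a j)" for j
  have "(\<Sum>j<d. a' j *\<^sub>R e j) = a' i *\<^sub>R e i + (\<Sum>j\<in>?I. a' j *\<^sub>R e j)"
    using i by (intro sum.remove) auto
  also have "(\<Sum>j\<in>?I. a' j *\<^sub>R e j) = (\<Sum>j\<in>?I. - (a j *\<^sub>R e j))"
    by (rule sum.cong) (auto simp: a'_def)
  also have "a' i *\<^sub>R e i + \<dots> = r" by (simp add: r_def a a'_def sum_negf)
  finally have 1: "r = (\<Sum>j<d. a' j *\<^sub>R e j)" by (rule sym)
  have "inner r (e i) = inner r r + inner r p" by (simp add: r_def inner_diff_right)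
  also have "inner r p = 0" using p by (simp add: r_def)
  finally have 2: "inner r (e i) = (norm r)\<^sup>2" by (simp add: power2_norm_eq_inner)
  have 3: "inner r (e j) = 0" if "j < d" "j \<noteq> i" for j
    using that p(2)[of "e j"] by (simp add: r_def span_base)
  have 4: "a' i = 1" by (simp add: a'_def)
  show ?thesis using 1 2 3 4 by blast
qed

text \<open>The residual of \<open>e i\<close> has coefficient 1 at \<open>e i\<close>, so
  \<open>ind\<close> bounds its norm below by \<open>\<beta>\<close>; the dual vector has the
  reciprocal norm.\<close>

lemma dual_family:
  fixes e :: "nat \<Rightarrow> 'a::real_inner"
  assumes \<beta>: "0 < \<beta>" and ind: "\<And>a. \<beta> * (\<Sum>i<d. \<bar>a i\<bar>) \<le> norm (\<Sum>i<d. a i *\<^sub>R e i)"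
  shows "\<exists>z. \<forall>i<d. norm (z i) \<le> 1 / \<beta> \<and> (\<forall>j<d. inner (z i) (e j) = (if i = j then 1 else 0))"
proof -
  have "\<exists>z. norm z \<le> 1 / \<beta> \<and> (\<forall>j<d. inner z (e j) = (if i = j then 1 else 0))" if i: "i < d" for i
  proof -
    obtain r a' where ra: "r = (\<Sum>j<d. a' j *\<^sub>R e j)" "a' i = 1" and ri: "inner r (e i) = (norm r)\<^sup>2"
      and rj: "\<forall>j<d. j \<noteq> i \<longrightarrow> inner r (e j) = 0"
      using orthogonal_residual[OF i, of e] by blast
    have "\<bar>a' i\<bar> \<le> (\<Sum>j<d. \<bar>a' j\<bar>)" using i by (intro member_le_sum) auto
    then have one: "1 \<le> (\<Sum>j<d. \<bar>a' j\<bar>)" using ra(2) by simp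
    have r: "\<beta> \<le> norm r"
      unfolding ra(1) using order_trans[OF mult_left_mono[OF one less_imp_le[OF \<beta>]] ind[of a']] by (simp only: mult_1_right)
    show ?thesis
    proof (intro exI[of _ "r /\<^sub>R (norm r ^ 2)"] conjI allI impI)
      have "norm (r /\<^sub>R (norm r ^ 2)) = 1 / norm r" using r \<beta> by (simp add: power2_eq_square divide_simps)
      also have "\<dots> \<le> 1 / \<beta>" using r \<beta> by (intro divide_left_mono mult_pos_pos) linarith+
      finally show "norm (r /\<^sub>R (norm r ^ 2)) \<le> 1 / \<beta>" .
      fix j assume "j < d"
      then show "inner (r /\<^sub>R (norm r ^ 2)) (e j) = (if i = j then 1 else 0)"
      proof -
        have "norm r \<noteq> 0" using r \<beta> by linarith
        then show ?thesis using ri rj \<open>j < d\<close> by auto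
      qed
    qed
  qed
  then show ?thesis by metis
qed

section \<open>Sets of small Hausdorff dimension\<close>

lemma power_scale_exists:
  assumes "0 < (R::real)" "R \<le> 1" "2 \<le> (K::nat)"
  shows "\<exists>n. R \<le> 1 / real K ^ n \<and> 1 / real K ^ Suc n < R"
proof -
  have "\<exists>m. 1 / real K ^ m < R"
  proof -
    have "(1 / real K) < 1" "0 < 1 / real K" using assms(3) by auto
    then obtain m where "(1 / real K) ^ m < R" using real_arch_pow_inv[OF assms(1)] by blast
    then show ?thesis by (auto simp: power_divide)
  qed
  then have L: "1 / real K ^ (LEAST m. 1 / real K ^ m < R) < R" by (rule LeastI_ex)
  define m where "m = (LEAST m. 1 / real K ^ m < R)"
  have "m \<noteq> 0"
  proof
    assume "m = 0"
    then show False using L assms(2) by (simp add: m_def[symmetric])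
  qed
  then obtain n where n: "m = Suc n" by (cases m) auto
  then have "\<not> 1 / real K ^ n < R" unfolding m_def by (intro not_less_Least) auto
  then show ?thesis using L n by (intro exI[of _ n]) (auto simp: m_def[symmetric])
qed

text \<open>On sets of diameter at most \<open>\<delta>'\<close>, raising the exponent from
  \<open>s\<close> to \<open>s'\<close> gains the factor \<open>\<delta>' powr (s' - s)\<close>,
  which is as small as desired. A finite measure thus gives covers of arbitrarily small total
  weight.\<close>

lemma Hausdorff_measure_finite_covers:
  assumes H: "Hausdorff_measure s B < \<infinity>" and s: "0 \<le> s" "s < s'" and \<epsilon>: "0 < \<epsilon>" "0 < \<delta>"
  obtains E :: "nat \<Rightarrow> 'a::metric_space set"
  where "B \<subseteq> (\<Union>i. E i)" "\<And>i. bounded (E i)" "\<And>i. diameter (E i) \<le> \<delta>"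
    "(\<Sum>i. ennreal (diameter (E i) powr s')) \<le> ennreal \<epsilon>"
proof -
  define h where "h = enn2real (Hausdorff_measure s B) + 1"
  have h: "0 < h" by (simp add: h_def add_nonneg_pos)
  have Hh: "Hausdorff_measure s B < ennreal h"
  proof -
    have "Hausdorff_measure s B = ennreal (enn2real (Hausdorff_measure s B))" using H by simp
    also have "\<dots> < ennreal h" by (intro ennreal_lessI) (auto simp: h_def add_nonneg_pos)
    finally show ?thesis .
  qed
  define \<delta>' where "\<delta>' = min \<delta> ((\<epsilon> / h) powr (1 / (s' - s)))"
  have \<delta>': "0 < \<delta>'" "\<delta>' \<le> \<delta>" using h \<epsilon> by (auto simp: \<delta>'_def)
  have pw: "\<delta>' powr (s' - s) * h \<le> \<epsilon>"
  proof -
    have "\<delta>' powr (s' - s) \<le> ((\<epsilon> / h) powr (1 / (s' - s))) powr (s' - s)"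
      using \<delta>' s by (intro powr_mono2) (auto simp: \<delta>'_def)
    also have "\<dots> = \<epsilon> / h" using s h \<epsilon> by (simp add: powr_powr)
    finally show ?thesis using h by (simp add: field_simps)
  qed
  have "Hausdorff_content \<delta>' s B \<le> Hausdorff_measure s B"
    unfolding Hausdorff_measure_def using \<delta>' by (intro SUP_upper) auto
  then have "Hausdorff_content \<delta>' s B < ennreal h" using Hh by simp
  then obtain E :: "nat \<Rightarrow> 'a set" where E: "B \<subseteq> (\<Union>i. E i)" "\<And>i. bounded (E i)" "\<And>i. diameter (E i) \<le> \<delta>'"
    "(\<Sum>i. diam_powr s (E i)) < ennreal h"
    unfolding Hausdorff_content_def INF_less_iff by blast
  have bound: "ennreal (diameter (E i) powr s') \<le> ennreal (\<delta>' powr (s' - s)) * diam_powr s (E i)" for i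
  proof (cases "E i = {}")
    case True
    then show ?thesis using s by simp
  next
    case False
    have d0: "0 \<le> diameter (E i)" by (rule diameter_ge_0[OF E(2)])
    show ?thesis
    proof (cases "s = 0")
      case True
      have "diameter (E i) powr s' \<le> \<delta>' powr s'" using d0 E(3)[of i] s True by (intro powr_mono2) auto
      then show ?thesis using True False by (simp add: diam_powr_def ennreal_leI)
    next
      case s0: False
      have "diameter (E i) powr s' = diameter (E i) powr (s' - s) * diameter (E i) powr s"
        by (simp add: powr_add[symmetric])
      also have "\<dots> \<le> \<delta>' powr (s' - s) * diameter (E i) powr s"
        using d0 E(3)[of i] s by (intro mult_right_mono powr_mono2) auto
      finally have "ennreal (diameter (E i) powr s') \<le> ennreal (\<delta>' powr (s' - s) * diameter (E i) powr s)"
        by (rule ennreal_leI)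
      then show ?thesis using False s0 by (simp add: diam_powr_def ennreal_mult)
    qed
  qed
  have "(\<Sum>i. ennreal (diameter (E i) powr s')) \<le> (\<Sum>i. ennreal (\<delta>' powr (s' - s)) * diam_powr s (E i))"
    by (intro suminf_le bound summableI)
  also have "\<dots> = ennreal (\<delta>' powr (s' - s)) * (\<Sum>i. diam_powr s (E i))" by (rule ennreal_suminf_cmult)
  also have "\<dots> \<le> ennreal (\<delta>' powr (s' - s)) * ennreal h" using E(4) by (intro mult_left_mono) auto
  also have "\<dots> \<le> ennreal \<epsilon>" using pw h by (simp add: ennreal_mult[symmetric] ennreal_leI)
  finally show thesis using E \<delta>'(2) by (intro that[of E]) (auto intro: order_trans)
qed

text \<open>A set of diameter \<open>r\<close> meets at most \<open>2 ^ d\<close> grid cells of a comparable side length; the set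
  component of a leaf index records which of these cells is meant.\<close>

lemma grid_cover_scale:
  fixes c :: "nat \<Rightarrow> 'b::metric_space \<Rightarrow> real" and d :: nat and s0 s :: real
  defines "crd \<equiv> \<lambda>y i. if i < d then c i y else 0"
  assumes d: "1 \<le> d" and s: "0 \<le> s0" "s0 < s" "s < d" and H: "Hausdorff_measure s0 B < \<infinity>"
    and \<Lambda>: "0 < \<Lambda>" "\<And>i. i < d \<Longrightarrow> \<Lambda>-lipschitz_on UNIV (c i)"
    and hK: "2 \<le> K" "real (2 ^ (d * (d - 1))) \<le> real K powr (real d - s)" and \<eta>: "0 < \<eta>"
  shows "\<exists>G. (\<forall>j<d. G j \<in> sets borel) \<and> B \<subseteq> (\<Union>j<d. G j) \<and>
    (\<forall>j<d. \<forall>D u C q. D \<in> sets borel \<longrightarrow> (\<forall>i<d. (\<lambda>t. c i (u t)) \<in> borel_measurable borel) \<longrightarrow> 0 \<le> C \<longrightarrow>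
      (\<forall>s\<in>D. \<forall>t\<in>D. \<bar>s - t\<bar> \<le> C * \<bar>c j (u s) - c j (u t)\<bar>) \<longrightarrow>
      (\<forall>s\<in>D. \<forall>t\<in>D. \<forall>i<d. i \<noteq> j \<longrightarrow> \<bar>c i (u s) - c i (u t)\<bar> \<le> \<bar>c j (u s) - c j (u t)\<bar> / real K) \<longrightarrow>
      (\<forall>t\<in>D. cell d K 0 (crd (u t)) = q) \<longrightarrow>
      emeasure lborel {t \<in> D. u t \<in> G j} \<le> ennreal (C * \<eta> powr (1 / d)))"
proof -
  have K0: "1 < real K" using hK by simp
  have s0: "0 < s" using s by simp
  \<comment> \<open>Computed backwards from the total mass \<open>\<eta>\<close>: the
    \<open>i\<close>-th set yields \<open>2 ^ d\<close> leaves of weight at most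
    \<open>(K * \<Lambda>) powr s * (r i powr s + t i powr s)\<close>, and each of the two sums over
    \<open>i\<close> is at most \<open>\<kappa>\<close>.\<close>
  define \<kappa> where "\<kappa> = \<eta> / (2 * 2 ^ d * (real K * \<Lambda>) powr s)"
  have \<kappa>: "0 < \<kappa>" using \<eta> K0 \<Lambda> by (simp add: \<kappa>_def)
  define \<eta>' where "\<eta>' = min \<kappa> ((1 / \<Lambda>) powr s)"
  have \<eta>': "0 < \<eta>'" "\<eta>' \<le> \<kappa>" using \<kappa> \<Lambda> by (auto simp: \<eta>'_def)
  obtain E where E: "B \<subseteq> (\<Union>i. E i)" "\<And>i. bounded (E i)" "\<And>i. diameter (E i) \<le> 1 / \<Lambda>"
    "(\<Sum>i. ennreal (diameter (E i) powr s)) \<le> ennreal \<kappa>"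
  proof (rule Hausdorff_measure_finite_covers[OF H s(1,2) \<kappa>, of "1 / \<Lambda>"])
    show "0 < 1 / \<Lambda>" using \<Lambda>(1) by simp
  qed (rule that)
  define r where "r i = diameter (E i)" for i
  have r0: "0 \<le> r i" for i unfolding r_def by (rule diameter_ge_0[OF E(2)])
  \<comment> \<open>A set of diameter zero would have no finite level. The positive
    \<open>t i\<close> bound the sizes from below, and their powers \<open>t i powr s\<close> add up
    to only \<open>\<eta>'\<close>.\<close>
  define t where "t i = (\<eta>' * (1/2) ^ Suc i) powr (1 / s)" for i :: nat
  have t: "0 < t i" "t i powr s = \<eta>' * (1/2) ^ Suc i" "t i \<le> 1 / \<Lambda>" for i
  proof -
    show t0: "0 < t i" using \<eta>' by (simp add: t_def)
    show "t i powr s = \<eta>' * (1/2) ^ Suc i" using \<eta>' s0 by (simp add: t_def powr_powr)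
    have "\<eta>' * (1/2) ^ Suc i \<le> \<eta>' * 1" using \<eta>' by (intro mult_left_mono power_le_one) auto
    also have "\<dots> \<le> (1 / \<Lambda>) powr s" by (simp add: \<eta>'_def)
    finally have "t i \<le> ((1 / \<Lambda>) powr s) powr (1 / s)" using \<eta>' s0 unfolding t_def by (intro powr_mono2) auto
    then show "t i \<le> 1 / \<Lambda>" using s0 \<Lambda>(1) by (simp add: powr_powr)
  qed
  define R where "R i = \<Lambda> * max (r i) (t i)" for i
  have R: "0 < R i" "R i \<le> 1" for i
  proof -
    show "0 < R i" using \<Lambda>(1) t(1)[of i] by (simp add: R_def less_max_iff_disj)
    have "\<Lambda> * max (r i) (t i) \<le> \<Lambda> * (1 / \<Lambda>)" using t(3)[of i] E(3)[of i] \<Lambda>(1) by (intro mult_left_mono) (auto simp: r_def)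
    then show "R i \<le> 1" using \<Lambda>(1) by (simp add: R_def)
  qed
  \<comment> \<open>\<open>R i\<close> bounds the oscillation of the coordinates on
    \<open>E i\<close>. The cube side is at least \<open>R i\<close>, so that each coordinate meets
    at most two indices, and less than \<open>K * R i\<close>, which bounds the weight
    \<open>W i\<close>.\<close>
  obtain n where n: "\<And>i. R i \<le> 1 / real K ^ n i" "\<And>i. 1 / real K ^ Suc (n i) < R i"
    using power_scale_exists[OF R(1) R(2) hK(1)] by metis
  define W where "W i = real K powr (- s * n i)" for i
  have W: "W i \<le> (real K * \<Lambda>) powr s * (r i powr s + t i powr s)" for i
  proof -
    have "1 / real K ^ n i = real K * (1 / real K ^ Suc (n i))" using K0 by simp
    also have "\<dots> \<le> real K * R i" using n(2)[of i] K0 by (intro mult_left_mono) auto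
    finally have "(1 / real K ^ n i) powr s \<le> (real K * R i) powr s"
      using s0 K0 by (intro powr_mono2) auto
    also have "(1 / real K ^ n i) powr s = W i"
      using K0 by (simp add: W_def powr_realpow[symmetric] powr_minus[symmetric] powr_powr divide_inverse mult.commute)
    also have "(real K * R i) powr s = (real K * \<Lambda>) powr s * max (r i) (t i) powr s"
      using K0 \<Lambda>(1) r0[of i] t(1)[of i] by (simp add: R_def powr_mult[symmetric] mult.assoc)
    also have "max (r i) (t i) powr s \<le> r i powr s + t i powr s" by (simp add: max_def)
    finally show ?thesis by (simp add: mult_left_mono)
  qed
  have W0: "0 \<le> W i" for i by (simp add: W_def)
  have sumW: "(\<Sum>i. ennreal (W i)) \<le> ennreal (\<eta> / 2 ^ d)"
  proof -
    let ?c = "(real K * \<Lambda>) powr s"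
    have "(\<Sum>i. ennreal (W i)) \<le> (\<Sum>i. ennreal ?c * (ennreal (r i powr s) + ennreal (t i powr s)))"
      using W by (intro suminf_le summableI) (simp add: ennreal_mult[symmetric] ennreal_plus[symmetric] ennreal_leI del: ennreal_plus)
    also have "\<dots> = ennreal ?c * ((\<Sum>i. ennreal (r i powr s)) + (\<Sum>i. ennreal (t i powr s)))"
      by (simp add: ennreal_suminf_cmult suminf_add[symmetric] summableI)
    also have "(\<Sum>i. ennreal (t i powr s)) = ennreal \<eta>'"
    proof -
      have "(\<lambda>i. \<eta>' * (1/2) ^ Suc i) sums (\<eta>' * 1)" by (intro sums_mult power_half_series)
      then have "(\<lambda>i. ennreal (t i powr s)) sums ennreal (\<eta>' * 1)"
        using \<eta>' unfolding t(2) by (subst sums_ennreal) auto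
      then show ?thesis by (simp add: sums_iff)
    qed
    also have "ennreal ?c * ((\<Sum>i. ennreal (r i powr s)) + ennreal \<eta>') \<le> ennreal ?c * (ennreal \<kappa> + ennreal \<kappa>)"
      using E(4) \<eta>' by (intro mult_left_mono add_mono) (auto simp: r_def ennreal_leI)
    also have "\<dots> = ennreal (?c * (\<kappa> + \<kappa>))" using \<kappa> by (simp add: ennreal_mult[symmetric] ennreal_plus[symmetric] del: ennreal_plus)
    also have "?c * (\<kappa> + \<kappa>) = \<eta> / 2 ^ d" using K0 \<Lambda>(1) by (simp add: \<kappa>_def field_simps)
    finally show ?thesis .
  qed
  define w where "w p = (if snd p \<subseteq> {..<d} then ennreal (W (fst p)) else 0)" for p :: "nat \<times> nat set"
  define M where "M = density (count_space UNIV) w"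
  have sM: "sets M = UNIV" by (simp add: M_def)
  have eM: "emeasure M A = (\<Sum>p\<in>F. w p)" if "finite F" "F \<subseteq> A" "\<And>p. p \<in> A \<Longrightarrow> p \<notin> F \<Longrightarrow> w p = 0" for A F
  proof -
    have "emeasure M A = (\<integral>\<^sup>+p. w p * indicator A p \<partial>count_space UNIV)"
      unfolding M_def by (subst emeasure_density) auto
    also have "\<dots> = (\<Sum>p\<in>F. w p * indicator A p)"
      using that by (intro nn_integral_count_space') (auto simp: indicator_def)
    also have "\<dots> = (\<Sum>p\<in>F. w p)" using that(2) by (intro sum.cong) (auto simp: indicator_def)
    finally show ?thesis .
  qed
  have tot: "emeasure M UNIV \<le> ennreal \<eta>"
  proof -
    have "emeasure M UNIV = emeasure M (\<Union>i. {i} \<times> UNIV)" by (rule arg_cong[where f = "emeasure M"]) auto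
    also have "\<dots> \<le> (\<Sum>i. emeasure M ({i} \<times> UNIV))" by (intro emeasure_subadditive_countably) (auto simp: sM)
    also have "(\<lambda>i. emeasure M ({i} \<times> UNIV)) = (\<lambda>i. ennreal (2 ^ d) * ennreal (W i))"
    proof
      fix i
      have "emeasure M ({i} \<times> UNIV) = (\<Sum>p\<in>{i} \<times> Pow {..<d}. w p)"
        by (rule eM) (auto simp: w_def)
      also have "\<dots> = (\<Sum>p\<in>{i} \<times> Pow {..<d}. ennreal (W i))" by (rule sum.cong) (auto simp: w_def)
      also have "\<dots> = of_nat (2 ^ d) * ennreal (W i)" by (simp add: card_cartesian_product card_Pow)
      finally show "emeasure M ({i} \<times> UNIV) = ennreal (2 ^ d) * ennreal (W i)"
        by (simp add: ennreal_power[symmetric] ennreal_numeral)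
    qed
    also have "(\<Sum>i. ennreal (2 ^ d) * ennreal (W i)) = ennreal (2 ^ d) * (\<Sum>i. ennreal (W i))" by (rule ennreal_suminf_cmult)
    also have "\<dots> \<le> ennreal (2 ^ d) * ennreal (\<eta> / 2 ^ d)" by (rule mult_left_mono[OF sumW]) simp
    also have "\<dots> = ennreal \<eta>" using \<eta> by (simp add: ennreal_mult[symmetric])
    finally show ?thesis .
  qed
  have fM: "finite_measure M"
  proof (rule finite_measureI)
    have "space M = UNIV" by (simp add: M_def)
    then show "emeasure M (space M) \<noteq> \<infinity>" using tot ennreal_less_top[of \<eta>] by (auto simp: top_unique)
  qed
  define b where "b i l = (INF y\<in>E i. c l y)" for i l
  \<comment> \<open>\<open>b i\<close> is the lower corner of the coordinate box of
    \<open>E i\<close>; the set component tells in which coordinates to step to the next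
    cube.\<close>
  define pt where "pt p l = b (fst p) l + (if l \<in> snd p then 1 / real K ^ n (fst p) else 0)" for p :: "nat \<times> nat set" and l
  interpret grid_tree d K M "\<lambda>p. n (fst p)" pt
    by (rule grid_tree.intro) (fact d hK(1) fM sM)+
  \<comment> \<open>At a point of \<open>B\<close> the \<open>d\<close> gains at a suitable level
    have product at least \<open>1 / \<eta>\<close>, so one of them is at least the
    \<open>d\<close>-th root of this.\<close>
  define \<tau> where "\<tau> = \<eta> powr (- 1 / d)"
  have \<tau>: "0 < \<tau>" using \<eta> by (simp add: \<tau>_def)
  have \<tau>d: "\<tau> ^ d = 1 / \<eta>"
  proof -
    have "\<tau> ^ d = \<tau> powr real d" using \<tau> by (simp add: powr_realpow)
    also have "\<dots> = \<eta> powr (- 1)" using d by (simp add: \<tau>_def powr_powr)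
    finally show ?thesis using \<eta> by (simp add: powr_minus_divide)
  qed
  define G where "G j = {y. \<exists>n. \<tau> \<le> gain j n (crd y)}" for j
  have vb: "(\<lambda>y. crd y i) \<in> borel_measurable borel" for i
  proof (cases "i < d")
    case True
    then have "continuous_on UNIV (c i)" using \<Lambda>(2) lipschitz_on_continuous_on by blast
    then have "c i \<in> borel_measurable borel" by (rule borel_measurable_continuous_onI)
    then show ?thesis using True by (simp add: crd_def)
  qed (simp add: crd_def)
  have Gb: "G j \<in> sets borel" for j
  proof -
    have X: "{y. \<tau> \<le> gain j n (crd y)} \<in> sets borel" for n
      using measurable_sets[OF gain_measurable[OF vb], of "{\<tau>..}" j n] by (simp add: vimage_def)
    have "(\<Union>n. {y. \<tau> \<le> gain j n (crd y)}) \<in> sets borel"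
      by (intro sets.countable_UN' image_subsetI countableI_type X)
    moreover have "(\<Union>n. {y. \<tau> \<le> gain j n (crd y)}) = G j" by (auto simp: G_def)
    ultimately show ?thesis by (simp only:)
  qed
  have cov: "B \<subseteq> (\<Union>j<d. G j)"
  proof
    fix y assume "y \<in> B"
    then obtain i where i: "y \<in> E i" using E(1) by blast
    have near: "b i l \<le> c l y \<and> c l y \<le> b i l + 1 / real K ^ n i" if l: "l < d" for l
    proof -
      have osc: "\<bar>c l y - c l y'\<bar> \<le> R i" if "y \<in> E i" "y' \<in> E i" for y y'
      proof -
        have "\<bar>c l y - c l y'\<bar> \<le> \<Lambda> * dist y y'" using lipschitz_onD[OF \<Lambda>(2)[OF l], of y y'] by (simp add: dist_real_def)
        also have "\<dots> \<le> \<Lambda> * r i" using \<Lambda>(1) that diameter_bounded_bound[OF E(2)] by (intro mult_left_mono) (auto simp: r_def)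
        also have "\<dots> \<le> R i" using \<Lambda>(1) by (simp add: R_def)
        finally show ?thesis .
      qed
      have bb: "bdd_below (c l ` E i)"
      proof (rule bdd_belowI2)
        fix y' assume "y' \<in> E i"
        then show "c l y - R i \<le> c l y'" using osc[OF i, of y'] by linarith
      qed
      have "b i l \<le> c l y" unfolding b_def by (rule cINF_lower[OF bb i])
      moreover have "c l y - R i \<le> b i l" unfolding b_def
      proof (rule cINF_greatest)
        fix y' assume "y' \<in> E i"
        then show "c l y - R i \<le> c l y'" using osc[OF i, of y'] by linarith
      qed (use i in auto)
      ultimately show ?thesis using n(1)[of i] by linarith
    qed
    define P where "P = {l. l < d \<and> \<lfloor>real K ^ n i * c l y\<rfloor> \<noteq> \<lfloor>real K ^ n i * b i l\<rfloor>}"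
    have cell: "cl (n i) (crd y) = cl (n i) (pt (i, P))"
      unfolding cell_eq_iff
    proof (intro allI impI)
      fix l assume l: "l < d"
      have Kn: "0 < real K ^ n i" using K0 by simp
      have lo: "real K ^ n i * b i l \<le> real K ^ n i * c l y" and "real K ^ n i * c l y \<le> real K ^ n i * (b i l + 1 / real K ^ n i)"
        using near[OF l] Kn by (auto intro!: mult_left_mono)
      moreover have "k * (x + 1 / k) = k * x + 1" if "0 < k" for k x :: real
        using that by (simp add: distrib_left)
      from this[OF Kn] have Kb: "real K ^ n i * (b i l + 1 / real K ^ n i) = real K ^ n i * b i l + 1" .
      ultimately have "real K ^ n i * c l y \<le> real K ^ n i * b i l + 1" by simp
      then have "\<lfloor>real K ^ n i * c l y\<rfloor> = \<lfloor>real K ^ n i * b i l\<rfloor> \<or> \<lfloor>real K ^ n i * c l y\<rfloor> = \<lfloor>real K ^ n i * b i l\<rfloor> + 1"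
        using lo by linarith
      with Kb show "\<lfloor>real K ^ n i * crd y l\<rfloor> = \<lfloor>real K ^ n i * pt (i, P) l\<rfloor>"
        using l by (auto simp: crd_def pt_def P_def)
    qed
    have "1 / \<eta> \<le> (\<Prod>j<d. gain j (n (fst (i, P))) (crd y))"
    proof (rule gain_lower[OF hK(2)])
      have "emeasure M {(i, P)} = ennreal (W i)"
        by (subst eM[of "{(i, P)}"]) (auto simp: w_def P_def)
      then show "real K powr (- s * real (n (fst (i, P)))) \<le> measure M {(i, P)}"
        using W0[of i] by (simp add: measure_def W_def)
      show "measure M UNIV \<le> \<eta>" using tot \<eta> by (simp add: measure_def enn2real_leI)
    qed (use \<eta> cell in auto)
    then have prod: "\<tau> ^ d \<le> (\<Prod>j<d. gain j (n i) (crd y))" using \<tau>d by simp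
    have "\<exists>j<d. \<tau> \<le> gain j (n i) (crd y)"
    proof (rule ccontr)
      assume "\<not> ?thesis"
      then have lt: "gain j (n i) (crd y) < \<tau>" if "j < d" for j using that by force
      have "(\<Prod>j<d. gain j (n i) (crd y)) < (\<Prod>j<d. \<tau>)"
        by (rule prod_mono_strict[of 0]) (use lt d \<tau> gain_nonneg in \<open>auto intro: less_imp_le\<close>)
      then show False using prod by simp
    qed
    then show "y \<in> (\<Union>j<d. G j)" by (auto simp: G_def)
  qed
  show ?thesis
  proof (intro exI[of _ G] conjI allI impI)
    fix j D u C q
    assume j: "j < d" and D: "D \<in> sets borel" and u: "\<forall>i<d. (\<lambda>t. c i (u t)) \<in> borel_measurable borel" and C: "0 \<le> C"
      and st: "\<forall>s\<in>D. \<forall>t\<in>D. \<bar>s - t\<bar> \<le> C * \<bar>c j (u s) - c j (u t)\<bar>"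
      and cone: "\<forall>s\<in>D. \<forall>t\<in>D. \<forall>i<d. i \<noteq> j \<longrightarrow> \<bar>c i (u s) - c i (u t)\<bar> \<le> \<bar>c j (u s) - c j (u t)\<bar> / real K"
      and q: "\<forall>t\<in>D. cell d K 0 (crd (u t)) = q"
    have um: "(\<lambda>t. crd (u t) i) \<in> borel_measurable borel" for i
      using u by (cases "i < d") (auto simp: crd_def)
    have "emeasure lborel {t \<in> D. \<exists>n. \<tau> \<le> gain j n (crd (u t))} \<le> ennreal (C / \<tau>)"
    proof (rule gain_upper_unbounded[OF j D um C _ _ \<tau>])
      show "\<bar>s - t\<bar> \<le> C * \<bar>crd (u s) j - crd (u t) j\<bar>" if "s \<in> D" "t \<in> D" for s t
        using st that j by (simp add: crd_def)
      show "\<bar>crd (u s) i - crd (u t) i\<bar> \<le> \<bar>crd (u s) j - crd (u t) j\<bar> / real K"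
        if "s \<in> D" "t \<in> D" "i < d" "i \<noteq> j" for s t i
        using cone that j by (simp add: crd_def)
      show "cl 0 (crd (u t)) = q" if "t \<in> D" for t using q that by simp
    qed
    moreover have "C / \<tau> = C * \<eta> powr (1 / d)" using \<eta> by (simp add: \<tau>_def powr_minus_divide)
    ultimately show "emeasure lborel {t \<in> D. u t \<in> G j} \<le> ennreal (C * \<eta> powr (1 / d))"
      by (simp add: G_def)
  qed (use Gb cov in auto)
qed

lemma grid_size_exists:
  assumes "(s::real) < real d"
  obtains K :: nat where "2 \<le> K" "real (2 ^ (d * (d - 1))) \<le> real K powr (real d - s)"
proof -
  let ?a = "real (2 ^ (d * (d - 1)))"
  obtain K0 :: nat where K0: "?a powr (1 / (real d - s)) \<le> real K0" using real_arch_simple by blast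
  have "?a = (?a powr (1 / (real d - s))) powr (real d - s)" using assms by (simp add: powr_powr)
  also have "\<dots> \<le> real (max 2 K0) powr (real d - s)" using assms K0 by (intro powr_mono2) auto
  finally show thesis by (intro that[of "max 2 K0"]) auto
qed

text \<open>\<open>grid_cover_scale\<close> with total mass \<open>((1/2) ^ k) ^ d\<close> bounds
  the time spent in \<open>G k j\<close> by \<open>C * (1/2) ^ k\<close>. Each point of
  \<open>B\<close> lies in \<open>G k j\<close> for infinitely many \<open>k\<close> with one and
  the same \<open>j\<close>, so the upper limits of these sets still cover \<open>B\<close>, and by
  Borel-Cantelli they are null on steep curves.\<close>

lemma hausdorff_cone_cover:
  fixes c :: "nat \<Rightarrow> 'b::metric_space \<Rightarrow> real" and d :: nat and s0 s :: real
  assumes d: "1 \<le> d" and s: "0 \<le> s0" "s0 < s" "s < d" and H: "Hausdorff_measure s0 B < \<infinity>"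
    and \<Lambda>: "0 < \<Lambda>" "\<And>i. i < d \<Longrightarrow> \<Lambda>-lipschitz_on UNIV (c i)"
    and hK: "2 \<le> K" "real (2 ^ (d * (d - 1))) \<le> real K powr (real d - s)"
  shows "\<exists>G. (\<forall>j<d. G j \<in> sets borel) \<and> B \<subseteq> (\<Union>j<d. G j) \<and>
    (\<forall>j<d. \<forall>D u C. D \<in> sets borel \<longrightarrow> u \<in> borel_measurable borel \<longrightarrow> 0 \<le> C \<longrightarrow>
      (\<forall>s\<in>D. \<forall>t\<in>D. \<bar>s - t\<bar> \<le> C * \<bar>c j (u s) - c j (u t)\<bar>) \<longrightarrow>
      (\<forall>s\<in>D. \<forall>t\<in>D. \<forall>i<d. i \<noteq> j \<longrightarrow> \<bar>c i (u s) - c i (u t)\<bar> \<le> \<bar>c j (u s) - c j (u t)\<bar> / real K) \<longrightarrow>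
      {t \<in> D. u t \<in> G j} \<in> null_sets lborel)"
proof -
  define crd where "crd y i = (if i < d then c i y else 0)" for y i
  define P where "P k G \<longleftrightarrow> (\<forall>j<d. G j \<in> sets borel) \<and> B \<subseteq> (\<Union>j<d. G j) \<and>
    (\<forall>j<d. \<forall>D u C q. D \<in> sets borel \<longrightarrow> (\<forall>i<d. (\<lambda>t. c i (u t)) \<in> borel_measurable borel) \<longrightarrow> 0 \<le> C \<longrightarrow>
      (\<forall>s\<in>D. \<forall>t\<in>D. \<bar>s - t\<bar> \<le> C * \<bar>c j (u s) - c j (u t)\<bar>) \<longrightarrow>
      (\<forall>s\<in>D. \<forall>t\<in>D. \<forall>i<d. i \<noteq> j \<longrightarrow> \<bar>c i (u s) - c i (u t)\<bar> \<le> \<bar>c j (u s) - c j (u t)\<bar> / real K) \<longrightarrow>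
      (\<forall>t\<in>D. cell d K 0 (crd (u t)) = q) \<longrightarrow>
      emeasure lborel {t \<in> D. u t \<in> G j} \<le> ennreal (C * (1/2) ^ k))" for k :: nat and G
  have "\<exists>G. P k G" for k
  proof -
    define h :: real where "h = (1/2) ^ k"
    have h0: "0 < h" by (simp add: h_def)
    have pw: "(h ^ d) powr (1 / real d) = h"
      using d h0 by (simp add: powr_powr powr_realpow[symmetric])
    have "0 < h ^ d" using h0 by simp
    from grid_cover_scale[OF d s H \<Lambda> hK this] show ?thesis
      unfolding P_def crd_def h_def[symmetric] pw .
  qed
  then obtain G where G: "\<And>k. P k (G k)" by metis
  define Bs where "Bs j = (\<Inter>m. \<Union>k\<in>{m..}. G k j)" for j
  have Gb: "G k j \<in> sets borel" if "j < d" for k j using G[of k] that unfolding P_def by blast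
  have Bb: "Bs j \<in> sets borel" if "j < d" for j
    unfolding Bs_def by (intro sets.countable_INT'' sets.countable_UN' image_subsetI Gb that) auto
  have cov: "B \<subseteq> (\<Union>j<d. Bs j)"
  proof
    fix y assume y: "y \<in> B"
    show "y \<in> (\<Union>j<d. Bs j)"
    proof (rule ccontr)
      assume "y \<notin> (\<Union>j<d. Bs j)"
      then have "\<exists>m. \<forall>k\<ge>m. y \<notin> G k j" if "j < d" for j using that unfolding Bs_def by fastforce
      then obtain m where m: "\<And>j k. j < d \<Longrightarrow> m j \<le> k \<Longrightarrow> y \<notin> G k j" by metis
      define k where "k = (\<Sum>j<d. m j)"
      have "B \<subseteq> (\<Union>j<d. G k j)" using G[of k] unfolding P_def by blast
      then obtain j where j: "j < d" "y \<in> G k j" using y by blast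
      have "m j \<le> k" unfolding k_def using j by (intro member_le_sum) auto
      then show False using m j by blast
    qed
  qed
  show ?thesis
  proof (intro exI[of _ Bs] conjI allI impI)
    fix j D u C
    assume j: "j < d" and D: "D \<in> sets borel" and u: "u \<in> borel_measurable borel" and C: "0 \<le> C"
      and st: "\<forall>s\<in>D. \<forall>t\<in>D. \<bar>s - t\<bar> \<le> C * \<bar>c j (u s) - c j (u t)\<bar>"
      and cone: "\<forall>s\<in>D. \<forall>t\<in>D. \<forall>i<d. i \<noteq> j \<longrightarrow> \<bar>c i (u s) - c i (u t)\<bar> \<le> \<bar>c j (u s) - c j (u t)\<bar> / real K"
    have cu: "(\<lambda>t. c i (u t)) \<in> borel_measurable borel" if "i < d" for i
    proof -
      have "c i \<in> borel_measurable borel"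
        using \<Lambda>(2)[OF that] lipschitz_on_continuous_on by (intro borel_measurable_continuous_onI)
      then show ?thesis by (rule measurable_compose[OF u])
    qed
    have crdu: "(\<lambda>t. crd (u t) i) \<in> borel_measurable borel" for i
      using cu[of i] by (cases "i < d") (auto simp: crd_def)
    \<comment> \<open>The bound holds within one cube of level 0, so \<open>D\<close> is split into
      countably many parts.\<close>
    define Dq where "Dq q = {t \<in> D. cell d K 0 (crd (u t)) = q}" for q
    have Dq: "Dq q \<in> sets borel" for q
    proof -
      have "(\<lambda>t. cell d K 0 (crd (u t))) -` {q} \<inter> space borel \<in> sets borel"
        by (rule measurable_sets[OF cell_measurable[OF crdu]]) simp
      then have "D \<inter> ((\<lambda>t. cell d K 0 (crd (u t))) -` {q} \<inter> space borel) \<in> sets borel"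
        by (rule sets.Int[OF D])
      moreover have "D \<inter> ((\<lambda>t. cell d K 0 (crd (u t))) -` {q} \<inter> space borel) = Dq q"
        by (auto simp: Dq_def)
      ultimately show ?thesis by (simp only:)
    qed
    define A where "A q k = {t \<in> Dq q. u t \<in> G k j}" for q k
    have Ab: "A q k \<in> sets lborel" for q k
    proof -
      have "Dq q \<inter> (u -` G k j \<inter> space borel) \<in> sets borel"
        by (rule sets.Int[OF Dq measurable_sets[OF u Gb[OF j]]])
      moreover have "Dq q \<inter> (u -` G k j \<inter> space borel) = A q k" by (auto simp: A_def)
      ultimately show ?thesis by (simp only: sets_lborel)
    qed
    have em: "emeasure lborel (A q k) \<le> ennreal (C * (1/2) ^ k)" for q k
    proof -
      have X: "\<forall>D u C q. D \<in> sets borel \<longrightarrow> (\<forall>i<d. (\<lambda>t. c i (u t)) \<in> borel_measurable borel) \<longrightarrow> 0 \<le> C \<longrightarrow>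
      (\<forall>s\<in>D. \<forall>t\<in>D. \<bar>s - t\<bar> \<le> C * \<bar>c j (u s) - c j (u t)\<bar>) \<longrightarrow>
      (\<forall>s\<in>D. \<forall>t\<in>D. \<forall>i<d. i \<noteq> j \<longrightarrow> \<bar>c i (u s) - c i (u t)\<bar> \<le> \<bar>c j (u s) - c j (u t)\<bar> / real K) \<longrightarrow>
      (\<forall>t\<in>D. cell d K 0 (crd (u t)) = q) \<longrightarrow>
      emeasure lborel {t \<in> D. u t \<in> G k j} \<le> ennreal (C * (1/2) ^ k)"
        using G[of k] j unfolding P_def by blast
      have sub: "Dq q \<subseteq> D" by (auto simp: Dq_def)
      show ?thesis
        unfolding A_def
      proof (rule X[rule_format, of "Dq q" u C q])
        show "\<bar>s - t\<bar> \<le> C * \<bar>c j (u s) - c j (u t)\<bar>" if "s \<in> Dq q" "t \<in> Dq q" for s t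
          using st that sub by blast
        show "\<bar>c i (u s) - c i (u t)\<bar> \<le> \<bar>c j (u s) - c j (u t)\<bar> / real K"
          if "s \<in> Dq q" "t \<in> Dq q" "i < d" "i \<noteq> j" for s t i
          using cone that sub by blast
      qed (use Dq cu C in \<open>simp_all add: Dq_def\<close>)
    qed
    have lim: "limsup (A q) \<in> null_sets lborel" for q
    proof (rule borel_cantelli_limsup1)
      show "emeasure lborel (A q k) < \<infinity>" for k
        unfolding infinity_ennreal_def by (rule le_less_trans[OF em ennreal_less_top])
      have "summable (\<lambda>k. C * (1/2) ^ k)" by (intro summable_mult summable_geometric) auto
      then show "summable (\<lambda>k. measure lborel (A q k))"
      proof (rule summable_comparison_test'[where N = 0])
        fix k
        have "measure lborel (A q k) \<le> C * (1/2) ^ k"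
          unfolding measure_def by (rule enn2real_leI[OF _ em]) (use C in simp)
        then show "norm (measure lborel (A q k)) \<le> C * (1/2) ^ k" by simp
      qed
    qed (rule Ab)
    have UNb: "(\<Union>q. limsup (A q)) \<in> null_sets lborel"
      by (rule null_sets_UN'[OF countableI_type lim])
    have sub: "{t \<in> D. u t \<in> Bs j} \<subseteq> (\<Union>q. limsup (A q))"
    proof
      fix t assume t: "t \<in> {t \<in> D. u t \<in> Bs j}"
      then have "t \<in> limsup (A (cell d K 0 (crd (u t))))"
        unfolding limsup_INF_SUP Bs_def A_def Dq_def by auto
      then show "t \<in> (\<Union>q. limsup (A q))" by blast
    qed
    have "D \<inter> (u -` Bs j \<inter> space borel) \<in> sets borel"
      by (rule sets.Int[OF D measurable_sets[OF u Bb[OF j]]])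
    moreover have "D \<inter> (u -` Bs j \<inter> space borel) = {t \<in> D. u t \<in> Bs j}" by auto
    ultimately have "{t \<in> D. u t \<in> Bs j} \<in> sets lborel" by (simp only: sets_lborel)
    then show "{t \<in> D. u t \<in> Bs j} \<in> null_sets lborel"
      by (rule null_sets_subset[OF UNb _ sub])
  qed (use Bb cov in auto)
qed

lemma cone_null_cover_exact:
  fixes e :: "nat \<Rightarrow> 'b::euclidean_space" and s0 s :: real
  assumes d: "1 \<le> d" and s: "0 \<le> s0" "s0 < s" "s < d" and H: "Hausdorff_measure s0 B < \<infinity>"
    and hK: "2 \<le> K" "real (2 ^ (d * (d - 1))) \<le> real K powr (real d - s)"
    and \<beta>: "0 < \<beta>" and ind: "\<And>a. \<beta> * (\<Sum>i<d. \<bar>a i\<bar>) \<le> norm (\<Sum>i<d. a i *\<^sub>R e i)"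
  shows "\<exists>G. (\<forall>j<d. dir_null (\<lambda>x. x) (e j) (\<beta> / (real K + 1)) (G j)) \<and> B \<subseteq> (\<Union>j<d. G j)"
proof -
  obtain z where z: "\<And>i. i < d \<Longrightarrow> norm (z i) \<le> 1 / \<beta>" "\<And>i j. i < d \<Longrightarrow> j < d \<Longrightarrow> inner (z i) (e j) = (if i = j then 1 else 0)"
    using dual_family[OF \<beta> ind] by blast
  define \<delta> where "\<delta> = \<beta> / (real K + 1)"
  have lip: "(1 / \<beta>)-lipschitz_on UNIV (\<lambda>x. inner (z i) x)" if "i < d" for i
  proof (rule lipschitz_onI)
    fix x y :: 'b
    have "\<bar>inner (z i) (x - y)\<bar> \<le> norm (z i) * norm (x - y)" by (rule Cauchy_Schwarz_ineq2)
    also have "\<dots> \<le> 1 / \<beta> * norm (x - y)" using z(1)[OF that] by (rule mult_right_mono) simp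
    finally show "dist (inner (z i) x) (inner (z i) y) \<le> 1 / \<beta> * dist x y"
      by (simp add: dist_norm inner_diff_right)
  qed (use \<beta> in simp)
  have "0 < 1 / \<beta>" using \<beta> by simp
  from hausdorff_cone_cover[where c = "\<lambda>i. inner (z i)", OF d s H this lip hK]
  obtain G where G1: "\<forall>j<d. G j \<in> sets borel" and G2: "B \<subseteq> (\<Union>j<d. G j)" and G3:
    "\<forall>j<d. \<forall>D u C. D \<in> sets borel \<longrightarrow> u \<in> borel_measurable borel \<longrightarrow> 0 \<le> C \<longrightarrow>
      (\<forall>s\<in>D. \<forall>t\<in>D. \<bar>s - t\<bar> \<le> C * \<bar>inner (z j) (u s) - inner (z j) (u t)\<bar>) \<longrightarrow>
      (\<forall>s\<in>D. \<forall>t\<in>D. \<forall>i<d. i \<noteq> j \<longrightarrow> \<bar>inner (z i) (u s) - inner (z i) (u t)\<bar> \<le> \<bar>inner (z j) (u s) - inner (z j) (u t)\<bar> / real K) \<longrightarrow>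
      {t \<in> D. u t \<in> G j} \<in> null_sets lborel"
    by - (drule meta_mp, assumption, elim exE conjE, rule that)
  have "dir_null (\<lambda>x. x) (e j) \<delta> (G j)" if j: "j < d" for j
    unfolding dir_null_def
  proof (intro conjI allI impI)
    fix D u assume f: "dir_frag (\<lambda>x. x) (e j) \<delta> D u"
    \<comment> \<open>Extension by zero gives a Borel map on the whole line that agrees with
      \<open>u\<close> on \<open>D\<close>.\<close>
    define u' where "u' t = indicator D t *\<^sub>R u t" for t :: real
    have D: "D \<in> sets borel" using f by (auto simp: dir_frag_def borel_compact)
    have u': "u' \<in> borel_measurable borel"
      unfolding u'_def using D f by (intro borel_measurable_continuous_on_indicator) (auto simp: dir_frag_def)
    have uu: "u' t = u t" if "t \<in> D" for t using that by (simp add: u'_def)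
    have est: "\<bar>inner (z i) (u s) - inner (z i) (u t) - (s - t) * (if i = j then 1 else 0)\<bar> \<le> 1 / (real K + 1) * \<bar>s - t\<bar>"
      if st: "s \<in> D" "t \<in> D" and i: "i < d" for s t i
    proof -
      have "inner (z i) (u s) - inner (z i) (u t) - (s - t) * (if i = j then 1 else 0) = inner (z i) (u s - u t - (s - t) *\<^sub>R e j)"
        using z(2)[OF i j] by (simp add: inner_diff_right)
      also have "\<bar>\<dots>\<bar> \<le> norm (z i) * norm (u s - u t - (s - t) *\<^sub>R e j)" by (rule Cauchy_Schwarz_ineq2)
      also have "\<dots> \<le> (1 / \<beta>) * (\<delta> * \<bar>s - t\<bar>)"
        using z(1)[OF i] f st \<beta> by (intro mult_mono) (auto simp: dir_frag_def)
      also have "\<dots> = 1 / (real K + 1) * \<bar>s - t\<bar>" using \<beta> by (simp add: \<delta>_def)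
      finally show ?thesis .
    qed
    have K1: "0 < real K" "1 / (real K + 1) \<le> 1 / 2" using hK by auto
    have big: "(1 - 1 / (real K + 1)) * \<bar>s - t\<bar> \<le> \<bar>inner (z j) (u s) - inner (z j) (u t)\<bar>"
      if st: "s \<in> D" "t \<in> D" for s t
      using est[OF st j] by (simp add: algebra_simps)
    have "{t \<in> D. u' t \<in> G j} \<in> null_sets lborel"
    proof (rule G3[rule_format, OF j D u', of 2])
      fix s t assume st: "s \<in> D" "t \<in> D"
      have "1 / 2 * \<bar>s - t\<bar> \<le> (1 - 1 / (real K + 1)) * \<bar>s - t\<bar>" using K1 by (intro mult_right_mono) auto
      from order_trans[OF this big[OF st]] show "\<bar>s - t\<bar> \<le> 2 * \<bar>inner (z j) (u' s) - inner (z j) (u' t)\<bar>"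
        using uu[OF st(1)] uu[OF st(2)] by simp
    next
      fix s t i assume st: "s \<in> D" "t \<in> D" and i: "i < d" "i \<noteq> j"
      have "\<bar>inner (z i) (u s) - inner (z i) (u t)\<bar> \<le> 1 / (real K + 1) * \<bar>s - t\<bar>"
        using est[OF st i(1)] i(2) by simp
      also have "1 / (real K + 1) = (1 - 1 / (real K + 1)) / real K"
      proof -
        have "1 / (real K + 1) * (real K + 1) = 1" by simp
        then have "1 - 1 / (real K + 1) = 1 / (real K + 1) * real K" unfolding distrib_left by linarith
        then show ?thesis using K1(1) by simp
      qed
      also have "\<dots> * \<bar>s - t\<bar> = ((1 - 1 / (real K + 1)) * \<bar>s - t\<bar>) / real K" by simp
      also have "\<dots> \<le> \<bar>inner (z j) (u s) - inner (z j) (u t)\<bar> / real K"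
        using big[OF st] by (rule divide_right_mono) simp
      finally show "\<bar>inner (z i) (u' s) - inner (z i) (u' t)\<bar> \<le> \<bar>inner (z j) (u' s) - inner (z j) (u' t)\<bar> / real K"
        using uu[OF st(1)] uu[OF st(2)] by simp
    qed simp
    moreover have "{t \<in> D. u' t \<in> G j} = {t \<in> D. u t \<in> G j}" using uu by auto
    ultimately show "{t \<in> D. u t \<in> G j} \<in> null_sets lborel" by (simp only:)
  qed (rule G1[rule_format, OF j])
  then show ?thesis using G2 unfolding \<delta>_def by blast
qed

text \<open>The opening of the cones above shrinks as \<open>s0\<close> increases to \<open>d\<close>. Splitting the directions
  into finitely many narrow cones makes the opening independent of \<open>s0\<close>.\<close>

lemma cone_null_cover:
  fixes e :: "nat \<Rightarrow> 'b::euclidean_space" and s0 :: real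
  assumes d: "1 \<le> d" and s: "0 \<le> s0" "s0 < d" and H: "Hausdorff_measure s0 B < \<infinity>"
    and \<beta>: "0 < \<beta>" and ind: "\<And>a. \<beta> * (\<Sum>i<d. \<bar>a i\<bar>) \<le> norm (\<Sum>i<d. a i *\<^sub>R e i)"
  shows "\<exists>G. (\<forall>j<d. dir_null (\<lambda>x. x) (e j) (\<beta> / 2) (G j)) \<and> B \<subseteq> (\<Union>j<d. G j)"
proof -
  define s where "s = (s0 + real d) / 2"
  have s': "s0 < s" "s < d" using s by (auto simp: s_def)
  obtain K :: nat where K: "2 \<le> K" "real (2 ^ (d * (d - 1))) \<le> real K powr (real d - s)"
    using grid_size_exists[OF s'(2)] .
  \<comment> \<open>If each \<open>y i\<close> is within \<open>\<beta> / 2\<close> of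
    \<open>e i\<close>, the frame \<open>y\<close> satisfies the independence estimate with constant
    \<open>\<beta> / 2\<close>. So \<open>cone_null_cover_exact\<close> gives this opening for all
    such frames.\<close>
  define \<delta> where "\<delta> = \<beta> / 2 / (real K + 1)"
  have \<delta>: "0 < \<delta>" using \<beta> by (simp add: \<delta>_def)
  have "\<exists>Y. finite Y \<and> Y \<subseteq> cball (e j) (\<beta> / 2) \<and> cball (e j) (\<beta> / 2) \<subseteq> (\<Union>y\<in>Y. ball y \<delta>)" for j
    using seq_compact_imp_totally_bounded[of "cball (e j) (\<beta> / 2)"] \<delta> compact_imp_seq_compact[OF compact_cball] by blast
  then obtain Y where Y: "\<And>j. finite (Y j)" "\<And>j. Y j \<subseteq> cball (e j) (\<beta> / 2)"
     "\<And>j. cball (e j) (\<beta> / 2) \<subseteq> (\<Union>y\<in>Y j. ball y \<delta>)" by metis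
  define T where "T = PiE {..<d} Y"
  have fT: "finite T" unfolding T_def using Y(1) by (intro finite_PiE) auto
  have "\<exists>G. (\<forall>j<d. dir_null (\<lambda>x. x) (y j) \<delta> (G j)) \<and> B \<subseteq> (\<Union>j<d. G j)" if y: "y \<in> T" for y
    unfolding \<delta>_def
  proof (rule cone_null_cover_exact[OF d s(1) s' H K])
    fix a :: "nat \<Rightarrow> real"
    have "norm (\<Sum>i<d. a i *\<^sub>R (e i - y i)) \<le> (\<Sum>i<d. \<bar>a i\<bar> * (\<beta> / 2))"
    proof (rule sum_norm_le)
      fix i assume "i \<in> {..<d}"
      then have "norm (e i - y i) \<le> \<beta> / 2" using y Y(2)[of i] by (auto simp: T_def PiE_iff dist_norm)
      then have "\<bar>a i\<bar> * norm (e i - y i) \<le> \<bar>a i\<bar> * (\<beta> / 2)" by (rule mult_left_mono) simp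
      then show "norm (a i *\<^sub>R (e i - y i)) \<le> \<bar>a i\<bar> * (\<beta> / 2)" by simp
    qed
    also have "\<dots> = \<beta> / 2 * (\<Sum>i<d. \<bar>a i\<bar>)" by (simp add: sum_distrib_left mult.commute)
    finally have 1: "norm (\<Sum>i<d. a i *\<^sub>R (e i - y i)) \<le> \<beta> / 2 * (\<Sum>i<d. \<bar>a i\<bar>)" .
    have "(\<Sum>i<d. a i *\<^sub>R e i) = (\<Sum>i<d. a i *\<^sub>R y i) + (\<Sum>i<d. a i *\<^sub>R (e i - y i))"
      by (simp add: sum.distrib[symmetric] scaleR_add_right[symmetric])
    then have "norm (\<Sum>i<d. a i *\<^sub>R e i) \<le> norm (\<Sum>i<d. a i *\<^sub>R y i) + norm (\<Sum>i<d. a i *\<^sub>R (e i - y i))"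
      by (metis norm_triangle_ineq)
    then show "\<beta> / 2 * (\<Sum>i<d. \<bar>a i\<bar>) \<le> norm (\<Sum>i<d. a i *\<^sub>R y i)"
      using ind[of a] 1 by (simp add: field_simps)
  qed (use \<beta> in simp)
  then obtain G where G: "\<And>y j. y \<in> T \<Longrightarrow> j < d \<Longrightarrow> dir_null (\<lambda>x. x) (y j) \<delta> (G y j)"
    "\<And>y. y \<in> T \<Longrightarrow> B \<subseteq> (\<Union>j<d. G y j)" by metis
  define A where "A j w = (\<Union>y\<in>{y \<in> T. y j = w}. G y j)" for j w
  \<comment> \<open>A point outside every \<open>Bs j\<close> misses some \<open>A j (w j)\<close>
    for each \<open>j\<close>, contrary to the cover belonging to the tuple \<open>w\<close>. When a
    fragment is in \<open>Bs j\<close> with derivative near the net point \<open>w\<close>, it is in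
    \<open>A j w\<close>, which is null for that direction.\<close>
  define Bs where "Bs j = UNIV \<inter> (\<Inter>w\<in>Y j. A j w)" for j
  have An: "dir_null (\<lambda>x. x) w \<delta> (A j w)" if "j < d" for j w
    unfolding A_def using fT G(1) that by (intro dir_null_UN) (auto intro: countable_finite)
  have Yne: "Y j \<noteq> {}" for j
    using Y(3)[of j] \<beta> centre_in_cball[of "e j" "\<beta> / 2"] by force
  have Bb: "Bs j \<in> sets borel" if j: "j < d" for j
    unfolding Bs_def using An[OF j] Y(1)[of j] Yne[of j]
    by (intro sets.Int sets.finite_INT) (auto simp: dir_null_def)
  have "dir_null (\<lambda>x. x) (e j) (\<beta> / 2) (Bs j)" if j: "j < d" for j
    unfolding dir_null_def
  proof (intro conjI allI impI)
    fix D u assume f: "dir_frag (\<lambda>x. x) (e j) (\<beta> / 2) D u"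
    obtain N where N: "N \<in> null_sets lborel" "\<And>t. t \<in> D - N \<Longrightarrow> \<exists>y. norm (y - e j) \<le> \<beta> / 2 \<and> (u has_vector_derivative y) (at t within D)"
      using dir_frag_derivative_AE[OF f] \<beta> by auto
    have Dc: "compact D" "continuous_on D u" using f by (auto simp: dir_frag_def)
    define Z where "Z w = {t \<in> D. u t \<in> A j w \<and>
        (\<exists>v'. dist v' w < \<delta> \<and> (u has_vector_derivative v') (at t within D))}" for w
    have "\<exists>M\<in>null_sets lborel. Z w \<subseteq> M" for w
      unfolding Z_def by (rule dir_null_deriv[OF An[OF j] Dc continuous_on_id])
    then obtain M where M: "\<And>w. M w \<in> null_sets lborel" "\<And>w. Z w \<subseteq> M w" by metis
    have null: "N \<union> (\<Union>w\<in>Y j. M w) \<in> null_sets lborel"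
      using N(1) M(1) Y(1) by (intro null_sets.Un null_sets_UN' countable_finite)
    have sub: "{t \<in> D. u t \<in> Bs j} \<subseteq> N \<union> (\<Union>w\<in>Y j. M w)"
    proof
      fix t assume t: "t \<in> {t \<in> D. u t \<in> Bs j}"
      show "t \<in> N \<union> (\<Union>w\<in>Y j. M w)"
      proof (cases "t \<in> N")
        case False
        then obtain y where y: "norm (y - e j) \<le> \<beta> / 2" "(u has_vector_derivative y) (at t within D)" using N(2) t by blast
        have "y \<in> cball (e j) (\<beta> / 2)" using y(1) by (simp add: dist_norm norm_minus_commute)
        then obtain w where w: "w \<in> Y j" "dist y w < \<delta>" using Y(3)[of j] by (auto simp: dist_commute)
        have "u t \<in> A j w" using t w(1) by (simp add: Bs_def)
        then have "t \<in> Z w" unfolding Z_def using t y(2) w(2) by blast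
        then have "t \<in> M w" using M(2) by blast
        then show ?thesis using w(1) by blast
      qed simp
    qed
    have "{t \<in> D. u t \<in> Bs j} \<in> sets lborel"
      unfolding sets_lborel by (rule continuous_on_preimage_borel[OF Dc Bb[OF j]])
    then show "{t \<in> D. u t \<in> Bs j} \<in> null_sets lborel"
      by (rule null_sets_subset[OF null _ sub])
  qed (rule Bb[OF j])
  moreover have "B \<subseteq> (\<Union>j<d. Bs j)"
  proof
    fix b assume b: "b \<in> B"
    show "b \<in> (\<Union>j<d. Bs j)"
    proof (rule ccontr)
      assume "b \<notin> (\<Union>j<d. Bs j)"
      then have "\<forall>j\<in>{..<d}. \<exists>w\<in>Y j. b \<notin> A j w" unfolding Bs_def by auto
      then obtain w where w: "\<And>j. j < d \<Longrightarrow> w j \<in> Y j \<and> b \<notin> A j (w j)" by (metis lessThan_iff)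
      define y where "y = restrict w {..<d}"
      have y: "y \<in> T" using w by (auto simp: T_def y_def)
      then obtain j where j: "j < d" "b \<in> G y j" using G(2) b by blast
      have "b \<in> A j (w j)" unfolding A_def using y j by (auto simp: y_def intro!: UN_I[of y])
      then show False using w j by blast
    qed
  qed
  ultimately show ?thesis by blast
qed

section \<open>Maps with low-dimensional images\<close>

text \<open>With \<open>V = norm v\<close> and \<open>e = J v\<close>, the derivative
  \<open>y\<close> of \<open>f \<circ> \<gamma>\<close> has norm at most \<open>V + \<rho>\<close>
  because \<open>f\<close> is 1-Lipschitz. If it is farther than \<open>\<sigma>\<close> from
  \<open>e\<close>, expanding the square of \<open>norm (y - e)\<close> shows that
  \<open>inner y e\<close> stays \<open>(\<sigma>\<^sup>2 - \<rho>\<^sup>2) / 2\<close> below the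
  bound \<open>V * (V + \<rho>)\<close>. The total deficit is at most
  \<open>2 * \<rho> * V * (b - a) + 2 * \<epsilon> * V\<close>, since \<open>f\<close> is close to
  \<open>J\<close> at the first and last point of the fragment. Where the derivative is near
  \<open>e\<close>, the set \<open>B\<close> is met only in a null set of times.\<close>

lemma perturbed_fragment_bound:
  fixes f J :: "'a::euclidean_space \<Rightarrow> 'b::euclidean_space"
  assumes f: "1-lipschitz_on UNIV f" and fr: "dir_frag (\<lambda>x. x) v \<rho> D \<gamma>"
    and \<rho>: "0 \<le> \<rho>" "\<rho> < \<sigma>" "\<sigma> < \<sigma>'" and D: "D \<subseteq> {a..b}" "a \<le> b"
    and J: "linear J" "\<And>x. inner (J x) (J v) = inner x v"
    and \<epsilon>: "0 \<le> \<epsilon>" "\<And>t. t \<in> D \<Longrightarrow> norm (f (\<gamma> t) - J (\<gamma> t)) \<le> \<epsilon>"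
    and B: "dir_null (\<lambda>x. x) (J v) \<sigma>' B"
  shows "emeasure lborel {t \<in> D. f (\<gamma> t) \<in> B}
    \<le> ennreal ((2 * \<rho> * norm v * (b - a) + 2 * \<epsilon> * norm v) / ((\<sigma>\<^sup>2 - \<rho>\<^sup>2) / 2))"
proof (cases "D = {}")
  case ne: False
  define u where "u t = f (\<gamma> t)" for t
  define V where "V = norm v"
  define e where "e = J v"
  have V0: "0 \<le> V" by (simp add: V_def)
  have eV: "norm e = V" unfolding e_def V_def using J(2)[of v] by (simp add: norm_eq_sqrt_inner)
  have Dc: "compact D" "continuous_on D \<gamma>" using fr by (auto simp: dir_frag_def)
  have fc: "continuous_on UNIV f" by (rule lipschitz_on_continuous_on[OF f])
  have uc: "continuous_on D u" unfolding u_def by (rule continuous_on_compose2[OF fc Dc(2)]) simp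
  obtain a0 where a0: "a0 \<in> D" "\<And>t. t \<in> D \<Longrightarrow> a0 \<le> t" using compact_attains_inf[OF Dc(1) ne] by blast
  obtain b0 where b0: "b0 \<in> D" "\<And>t. t \<in> D \<Longrightarrow> t \<le> b0" using compact_attains_sup[OF Dc(1) ne] by blast
  have ab: "a0 \<le> b0" "b0 - a0 \<le> b - a"
  proof -
    show "a0 \<le> b0" by (rule a0(2)[OF b0(1)])
    have "a \<le> a0" "b0 \<le> b" using subsetD[OF D(1) a0(1)] subsetD[OF D(1) b0(1)] by auto
    then show "b0 - a0 \<le> b - a" by linarith
  qed
  have ulip: "norm (u s - u t) \<le> (V + \<rho>) * \<bar>s - t\<bar>" if "s \<in> D" "t \<in> D" for s t
  proof -
    have "norm (u s - u t) \<le> norm (\<gamma> s - \<gamma> t)"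
      using lipschitz_onD[OF f, of "\<gamma> s" "\<gamma> t"] by (simp add: u_def dist_norm)
    also have "\<dots> \<le> (V + \<rho>) * \<bar>s - t\<bar>"
      using lipschitz_onD[OF dir_frag_lipschitz[OF fr \<rho>(1)] that] by (simp add: V_def dist_norm)
    finally show ?thesis .
  qed
  have "(V + \<rho>)-lipschitz_on D u"
    by (rule lipschitz_onI) (use ulip V0 \<rho> in \<open>auto simp: dist_norm\<close>)
  from lipschitz_euclidean_differentiable_AE[OF this]
  obtain N1 where N1: "N1 \<in> null_sets lborel" "\<forall>t\<in>D - N1. \<exists>y. (u has_vector_derivative y) (at t within D)"
    by (rule bexE)
  define Z where "Z = {t \<in> D. u t \<in> B \<and> (\<exists>y. dist y e < \<sigma>' \<and> (u has_vector_derivative y) (at t within D))}"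
  have "\<exists>N\<in>null_sets lborel. Z \<subseteq> N"
    unfolding Z_def e_def by (rule dir_null_deriv[OF B Dc(1) uc continuous_on_id])
  then obtain N2 where N2: "N2 \<in> null_sets lborel" "Z \<subseteq> N2" by blast
  define L where "L = V * (V + \<rho>)"
  have "L-lipschitz_on D (\<lambda>t. inner (u t) e)"
  proof (rule lipschitz_onI)
    fix s t assume st: "s \<in> D" "t \<in> D"
    have "\<bar>inner (u s - u t) e\<bar> \<le> norm (u s - u t) * norm e" by (rule Cauchy_Schwarz_ineq2)
    also have "\<dots> \<le> ((V + \<rho>) * \<bar>s - t\<bar>) * V" unfolding eV using ulip[OF st] V0 by (rule mult_right_mono)
    finally show "dist (inner (u s) e) (inner (u t) e) \<le> L * dist s t"
      by (simp add: dist_real_def inner_diff_left L_def mult_ac)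
  qed (use V0 \<rho> in \<open>simp add: L_def\<close>)
  then obtain g where g: "L-lipschitz_on UNIV g" "\<And>t. t \<in> D \<Longrightarrow> g t = inner (u t) e"
    using lipschitz_real_extension[OF _ ne] by blast
  obtain N3 where N3: "N3 \<in> null_sets lborel" "\<And>t. t \<notin> N3 \<Longrightarrow> \<exists>y. (g has_real_derivative y) (at t)"
    using lipschitz_real_differentiable_AE[OF g(1)] by blast
  \<comment> \<open>\<open>H\<close> accumulates the deficit. It is monotone because
    \<open>L = V * (V + \<rho>)\<close> is a Lipschitz constant of \<open>g\<close>.\<close>
  define H where "H t = L * t - g t" for t
  have mH: "mono H"
  proof (rule monoI)
    fix s t :: real assume "s \<le> t"
    then have "\<bar>g t - g s\<bar> \<le> L * (t - s)" using lipschitz_onD[OF g(1), of t s] by (simp add: dist_real_def)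
    then show "H s \<le> H t" by (simp add: H_def algebra_simps abs_le_iff)
  qed
  have cH: "continuous_on UNIV H"
    unfolding H_def by (intro continuous_intros lipschitz_on_continuous_on[OF g(1)])
  define \<beta> where "\<beta> = (\<sigma>\<^sup>2 - \<rho>\<^sup>2) / 2"
  have \<beta>: "0 < \<beta>" using \<rho> by (simp add: \<beta>_def power_strict_mono)
  define P where "P = {t \<in> D. u t \<in> B}"
  define N where "N = N1 \<union> N2 \<union> N3"
  have N: "N \<in> null_sets lborel" unfolding N_def using N1(1) N2(1) N3(1) by (intro null_sets.Un)
  have Pb: "P \<in> sets borel"
    unfolding P_def using B by (intro continuous_on_preimage_borel[OF Dc(1) uc]) (simp add: dir_null_def)
  have Nb: "N \<in> sets borel" using N by auto
  have "ennreal \<beta> * emeasure lborel (P - N) \<le> ennreal (H b0 - H a0)"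
  proof (rule slope_measure_bound[where h = H])
    show "P - N \<in> sets borel" using Pb Nb by (rule sets.Diff)
    show "P - N \<subseteq> {a0..b0}" using a0 b0 by (auto simp: P_def)
    fix t \<delta> :: real assume t: "t \<in> P - N" and \<delta>: "0 < \<delta>"
    then have tD: "t \<in> D" and tB: "u t \<in> B" and tN: "t \<notin> N1" "t \<notin> N2" "t \<notin> N3" by (auto simp: P_def N_def)
    obtain y where y: "(u has_vector_derivative y) (at t within D)" using N1(2) tD tN by blast
    have notZ: "\<not> (dist y' e < \<sigma>' \<and> (u has_vector_derivative y') (at t within D))" for y'
      using N2(2) tN(2) tD tB unfolding Z_def by blast
    have \<sigma>0: "0 < \<sigma>'" using \<rho> by linarith
    \<comment> \<open>At an isolated time \<open>e\<close> would be a derivative, which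
      \<open>notZ\<close> excludes.\<close>
    have lim: "t islimpt D" using has_vector_derivative_isolated[of t D u e] notZ[of e] \<sigma>0 by auto
    have yb: "norm y \<le> V + \<rho>"
      using has_vector_derivative_norm_bound[OF y tD lim, of 0 "V + \<rho>"] ulip tD by simp
    have far: "\<sigma> < norm (y - e)" using notZ[of y] y \<rho> by (simp add: dist_norm)
    obtain g' where g': "(g has_real_derivative g') (at t)" using N3(2) tN by blast
    have "(g has_vector_derivative g') (at t within D)"
      using g' by (simp add: has_real_derivative_iff_has_vector_derivative has_vector_derivative_at_within)
    moreover have "((\<lambda>t. inner (u t) e) has_vector_derivative inner y e) (at t within D)"
      by (rule bounded_linear.has_vector_derivative[OF bounded_linear_inner_left y])
    then have "(g has_vector_derivative inner y e) (at t within D)"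
      by (rule has_vector_derivative_transform[OF tD, rotated]) (rule g(2))
    ultimately have gy: "g' = inner y e"
      using lim by (intro vector_derivative_unique_within[of t D g]) (simp_all add: trivial_limit_within)
    have "\<sigma>\<^sup>2 < (norm (y - e))\<^sup>2" using far \<rho> by (intro power_strict_mono) auto
    also have "\<dots> = (norm y)\<^sup>2 - 2 * inner y e + V\<^sup>2"
      by (simp add: eV[symmetric] power2_norm_eq_inner inner_diff_left inner_diff_right inner_commute)
    also have "\<dots> \<le> (V + \<rho>)\<^sup>2 - 2 * inner y e + V\<^sup>2" using yb by (simp add: power_mono)
    \<comment> \<open>Here
      \<open>(V + \<rho>)\<^sup>2 + V\<^sup>2 = 2 * L + \<rho>\<^sup>2\<close>.\<close>
    finally have "\<sigma>\<^sup>2 - \<rho>\<^sup>2 < 2 * (L - inner y e)"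
      by (simp add: L_def power2_eq_square algebra_simps)
    then have "(\<sigma>\<^sup>2 - \<rho>\<^sup>2) / 2 < 2 * (L - inner y e) / 2" by (rule divide_strict_right_mono) simp
    then have slope: "\<beta> < L - g'" unfolding \<beta>_def gy by simp
    have "(H has_real_derivative L - g') (at t)"
      unfolding H_def using g' by (auto intro!: derivative_eq_intros)
    show "\<exists>s. s \<noteq> 0 \<and> \<bar>s\<bar> < \<delta> \<and> \<beta> \<le> (H (t + s) - H t) / s"
    proof -
      have "((\<lambda>s. (H (t + s) - H t) / s) \<longlongrightarrow> L - g') (at 0)"
        using \<open>(H has_real_derivative L - g') (at t)\<close> unfolding DERIV_def .
      from order_tendstoD(1)[OF this slope]
      obtain \<delta>' where \<delta>': "0 < \<delta>'" "\<forall>s. s \<noteq> 0 \<and> dist s 0 < \<delta>' \<longrightarrow> \<beta> < (H (t + s) - H t) / s"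
        unfolding eventually_at by auto
      obtain s where s: "0 < s" "s < min \<delta> \<delta>'" using dense[of 0 "min \<delta> \<delta>'"] \<delta> \<delta>'(1) by auto
      then have "\<beta> < (H (t + s) - H t) / s" using \<delta>'(2) by simp
      then show ?thesis using s by (intro exI[of _ s]) simp
    qed
  qed (rule mH cH ab(1) | use \<beta> in simp)+
  then have "ennreal (1 / \<beta>) * (ennreal \<beta> * emeasure lborel (P - N)) \<le> ennreal (1 / \<beta>) * ennreal (H b0 - H a0)"
    by (rule mult_left_mono) simp
  moreover have "ennreal (1 / \<beta>) * (ennreal \<beta> * emeasure lborel (P - N)) = emeasure lborel (P - N)"
    using \<beta> by (simp add: mult.assoc[symmetric] ennreal_mult[symmetric])
  moreover have "ennreal (1 / \<beta>) * ennreal (H b0 - H a0) = ennreal ((H b0 - H a0) / \<beta>)"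
    using \<beta> monoD[OF mH ab(1)] by (simp add: ennreal_mult[symmetric])
  ultimately have PN: "emeasure lborel (P - N) \<le> ennreal ((H b0 - H a0) / \<beta>)" by (simp only:)
  have "emeasure lborel P = emeasure lborel (P - N)"
    using emeasure_Diff_null_set[OF N, of P] Pb by (simp only: sets_lborel)
  also note PN
  also have "ennreal ((H b0 - H a0) / \<beta>) \<le> ennreal ((2 * \<rho> * V * (b - a) + 2 * \<epsilon> * V) / \<beta>)"
  proof (intro ennreal_leI divide_right_mono)
    define G where "G = \<gamma> b0 - \<gamma> a0"
    define T where "T = b0 - a0"
    have T0: "0 \<le> T" "T \<le> b - a" using ab by (auto simp: T_def)
    have "norm (\<gamma> b0 - \<gamma> a0 - (b0 - a0) *\<^sub>R v) \<le> \<rho> * \<bar>b0 - a0\<bar>" using fr a0(1) b0(1) unfolding dir_frag_def by blast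
    then have G: "norm (G - T *\<^sub>R v) \<le> \<rho> * T" using T0 by (simp add: G_def T_def)
    have "\<bar>inner (G - T *\<^sub>R v) v\<bar> \<le> norm (G - T *\<^sub>R v) * norm v" by (rule Cauchy_Schwarz_ineq2)
    also have "\<dots> \<le> \<rho> * T * V" unfolding V_def using G by (rule mult_right_mono) simp
    finally have i1: "T * V\<^sup>2 - \<rho> * T * V \<le> inner G v"
      by (simp add: inner_diff_left V_def power2_norm_eq_inner abs_le_iff)
    have "norm ((u b0 - u a0) - J G) \<le> 2 * \<epsilon>"
    proof -
      have "(u b0 - u a0) - J G = (f (\<gamma> b0) - J (\<gamma> b0)) - (f (\<gamma> a0) - J (\<gamma> a0))"
        by (simp add: u_def G_def linear_diff[OF J(1)])
      also have "norm \<dots> \<le> \<epsilon> + \<epsilon>" by (intro order_trans[OF norm_triangle_ineq4] add_mono \<epsilon>(2) a0(1) b0(1))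
      finally show ?thesis by simp
    qed
    then have "norm ((u b0 - u a0) - J G) * V \<le> 2 * \<epsilon> * V" using V0 by (rule mult_right_mono)
    moreover have "\<bar>inner ((u b0 - u a0) - J G) e\<bar> \<le> norm ((u b0 - u a0) - J G) * V"
      using Cauchy_Schwarz_ineq2[of "(u b0 - u a0) - J G" e] eV by simp
    moreover have "inner (J G) e = inner G v" unfolding e_def by (rule J(2))
    ultimately have i2: "inner G v - 2 * \<epsilon> * V \<le> inner (u b0 - u a0) e"
      by (simp add: inner_diff_left abs_le_iff)
    have "H b0 - H a0 = L * T - inner (u b0 - u a0) e"
      using g(2) a0(1) b0(1) by (simp add: H_def T_def inner_diff_left algebra_simps)
    also have "\<dots> \<le> L * T - (T * V\<^sup>2 - \<rho> * T * V - 2 * \<epsilon> * V)" using i1 i2 by linarith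
    also have "\<dots> = 2 * (\<rho> * V) * T + 2 * \<epsilon> * V" by (simp add: L_def power2_eq_square algebra_simps)
    also have "2 * (\<rho> * V) * T \<le> 2 * (\<rho> * V) * (b - a)" using T0 \<rho> V0 by (intro mult_left_mono) auto
    finally show "H b0 - H a0 \<le> 2 * \<rho> * V * (b - a) + 2 * \<epsilon> * V" by (simp add: mult.assoc)
  qed (use \<beta> in simp)
  finally show ?thesis unfolding P_def u_def V_def \<beta>_def .
qed simp

section \<open>Mazur's lemma for bounded vector-valued functions\<close>

definition tail_weights :: "nat \<Rightarrow> nat \<Rightarrow> (nat \<Rightarrow> real) \<Rightarrow> bool" where
  "tail_weights N m \<alpha> \<longleftrightarrow> (\<forall>j. 0 \<le> \<alpha> j) \<and> (\<forall>j. j < N \<or> m \<le> j \<longrightarrow> \<alpha> j = 0) \<and> (\<Sum>j<m. \<alpha> j) = 1"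

text \<open>Mazur's lemma: near-minimisers of the norm over the convex hulls of the tails form a Cauchy
  sequence, by the parallelogram law.\<close>

lemma tail_combination_AE_Cauchy:
  fixes g :: "nat \<Rightarrow> 'a \<Rightarrow> 'e::euclidean_space"
  assumes fin: "finite_measure M" and g: "\<And>n. g n \<in> borel_measurable M" and C: "\<And>n x. norm (g n x) \<le> C"
  shows "\<exists>m \<alpha>. (\<forall>n. tail_weights n (m n) (\<alpha> n)) \<and> (AE x in M. Cauchy (\<lambda>n. \<Sum>j<m n. \<alpha> n j *\<^sub>R g j x))"
proof -
  interpret finite_measure M by (rule fin)
  define u where "u m \<alpha> x = (\<Sum>j<m. \<alpha> j *\<^sub>R g j x)" for m and \<alpha> :: "nat \<Rightarrow> real" and x
  have C0: "0 \<le> C" using C[of 0 undefined] norm_ge_zero order_trans by blast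
  have um: "u m \<alpha> \<in> borel_measurable M" for m \<alpha>
    unfolding u_def using g by (intro borel_measurable_sum borel_measurable_scaleR borel_measurable_const)
  have ub: "norm (u m \<alpha> x) \<le> C" if "tail_weights N m \<alpha>" for N m \<alpha> x
  proof -
    have "norm (u m \<alpha> x) \<le> (\<Sum>j<m. \<alpha> j * C)"
      unfolding u_def using that C by (intro sum_norm_le) (auto simp: tail_weights_def intro!: mult_left_mono)
    also have "\<dots> = C" using that by (simp add: tail_weights_def sum_distrib_right[symmetric])
    finally show ?thesis .
  qed
  define Q where "Q f = (\<integral>x. (norm (f x))\<^sup>2 \<partial>M)" for f :: "'a \<Rightarrow> 'e"
  have int: "integrable M (\<lambda>x. (norm (f x))\<^sup>2)" if "f \<in> borel_measurable M" "\<And>x. norm (f x) \<le> K" for f :: "'a \<Rightarrow> 'e" and K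
    using that by (intro integrable_const_bound[of _ "K\<^sup>2"]) (auto intro!: AE_I2 power_mono)
  define S where "S N = {Q (u m \<alpha>) | m \<alpha>. tail_weights N m \<alpha>}" for N
  \<comment> \<open>The convex hulls of the tails shrink as \<open>N\<close> grows, so these infima
    increase; being bounded, they form a Cauchy sequence.\<close>
  define a where "a N = Inf (S N)" for N
  have Sne: "S N \<noteq> {}" for N
  proof -
    have "tail_weights N (Suc N) (\<lambda>j. if j = N then 1 else 0)" by (auto simp: tail_weights_def)
    then show ?thesis unfolding S_def by blast
  qed
  have Sbb: "bdd_below (S N)" for N
    by (rule bdd_belowI[of _ 0]) (auto simp: S_def Q_def)
  have Sle: "a N \<le> Q (u m \<alpha>)" if "tail_weights N m \<alpha>" for N m \<alpha>
    unfolding a_def by (rule cInf_lower[OF _ Sbb]) (use that in \<open>auto simp: S_def\<close>)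
  have tw_mono: "tail_weights N m \<alpha>" if "N \<le> N'" "tail_weights N' m \<alpha>" for N N' m \<alpha>
    using that by (auto simp: tail_weights_def)
  have a_mono: "a N \<le> a N'" if "N \<le> N'" for N N'
    unfolding a_def[of N']
  proof (rule cInf_greatest[OF Sne])
    fix q assume "q \<in> S N'"
    then obtain m \<alpha> where q: "q = Q (u m \<alpha>)" "tail_weights N' m \<alpha>" unfolding S_def by blast
    show "a N \<le> q" unfolding q(1) by (rule Sle[OF tw_mono[OF that q(2)]])
  qed
  have a_bd: "a N \<le> C\<^sup>2 * measure M (space M)" for N
  proof -
    obtain m \<alpha> where t: "tail_weights N m \<alpha>" using Sne[of N] by (auto simp: S_def)
    have "Q (u m \<alpha>) \<le> (\<integral>x. C\<^sup>2 \<partial>M)"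
      unfolding Q_def using ub[OF t] by (intro integral_mono int[OF um]) (auto intro!: power_mono)
    then show ?thesis using Sle[OF t] by (simp add: mult.commute)
  qed
  have "\<exists>m \<alpha>. tail_weights N m \<alpha> \<and> Q (u m \<alpha>) < a N + 1 / real (Suc N)" for N
  proof -
    have "Inf (S N) < a N + 1 / real (Suc N)" by (simp add: a_def)
    then show ?thesis using cInf_less_iff[OF Sne Sbb] by (auto simp: S_def)
  qed
  then obtain m \<alpha> where m\<alpha>: "\<And>N. tail_weights N (m N) (\<alpha> N)" "\<And>N. Q (u (m N) (\<alpha> N)) < a N + 1 / real (Suc N)"
    by metis
  define w where "w N = u (m N) (\<alpha> N)" for N
  have wm: "w N \<in> borel_measurable M" for N unfolding w_def by (rule um)
  have wb: "norm (w N x) \<le> C" for N x unfolding w_def by (rule ub[OF m\<alpha>(1)])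
  have ext: "u m' \<alpha>' x = u m'' \<alpha>' x \<and> tail_weights N m'' \<alpha>'" if t: "tail_weights N m' \<alpha>'" "m' \<le> m''" for N m' m'' \<alpha>' x
  proof -
    have "(\<Sum>j<m''. h j) = (\<Sum>j<m'. h j)" if "\<And>j. m' \<le> j \<Longrightarrow> h j = 0" for h :: "nat \<Rightarrow> 'z::comm_monoid_add"
      using \<open>m' \<le> m''\<close> that by (intro sum.mono_neutral_right) auto
    note this[of \<alpha>'] this[of "\<lambda>j. \<alpha>' j *\<^sub>R g j x"]
    then show ?thesis using t by (auto simp: tail_weights_def u_def)
  qed
  have diffQ: "Q (\<lambda>x. w N x - w N' x) \<le> 2 * (a N' - a N) + 4 * (1 / real (Suc N))" if NN: "N \<le> N'" for N N'
  proof -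
    define mm where "mm = max (m N) (m N')"
    \<comment> \<open>The midpoint of two near-minimisers is again a combination of the tail from
      \<open>N\<close>, so \<open>a N\<close> bounds its \<open>Q\<close> from below.\<close>
    define \<alpha>m where "\<alpha>m j = (\<alpha> N j + \<alpha> N' j) / 2" for j
    have t1: "tail_weights N mm (\<alpha> N)" and e1: "w N x = u mm (\<alpha> N) x" for x
      using ext[OF m\<alpha>(1)[of N], of mm] by (auto simp: mm_def w_def)
    have t2: "tail_weights N mm (\<alpha> N')" and e2: "w N' x = u mm (\<alpha> N') x" for x
      using ext[OF m\<alpha>(1)[of N'], of mm] tw_mono[OF NN] by (auto simp: mm_def w_def)
    have tm: "tail_weights N mm \<alpha>m"
      using t1 t2 by (auto simp: tail_weights_def \<alpha>m_def sum.distrib sum_divide_distrib[symmetric])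
    have em: "u mm \<alpha>m x = (1/2) *\<^sub>R (w N x + w N' x)" for x
      unfolding e1 e2 by (simp add: u_def \<alpha>m_def scaleR_sum_right sum.distrib[symmetric] scaleR_add_right scaleR_add_left add_divide_distrib)
    have par: "(norm (w N x - w N' x))\<^sup>2 = 2 * (norm (w N x))\<^sup>2 + 2 * (norm (w N' x))\<^sup>2 - 4 * (norm (u mm \<alpha>m x))\<^sup>2" for x
    proof -
      have "4 * (norm (u mm \<alpha>m x))\<^sup>2 = (norm (w N x + w N' x))\<^sup>2"
        unfolding em by (simp add: power_divide)
      then show ?thesis
        by (simp add: power2_norm_eq_inner inner_diff_left inner_diff_right inner_add_left inner_add_right inner_commute)
    qed
    have "Q (\<lambda>x. w N x - w N' x) = 2 * Q (w N) + 2 * Q (w N') - 4 * Q (u mm \<alpha>m)"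
      unfolding Q_def par using int[OF wm wb] int[OF um ub[OF tm]] by simp
    also have "\<dots> \<le> 2 * (a N + 1 / real (Suc N)) + 2 * (a N' + 1 / real (Suc N')) - 4 * a N"
    proof -
      have "2 * x + 2 * y - 4 * c \<le> 2 * x' + 2 * y' - 4 * c'" if "x < x'" "y < y'" "c' \<le> c" for x y c x' y' c' :: real
        using that by linarith
      from this[OF m\<alpha>(2) m\<alpha>(2) Sle[OF tm]] show ?thesis unfolding w_def .
    qed
    also have "1 / real (Suc N') \<le> 1 / real (Suc N)" using NN by (intro divide_left_mono) auto
    finally show ?thesis by (simp add: algebra_simps del: of_nat_Suc)
  qed
  have "incseq a" using a_mono by (simp add: incseq_def)
  moreover have "bdd_above (range a)" using a_bd by (intro bdd_aboveI2)
  ultimately have "a \<longlonglongrightarrow> (SUP n. a n)" using LIMSEQ_incseq_SUP by blast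
  then have "Cauchy a" by (rule LIMSEQ_imp_Cauchy)
  have L1: "\<exists>N0. \<forall>i\<ge>N0. \<forall>j\<ge>N0. (LINT x|M. norm (w i x - w j x)) < e" if e: "0 < e" for e
  proof -
    define K where "K = measure M (space M)"
    have K0: "0 \<le> K" by (simp add: K_def)
    \<comment> \<open>The subsequence theorem asks for a Cauchy sequence in L1. On a finite measure
      space the inequality \<open>y \<le> \<delta> / 2 + y\<^sup>2 / (2 * \<delta>)\<close> passes
      there from L2; with this \<open>\<delta>\<close> and \<open>Q\<close> below
      \<open>\<delta> * e\<close>, both summands integrate to less than
      \<open>e / 2\<close>.\<close>
    define \<delta> where "\<delta> = e / (K + 1)"
    have \<delta>: "0 < \<delta>" using e K0 by (simp add: \<delta>_def)
    have "0 < \<delta> * e / 4" using \<delta> e by simp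
    then obtain N1 where N1: "\<And>i j. N1 \<le> i \<Longrightarrow> N1 \<le> j \<Longrightarrow> \<bar>a i - a j\<bar> < \<delta> * e / 4"
      using CauchyD[OF \<open>Cauchy a\<close>, of "\<delta> * e / 4"] by (auto simp: real_norm_def)
    obtain N2 where N2: "1 / real (Suc N2) < \<delta> * e / 8" using nat_approx_posE[of "\<delta> * e / 8"] \<delta> e by auto
    have main: "(LINT x|M. norm (w i x - w j x)) < e" if ij: "max N1 N2 \<le> i" "i \<le> j" for i j
    proof -
      have qi: "Q (\<lambda>x. w i x - w j x) < \<delta> * e"
      proof -
        have "1 / real (Suc i) \<le> 1 / real (Suc N2)" using ij by (intro divide_left_mono) auto
        moreover have "q < y" if "q \<le> 2 * (x' - x) + 4 * s" "\<bar>x - x'\<bar> < y / 4" "s \<le> s'" "s' < y / 8"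
          for q x x' s s' y :: real
        proof -
          have "x' - x < y / 4" using that(2) unfolding abs_less_iff by simp
          moreover have "s < y / 8" using that(3,4) by (rule le_less_trans)
          ultimately
          have "2 * (x' - x) + 4 * s < 2 * (y / 4) + 4 * (y / 8)"
            by (intro add_strict_mono mult_strict_left_mono) auto
          then show "q < y" using that(1) by simp
        qed
        ultimately show ?thesis using diffQ[OF ij(2)] N1[of i j] N2 ij by (meson max.boundedE order_trans)
      qed
      have dm: "(\<lambda>x. w i x - w j x) \<in> borel_measurable M" by (intro borel_measurable_diff wm)
      have db: "norm (w i x - w j x) \<le> C + C" for x by (intro order_trans[OF norm_triangle_ineq4] add_mono wb)
      have pt: "norm (w i x - w j x) \<le> \<delta> / 2 + (norm (w i x - w j x))\<^sup>2 / (2 * \<delta>)" for x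
      proof -
        define y where "y = norm (w i x - w j x)"
        have "0 \<le> (y - \<delta>)\<^sup>2" by simp
        then have "2 * \<delta> * y \<le> \<delta>\<^sup>2 + y\<^sup>2" by (simp add: power2_diff algebra_simps)
        then have "y \<le> (\<delta>\<^sup>2 + y\<^sup>2) / (2 * \<delta>)" using \<delta> by (simp add: pos_le_divide_eq mult.commute)
        also have "\<dots> = \<delta> / 2 + y\<^sup>2 / (2 * \<delta>)" using \<delta> by (simp add: add_divide_distrib power2_eq_square)
        finally show ?thesis by (simp add: y_def)
      qed
      have "(LINT x|M. norm (w i x - w j x)) \<le> (LINT x|M. \<delta> / 2 + (norm (w i x - w j x))\<^sup>2 / (2 * \<delta>))"
        using pt int[OF dm db] dm db
        by (intro integral_mono) (auto intro!: integrable_const_bound[of _ "C + C"] AE_I2)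
      also have "\<dots> = \<delta> / 2 * K + Q (\<lambda>x. w i x - w j x) / (2 * \<delta>)"
        using int[OF dm db] by (simp add: Q_def K_def)
      also have "\<dots> < \<delta> / 2 * (K + 1) + \<delta> * e / (2 * \<delta>)"
        using qi \<delta> by (intro add_less_le_mono divide_right_mono) auto
      also have "\<dots> = e"
      proof -
        have "\<delta> * (K + 1) = e" using K0 by (simp add: \<delta>_def)
        then have "\<delta> / 2 * (K + 1) = e / 2" by simp
        moreover have "\<delta> * e / (2 * \<delta>) = e / 2" using \<delta> by simp
        ultimately show ?thesis by simp
      qed
      finally show ?thesis .
    qed
    show ?thesis
    proof (intro exI[of _ "max N1 N2"] allI impI)
      fix i j assume "max N1 N2 \<le> i" "max N1 N2 \<le> j"
      then show "(LINT x|M. norm (w i x - w j x)) < e"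
        using main[of i j] main[of j i] by (cases "i \<le> j") (auto simp: norm_minus_commute)
    qed
  qed
  have wi: "integrable M (w n)" for n
    using wm wb by (intro integrable_const_bound[of _ C]) auto
  obtain r where r: "strict_mono r" "AE x in M. Cauchy (\<lambda>i. w (r i) x)"
    using cauchy_L1_AE_cauchy_subseq[of M w, OF wi L1] by blast
  show ?thesis
  proof (intro exI[of _ "\<lambda>n. m (r n)"] exI[of _ "\<lambda>n. \<alpha> (r n)"] conjI allI)
    show "tail_weights n (m (r n)) (\<alpha> (r n))" for n
      by (rule tw_mono[OF seq_suble[OF r(1)] m\<alpha>(1)])
    show "AE x in M. Cauchy (\<lambda>n. \<Sum>j<m (r n). \<alpha> (r n) j *\<^sub>R g j x)"
      using r(2) by (simp add: w_def u_def)
  qed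
qed

section \<open>Independence estimates and maps isometric on a span\<close>

lemma independence_constant:
  fixes v :: "nat \<Rightarrow> 'a::real_inner"
  assumes ind: "\<And>a. (\<Sum>i<d. a i *\<^sub>R v i) = 0 \<Longrightarrow> \<forall>i<d. a i = 0"
  shows "\<exists>\<beta>>0. \<forall>a. \<beta> * (\<Sum>i<d. \<bar>a i\<bar>) \<le> norm (\<Sum>i<d. a i *\<^sub>R v i)"
proof -
  have "\<exists>z. inner z (v i) = 1 \<and> (\<forall>j<d. j \<noteq> i \<longrightarrow> inner z (v j) = 0)" if i: "i < d" for i
  proof -
    obtain r a where r: "r = (\<Sum>j<d. a j *\<^sub>R v j)" "a i = 1" "inner r (v i) = (norm r)\<^sup>2"
      "\<forall>j<d. j \<noteq> i \<longrightarrow> inner r (v j) = 0"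
      using orthogonal_residual[OF i, of v] by blast
    have "r \<noteq> 0" using r(1,2) ind[of a] i by auto
    then show ?thesis using r(3,4) by (intro exI[of _ "r /\<^sub>R (norm r)\<^sup>2"]) auto
  qed
  then obtain z where z: "\<And>i. i < d \<Longrightarrow> inner (z i) (v i) = 1" "\<And>i j. i < d \<Longrightarrow> j < d \<Longrightarrow> j \<noteq> i \<Longrightarrow> inner (z i) (v j) = 0"
    by metis
  \<comment> \<open>Inner products with the dual vectors \<open>z i\<close> recover the
    coefficients, so their norms control the sum of the absolute values. The \<open>+ 1\<close>
    keeps \<open>S\<close> positive even when \<open>d = 0\<close>.\<close>
  define S where "S = (\<Sum>i<d. norm (z i)) + 1"
  have S: "0 < S" unfolding S_def by (intro add_nonneg_pos sum_nonneg) auto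
  have "1 / S * (\<Sum>i<d. \<bar>a i\<bar>) \<le> norm (\<Sum>i<d. a i *\<^sub>R v i)" for a
  proof -
    let ?x = "\<Sum>i<d. a i *\<^sub>R v i"
    have "\<bar>a i\<bar> \<le> norm (z i) * norm ?x" if i: "i < d" for i
    proof -
      have "inner (z i) ?x = (\<Sum>j<d. a j * inner (z i) (v j))" by (simp add: inner_sum_right)
      also have "\<dots> = (\<Sum>j<d. if j = i then a j else 0)" using z i by (intro sum.cong) auto
      also have "\<dots> = a i" using i by simp
      finally show ?thesis using Cauchy_Schwarz_ineq2[of "z i" ?x] by simp
    qed
    then have "(\<Sum>i<d. \<bar>a i\<bar>) \<le> (\<Sum>i<d. norm (z i) * norm ?x)" by (intro sum_mono) auto
    also have "\<dots> = (\<Sum>i<d. norm (z i)) * norm ?x" by (rule sum_distrib_right[symmetric])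
    also have "\<dots> \<le> S * norm ?x" by (intro mult_right_mono) (auto simp: S_def)
    finally show ?thesis using S by (simp add: pos_divide_le_eq mult.commute)
  qed
  then show ?thesis using S by (intro exI[of _ "1 / S"]) auto
qed

text \<open>\<open>J\<close> is the orthogonal projection to the span followed by an isometric
  embedding into the target. Hence it is 1-Lipschitz everywhere and preserves inner products as soon
  as one argument lies in the span.\<close>

lemma isometric_on_span:
  fixes v :: "nat \<Rightarrow> 'a::euclidean_space"
  assumes d: "d \<le> DIM('b::euclidean_space)"
  obtains J :: "'a \<Rightarrow> 'b::euclidean_space" where "linear J" "\<And>x. norm (J x) \<le> norm x"
    "\<And>x y. y \<in> span (v ` {..<d}) \<Longrightarrow> inner (J x) (J y) = inner x y"
proof -
  obtain B where B: "B \<subseteq> span (v ` {..<d})" "pairwise orthogonal B" "\<And>x. x \<in> B \<Longrightarrow> norm x = 1"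
    "independent B" "card B = dim (span (v ` {..<d}))" "span B = span (v ` {..<d})"
    by (rule orthonormal_basis_subspace[OF subspace_span]) blast
  have fB: "finite B" using B(4) by (rule independent_imp_finite)
  have "card B \<le> card (v ` {..<d})" using B(5) by (simp add: dim_le_card')
  also have "\<dots> \<le> d" using card_image_le[of "{..<d}" v] by simp
  finally have "card B \<le> card (Basis :: 'b set)" using d by simp
  then obtain \<tau> where \<tau>: "\<tau> ` B \<subseteq> (Basis :: 'b set)" "inj_on \<tau> B" using card_le_inj[OF fB finite_Basis] by blast
  define J where "J x = (\<Sum>b\<in>B. inner x b *\<^sub>R \<tau> b)" for x
  have ip: "inner (J x) (J y) = (\<Sum>b\<in>B. inner x b * inner y b)" for x y
  proof -
    have "inner (J x) (\<tau> b) = inner x b" if b: "b \<in> B" for b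
    proof -
      have "inner (J x) (\<tau> b) = (\<Sum>c\<in>B. inner x c * inner (\<tau> c) (\<tau> b))" by (simp add: J_def inner_sum_left)
      also have "\<dots> = (\<Sum>c\<in>B. if c = b then inner x c else 0)"
      proof (rule sum.cong[OF refl])
        fix c assume c: "c \<in> B"
        have "inner (\<tau> c) (\<tau> b) = (if \<tau> c = \<tau> b then 1 else 0)"
          using \<tau>(1) b c by (intro inner_Basis) auto
        then show "inner x c * inner (\<tau> c) (\<tau> b) = (if c = b then inner x c else 0)"
          using inj_on_eq_iff[OF \<tau>(2) c b] by simp
      qed
      also have "\<dots> = inner x b" using fB b by simp
      finally show ?thesis .
    qed
    then show ?thesis unfolding J_def[of y] by (simp add: inner_sum_right mult.commute)
  qed
  have iso: "inner (J x) (J y) = inner x y" if y: "y \<in> span (v ` {..<d})" for x y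
  proof -
    have "y = (\<Sum>b\<in>B. inner y b *\<^sub>R b)"
      using orthonormal_basis_expand[OF B(2,3) _ fB, of y] y B(6) by simp
    then have "inner x y = (\<Sum>b\<in>B. inner y b * inner x b)" by (metis (no_types, lifting) inner_scaleR_right inner_sum_right sum.cong)
    then show ?thesis by (simp add: ip mult.commute)
  qed
  show thesis
  proof (rule that[of J])
    show "linear J"
      by (rule linearI) (auto simp: J_def inner_add_left scaleR_add_left sum.distrib scaleR_sum_right)
    show "norm (J x) \<le> norm x" for x
    proof -
      define p where "p = (\<Sum>b\<in>B. inner x b *\<^sub>R b)"
      have p: "p \<in> span (v ` {..<d})" unfolding p_def B(6)[symmetric] by (intro span_sum span_scale span_base)
      have Jp: "inner (J x) (J x) = inner x p" unfolding ip by (simp add: p_def inner_sum_right)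
      have "inner p b = inner x b" if "b \<in> B" for b
      proof -
        have "inner p b = (\<Sum>c\<in>B. inner x c * inner c b)" by (simp add: p_def inner_sum_left)
        also have "\<dots> = (\<Sum>c\<in>B. if c = b then inner x c else 0)"
          using B(2,3) that by (intro sum.cong refl) (auto simp: pairwise_def orthogonal_def norm_eq_1)
        also have "\<dots> = inner x b" using fB that by simp
        finally show ?thesis .
      qed
      then have "(\<Sum>b\<in>B. inner x b * inner p b) = (\<Sum>b\<in>B. inner x b * inner x b)" by (intro sum.cong) auto
      moreover have "inner p p = (\<Sum>b\<in>B. inner x b * inner p b)" by (subst (2) p_def) (simp add: inner_sum_right)
      moreover have "inner x p = (\<Sum>b\<in>B. inner x b * inner x b)" by (simp add: p_def inner_sum_right)
      ultimately have "inner p p = inner x p" by simp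
      then have "(norm p)\<^sup>2 = (norm (J x))\<^sup>2" using Jp by (simp add: power2_norm_eq_inner)
      then have e: "norm p = norm (J x)" by simp
      have "(norm (J x))\<^sup>2 \<le> norm x * norm (J x)"
        using Jp norm_cauchy_schwarz[of x p] by (simp add: power2_norm_eq_inner e)
      then show ?thesis by (cases "J x = 0") (auto simp: power2_eq_square)
    qed
  qed (rule iso)
qed

section \<open>Dependent directions with independent derivatives\<close>

text \<open>The vectors \<open>c i *\<^sub>R v i\<close> are the sides of a closed polygon, while
  the velocities \<open>w i\<close> along it predict a nonzero change of \<open>F\<close>. So at
  every base point there is a side \<open>j\<close> such that the prediction for the sides from
  \<open>Suc j\<close> on holds but that for the sides from \<open>j\<close> on fails. A fragment
  with velocity near \<open>(v j, w j)\<close> carries the prediction backwards over side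
  \<open>j\<close> at almost all of its times, and is therefore almost never in this set.\<close>

lemma circuit_null_cover:
  fixes F :: "'a::euclidean_space \<Rightarrow> 'b::real_normed_vector" and c :: "nat \<Rightarrow> real"
  assumes F: "L-lipschitz_on UNIV F" and v: "(\<Sum>i<p. c i *\<^sub>R v i) = 0" and w: "(\<Sum>i<p. c i *\<^sub>R w i) \<noteq> 0"
  shows "\<exists>\<rho>>0. \<exists>N. (\<forall>j<p. dir_null (\<lambda>x. (x, F x)) (v j, w j) \<rho> (N j)) \<and> (\<Union>j<p. N j) = UNIV"
proof -
  have L0: "0 \<le> L" using F by (rule lipschitz_on_nonneg)
  have Fl: "norm (F x - F y) \<le> L * norm (x - y)" for x y using lipschitz_onD[OF F, of x y] by (simp add: dist_norm)
  have cF: "continuous_on UNIV F" by (rule lipschitz_on_continuous_on[OF F])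
  \<comment> \<open>Error of one side in units of \<open>\<rho> * s\<close>. The duration of the
    side is at most \<open>(\<bar>c i\<bar> + 1) * s\<close>, the norms come from the error in that
    duration, and an error in position costs \<open>L\<close> times as much in the value of
    \<open>F\<close>.\<close>
  define C where "C i = L * (\<bar>c i\<bar> + 1 + norm (v i)) + (\<bar>c i\<bar> + 1 + norm (w i))" for i
  have C0: "0 \<le> C i" for i using L0 by (simp add: C_def)
  define q where "q j = (\<Sum>i\<in>{j..<p}. c i *\<^sub>R v i)" for j
  define z where "z j = (\<Sum>i\<in>{j..<p}. c i *\<^sub>R w i)" for j
  define S where "S = (\<Sum>i<p. C i)"
  have S0: "0 \<le> S" unfolding S_def using C0 by (intro sum_nonneg)
  have q0: "q 0 = 0" "z 0 \<noteq> 0" "q p = 0" "z p = 0"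
    using v w by (auto simp: q_def z_def lessThan_atLeast0)
  \<comment> \<open>The errors of all sides together amount to at most
    \<open>norm (z 0) / 2\<close>, so they cannot hide the predicted change.\<close>
  define \<rho> where "\<rho> = min 1 (norm (z 0) / (2 * (S + 1)))"
  have \<rho>: "0 < \<rho>" "\<rho> \<le> 1" using q0(2) S0 by (auto simp: \<rho>_def)
  define \<eta> where "\<eta> j = \<rho> * (\<Sum>i\<in>{j..<p}. C i)" for j
  have \<eta>0: "\<eta> 0 < norm (z 0)"
  proof -
    have "\<rho> * S \<le> (norm (z 0) / (2 * (S + 1))) * S" using S0 by (intro mult_right_mono) (auto simp: \<rho>_def)
    also have "\<dots> \<le> (norm (z 0) / (2 * (S + 1))) * (S + 1)" using S0 by (intro mult_left_mono) auto
    also have "\<dots> = norm (z 0) / 2"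
    proof -
      have "y / (2 * x) * x = y / 2" if "x \<noteq> 0" for x y :: real using that by simp
      moreover have "S + 1 \<noteq> 0" using S0 by linarith
      ultimately show ?thesis .
    qed
    also have "\<dots> < norm (z 0)" using q0(2) by simp
    finally show ?thesis by (simp add: \<eta>_def S_def lessThan_atLeast0)
  qed
  define Z where "Z j k = {x. \<forall>s. 0 < s \<and> s < 1 / real (Suc k) \<longrightarrow> norm (F (x + s *\<^sub>R q j) - F x - s *\<^sub>R z j) \<le> \<eta> j * s}" for j k
  \<comment> \<open>\<open>ZZ p\<close> is everything, as no side is left. \<open>ZZ 0\<close> is
    empty: the closed polygon returns to its start, and the prediction \<open>z 0\<close> exceeds
    the tolerance \<open>\<eta> 0\<close>.\<close>
  define ZZ where "ZZ j = (\<Union>k. Z j k)" for j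
  have Zc: "closed (Z j k)" for j k
  proof -
    have "closed {x \<in> UNIV. norm (F (x + s *\<^sub>R q j) - F x - s *\<^sub>R z j) \<le> \<eta> j * s}" for s
      by (intro continuous_on_closed_Collect_le continuous_intros continuous_on_compose2[OF cF] cF) auto
    then have "closed (\<Inter>s\<in>{s. 0 < s \<and> s < 1 / real (Suc k)}. {x \<in> UNIV. norm (F (x + s *\<^sub>R q j) - F x - s *\<^sub>R z j) \<le> \<eta> j * s})"
      by (intro closed_INT ballI)
    moreover have "(\<Inter>s\<in>{s. 0 < s \<and> s < 1 / real (Suc k)}. {x \<in> UNIV. norm (F (x + s *\<^sub>R q j) - F x - s *\<^sub>R z j) \<le> \<eta> j * s}) = Z j k"
      by (auto simp: Z_def)
    ultimately show ?thesis by (simp only:)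
  qed
  have Zb: "Z j k \<in> sets borel" for j k by (rule borel_closed[OF Zc])
  have ZZb: "ZZ j \<in> sets borel" for j unfolding ZZ_def by (intro sets.countable_UN' image_subsetI Zb countableI_type)
  have ZZp: "ZZ p = UNIV" by (auto simp: ZZ_def Z_def q0 \<eta>_def)
  have ZZ0: "ZZ 0 = {}"
  proof -
    have "x \<notin> Z 0 k" for x k
    proof
      assume "x \<in> Z 0 k"
      then have "norm (F (x + s *\<^sub>R q 0) - F x - s *\<^sub>R z 0) \<le> \<eta> 0 * s" if "0 < s" "s < 1 / real (Suc k)" for s
        using that unfolding Z_def by blast
      moreover obtain s :: real where s: "0 < s" "s < 1 / real (Suc k)" using dense[of 0 "1 / real (Suc k)"] by auto
      ultimately have "norm (F (x + s *\<^sub>R q 0) - F x - s *\<^sub>R z 0) \<le> \<eta> 0 * s" by blast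
      then have "norm (z 0) * s \<le> \<eta> 0 * s" using q0(1) s by (simp add: mult.commute)
      then have "norm (z 0) \<le> \<eta> 0" using s(1) by (rule mult_right_le_imp_le)
      then show False using \<eta>0 by simp
    qed
    then show ?thesis by (auto simp: ZZ_def)
  qed
  define N where "N j = ZZ (Suc j) - ZZ j" for j
  have "(\<Union>j<p. N j) = UNIV"
  proof (rule ccontr)
    assume "(\<Union>j<p. N j) \<noteq> UNIV"
    then obtain x where x: "\<And>j. j < p \<Longrightarrow> x \<notin> N j" by blast
    have "x \<in> ZZ 0"
    proof (rule inc_induct[of 0 p "\<lambda>j. x \<in> ZZ j"])
      fix n assume "0 \<le> n" "n < p" "x \<in> ZZ (Suc n)"
      then show "x \<in> ZZ n" using x[of n] by (simp add: N_def)
    qed (use ZZp in auto)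
    then show False using ZZ0 by simp
  qed
  moreover have "dir_null (\<lambda>x. (x, F x)) (v j, w j) \<rho> (N j)" if j: "j < p" for j
  proof -
    \<comment> \<open>Fixing \<open>k\<close> makes the prediction from \<open>Suc j\<close> on
      valid below one common scale at all points of the set. It is applied at the moved point
      \<open>\<gamma> t\<close>, found by \<open>density_points_AE\<close>, and not at
      \<open>\<gamma> t0\<close>.\<close>
    have one: "dir_null (\<lambda>x. (x, F x)) (v j, w j) \<rho> (Z (Suc j) k - ZZ j)" for k
      unfolding dir_null_def
    proof (intro conjI allI impI)
      show "Z (Suc j) k - ZZ j \<in> sets borel" by (rule sets.Diff[OF Zb ZZb])
      fix D \<gamma> assume f: "dir_frag (\<lambda>x. (x, F x)) (v j, w j) \<rho> D \<gamma>"
      have D: "compact D" "continuous_on D \<gamma>" using f by (auto simp: dir_frag_def)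
      define P where "P = {t \<in> D. \<gamma> t \<in> Z (Suc j) k - ZZ j}"
      have Pb: "P \<in> sets borel" unfolding P_def by (rule continuous_on_preimage_borel[OF D sets.Diff[OF Zb ZZb]])
      have "emeasure lborel P \<le> emeasure lborel D" using borel_compact[OF D(1)] by (intro emeasure_mono) (auto simp: P_def)
      then have Pf: "emeasure lborel P < \<infinity>" using emeasure_compact_finite[OF D(1)] by (rule le_less_trans)
      have split: "q j = c j *\<^sub>R v j + q (Suc j)" "z j = c j *\<^sub>R w j + z (Suc j)" "\<eta> j = \<rho> * C j + \<eta> (Suc j)"
        using j by (simp_all add: q_def z_def \<eta>_def sum.atLeast_Suc_lessThan distrib_left)
      have "P \<in> null_sets lborel"
      proof (rule density_points_AE[OF Pb \<rho>(1) Pf, where c = "c j"])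
        fix t0 s0 :: real assume t0: "t0 \<in> P" and s0: "0 < s0"
        show "\<exists>s. 0 < s \<and> s < s0 \<and> P \<inter> cball (t0 + c j * s) (\<rho> * s) = {}"
        proof (rule ccontr)
          assume no: "\<not> ?thesis"
          have est: "norm (F (\<gamma> t0 + s *\<^sub>R q j) - F (\<gamma> t0) - s *\<^sub>R z j) \<le> \<eta> j * s"
            if s: "0 < s" "s < s0" "s < 1 / real (Suc k)" for s
          proof -
            obtain t where t: "t \<in> P" "t \<in> cball (t0 + c j * s) (\<rho> * s)" using no s by blast
            define \<Delta> where "\<Delta> = t - t0"
            have d1: "\<bar>\<Delta> - c j * s\<bar> \<le> \<rho> * s" using t(2) by (simp add: \<Delta>_def dist_real_def abs_le_iff algebra_simps)
            have "\<rho> * s \<le> 1 * s" using \<rho> s by (intro mult_right_mono) auto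
            moreover have "\<bar>c j * s\<bar> = \<bar>c j\<bar> * s" using s by (simp add: abs_mult)
            ultimately have d2: "\<bar>\<Delta>\<bar> \<le> (\<bar>c j\<bar> + 1) * s" using d1 by (simp add: distrib_right)
            have tD: "t \<in> D" "t0 \<in> D" using t t0 by (auto simp: P_def)
            have "norm ((\<gamma> t, F (\<gamma> t)) - (\<gamma> t0, F (\<gamma> t0)) - (t - t0) *\<^sub>R (v j, w j)) \<le> \<rho> * \<bar>t - t0\<bar>"
              using f tD unfolding dir_frag_def by blast
            then have pr: "norm (\<gamma> t - \<gamma> t0 - \<Delta> *\<^sub>R v j, F (\<gamma> t) - F (\<gamma> t0) - \<Delta> *\<^sub>R w j) \<le> \<rho> * \<bar>\<Delta>\<bar>"
              by (simp add: \<Delta>_def)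
            have \<rho>\<Delta>: "\<rho> * \<bar>\<Delta>\<bar> \<le> \<rho> * ((\<bar>c j\<bar> + 1) * s)" using d2 \<rho> by (intro mult_left_mono) auto
            have gen: "norm (x - (c j * s) *\<^sub>R y) \<le> \<rho> * s * (\<bar>c j\<bar> + 1 + norm y)"
              if "norm (x - \<Delta> *\<^sub>R y) \<le> \<rho> * \<bar>\<Delta>\<bar>" for x y :: "'c::real_normed_vector"
            proof -
              have "x - (c j * s) *\<^sub>R y = (x - \<Delta> *\<^sub>R y) + (\<Delta> - c j * s) *\<^sub>R y" by (simp add: algebra_simps)
              then have "norm (x - (c j * s) *\<^sub>R y) \<le> norm (x - \<Delta> *\<^sub>R y) + norm ((\<Delta> - c j * s) *\<^sub>R y)"
                by (metis norm_triangle_ineq)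
              also have "\<dots> \<le> \<rho> * ((\<bar>c j\<bar> + 1) * s) + (\<rho> * s) * norm y"
                using that \<rho>\<Delta> d1 by (intro add_mono) (auto intro: mult_right_mono)
              finally show ?thesis by (simp add: algebra_simps)
            qed
            have e1: "norm (\<gamma> t - \<gamma> t0 - (c j * s) *\<^sub>R v j) \<le> \<rho> * s * (\<bar>c j\<bar> + 1 + norm (v j))"
              using order_trans[OF norm_fst_le pr] by (intro gen) simp
            have e2: "norm (F (\<gamma> t) - F (\<gamma> t0) - (c j * s) *\<^sub>R w j) \<le> \<rho> * s * (\<bar>c j\<bar> + 1 + norm (w j))"
              using order_trans[OF norm_snd_le pr] by (intro gen) simp
            have e3: "norm (F (\<gamma> t + s *\<^sub>R q (Suc j)) - F (\<gamma> t) - s *\<^sub>R z (Suc j)) \<le> \<eta> (Suc j) * s"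
              using t(1) s unfolding P_def Z_def by blast
            have e4: "norm (F (\<gamma> t0 + s *\<^sub>R q j) - F (\<gamma> t + s *\<^sub>R q (Suc j))) \<le> L * (\<rho> * s * (\<bar>c j\<bar> + 1 + norm (v j)))"
            proof -
              have "norm ((\<gamma> t0 + s *\<^sub>R q j) - (\<gamma> t + s *\<^sub>R q (Suc j))) = norm (\<gamma> t - \<gamma> t0 - (c j * s) *\<^sub>R v j)"
                unfolding split(1) by (subst norm_minus_commute) (simp add: algebra_simps)
              then show ?thesis using Fl[of "\<gamma> t0 + s *\<^sub>R q j" "\<gamma> t + s *\<^sub>R q (Suc j)"] mult_left_mono[OF e1 L0] by simp
            qed
            have "F (\<gamma> t0 + s *\<^sub>R q j) - F (\<gamma> t0) - s *\<^sub>R z j =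
              (F (\<gamma> t0 + s *\<^sub>R q j) - F (\<gamma> t + s *\<^sub>R q (Suc j))) + (F (\<gamma> t + s *\<^sub>R q (Suc j)) - F (\<gamma> t) - s *\<^sub>R z (Suc j))
              + (F (\<gamma> t) - F (\<gamma> t0) - (c j * s) *\<^sub>R w j)"
              unfolding split(2) by (simp add: algebra_simps)
            also have "norm \<dots> \<le> L * (\<rho> * s * (\<bar>c j\<bar> + 1 + norm (v j))) + \<eta> (Suc j) * s + \<rho> * s * (\<bar>c j\<bar> + 1 + norm (w j))"
              by (intro order_trans[OF norm_triangle_ineq] add_mono e2 e3 e4)
            also have "\<dots> = \<eta> j * s" unfolding split(3) C_def by (simp add: algebra_simps)
            finally show ?thesis .
          qed
          obtain k' where k': "1 / real (Suc k') < min s0 (1 / real (Suc k))"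
            using nat_approx_posE[of "min s0 (1 / real (Suc k))"] s0 by auto
          have "\<gamma> t0 \<in> Z j k'"
            unfolding Z_def using est k' by auto
          then have "\<gamma> t0 \<in> ZZ j" by (auto simp: ZZ_def)
          then show False using t0 by (simp add: P_def)
        qed
      qed
      then show "{t \<in> D. \<gamma> t \<in> Z (Suc j) k - ZZ j} \<in> null_sets lborel" unfolding P_def .
    qed
    have "N j = (\<Union>k. Z (Suc j) k - ZZ j)" by (auto simp: N_def ZZ_def)
    then show ?thesis using dir_null_UN[OF countableI_type one] by (simp only:)
  qed
  ultimately show ?thesis using \<rho>(1) by blast
qed

section \<open>Covers adapted to a frame\<close>

text \<open>A nonzero linear map is unbounded and so does not belong to the space. Preceded by the
  nearest point projection to a ball, which is 1-Lipschitz, \<open>J\<close> becomes bounded and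
  stays unchanged on that ball.\<close>

lemma low_dimensional_approximation:
  fixes \<mu> :: "'a::euclidean_space measure" and J :: "'a \<Rightarrow> 'b::euclidean_space"
  assumes dense: "\<And>f0 \<epsilon>. f0 \<in> (Lip1 :: ('a \<Rightarrow>\<^sub>C 'b) set) \<Longrightarrow> 0 < \<epsilon> \<Longrightarrow>
      \<exists>f\<in>Lip1. dist f f0 < \<epsilon> \<and> Hausdorff_dim (distr \<mu> borel (apply_bcontfun f)) < of_nat d"
    and J: "linear J" "\<And>x. norm (J x) \<le> norm x" and \<epsilon>: "0 < \<epsilon>" and R: "0 \<le> R"
  shows "\<exists>f s0 N. 1-lipschitz_on UNIV f \<and> (\<forall>x. norm x \<le> R \<longrightarrow> norm (f x - J x) \<le> \<epsilon>) \<and>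
    0 \<le> s0 \<and> s0 < real d \<and> N \<in> null_sets (distr \<mu> borel f) \<and> Hausdorff_measure s0 (UNIV - N) < \<infinity>"
proof -
  let ?P = "closest_point (cball (0::'a) R)"
  have Pl: "dist (?P x) (?P y) \<le> dist x y" for x y
    using R by (intro closest_point_lipschitz) auto
  have PR: "norm (?P x) \<le> R" for x
    using closest_point_in_set[of "cball 0 R" x] R by auto
  define h where "h x = J (?P x)" for x
  have hl: "dist (h x) (h y) \<le> 1 * dist x y" for x y
  proof -
    have "dist (h x) (h y) = norm (J (?P x - ?P y))" by (simp add: h_def dist_norm linear_diff[OF J(1)])
    also have "\<dots> \<le> dist (?P x) (?P y)" unfolding dist_norm by (rule J(2))
    also have "\<dots> \<le> dist x y" by (rule Pl)
    finally show ?thesis by simp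
  qed
  then have lip: "1-lipschitz_on UNIV h" by (intro lipschitz_onI) auto
  have "h \<in> bcontfun"
  proof (rule bcontfun_normI[of h R])
    show "continuous_on UNIV h" by (rule lipschitz_on_continuous_on[OF lip])
    show "norm (h x) \<le> R" for x unfolding h_def by (rule order_trans[OF J(2) PR])
  qed
  then have ah: "apply_bcontfun (Bcontfun h) = h" by (rule Bcontfun_inverse)
  then have "Bcontfun h \<in> Lip1" using lip by (simp add: Lip1_def)
  then obtain f where f: "f \<in> Lip1" "dist f (Bcontfun h) < \<epsilon>" "Hausdorff_dim (distr \<mu> borel (apply_bcontfun f)) < of_nat d"
    using dense \<epsilon> by blast
  have near: "norm (apply_bcontfun f x - J x) \<le> \<epsilon>" if "norm x \<le> R" for x
  proof -
    have "?P x = x" using that by (intro closest_point_self) simp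
    then have "h x = J x" by (simp add: h_def)
    moreover have "dist (apply_bcontfun f x) (apply_bcontfun (Bcontfun h) x) \<le> dist f (Bcontfun h)" by (rule dist_bounded)
    ultimately show ?thesis using f(2) unfolding ah by (simp add: dist_norm)
  qed
  obtain y where y: "y \<in> {ennreal s | s. 0 \<le> s \<and> (\<exists>N\<in>null_sets (distr \<mu> borel (apply_bcontfun f)). Hausdorff_measure s (UNIV - N) < \<infinity>)}"
    "y < of_nat d"
    using f(3) unfolding Hausdorff_dim_def Inf_less_iff by blast
  then obtain s N where s: "y = ennreal s" "0 \<le> s" "N \<in> null_sets (distr \<mu> borel (apply_bcontfun f))" "Hausdorff_measure s (UNIV - N) < \<infinity>"
    by blast
  have "s < real d" using y(2) s(1,2) by (simp add: ennreal_of_nat_eq_real_of_nat ennreal_less_iff)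
  moreover have "1-lipschitz_on UNIV (apply_bcontfun f)" using f(1) by (simp add: Lip1_def)
  ultimately show ?thesis using s near by blast
qed

text \<open>A set \<open>A j\<close> of large index occupies at most the share \<open>c / 2\<close>
  of an interval of time, up to an error that vanishes as \<open>j\<close> grows, and so does any
  weighted average of such sets. On \<open>T\<close> the averages are at least \<open>c\<close>, so
  \<open>T\<close> is met during at most half of every small interval, and
  \<open>thin_imp_null\<close> applies.\<close>

lemma density_of_weak_limit_null:
  fixes T :: "'a::euclidean_space set" and A :: "nat \<Rightarrow> 'a set" and w :: "nat \<Rightarrow> nat \<Rightarrow> real"
  assumes T: "T \<in> sets borel" and A: "\<And>j. A j \<in> sets borel" and \<rho>: "0 \<le> \<rho>" and c: "0 < c" and K: "0 \<le> K"
    and w: "\<And>n. tail_weights n (m n) (w n)"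
    and TA: "\<And>n x. N0 \<le> n \<Longrightarrow> x \<in> T \<Longrightarrow> c \<le> (\<Sum>j<m n. w n j * indicator (A j) x)"
    and bound: "\<And>D \<gamma> a b R j. dir_frag (\<lambda>x. x) v \<rho> D \<gamma> \<Longrightarrow> D \<subseteq> {a..b} \<Longrightarrow> a \<le> b \<Longrightarrow> (\<And>t. t \<in> D \<Longrightarrow> norm (\<gamma> t) \<le> R) \<Longrightarrow> R \<le> real j \<Longrightarrow>
      emeasure lborel {t \<in> D. \<gamma> t \<in> A j} \<le> ennreal (c / 2 * (b - a) + K * (1 / real (Suc j)))"
  shows "dir_null (\<lambda>x. x) v \<rho> T"
  unfolding dir_null_def
proof (intro conjI allI impI)
  fix D \<gamma> assume fr: "dir_frag (\<lambda>x. x) v \<rho> D \<gamma>"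
  have Dc: "compact D" "continuous_on D \<gamma>" using fr by (auto simp: dir_frag_def)
  define P where "P = {t \<in> D. \<gamma> t \<in> T}"
  have Pb: "P \<in> sets borel" unfolding P_def by (rule continuous_on_preimage_borel[OF Dc T])
  have "emeasure lborel P \<le> emeasure lborel D" using borel_compact[OF Dc(1)] by (intro emeasure_mono) (auto simp: P_def)
  then have Pf: "emeasure lborel P < \<infinity>" using emeasure_compact_finite[OF Dc(1)] by (rule le_less_trans)
  have "bounded (\<gamma> ` D)" by (rule compact_imp_bounded[OF compact_continuous_image[OF Dc(2,1)]])
  then obtain R where R: "\<And>t. t \<in> D \<Longrightarrow> norm (\<gamma> t) \<le> R" unfolding bounded_iff by auto
  obtain n0 :: nat where n0: "R \<le> real n0" using real_arch_simple by blast
  have "P \<in> null_sets lborel"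
  proof (rule thin_imp_null[OF Pb Pf, of "1/2"])
    fix t e :: real assume t: "t \<in> P" and e: "0 < e"
    define r where "r = e / 2"
    have r: "0 < r" "r < e" using e by (auto simp: r_def)
    let ?I = "cball t r"
    define D' where "D' = D \<inter> ?I"
    have D': "compact D'" unfolding D'_def by (rule compact_Int_closed[OF Dc(1)]) simp
    have fr': "dir_frag (\<lambda>x. x) v \<rho> D' \<gamma>" using dir_frag_subset[OF fr _ D'] by (simp add: D'_def)
    have D'sub: "D' \<subseteq> {t - r..t + r}" by (auto simp: D'_def cball_eq_atLeastAtMost)
    define Q where "Q j = {s \<in> D'. \<gamma> s \<in> A j}" for j
    have Qb: "Q j \<in> sets borel" for j
      unfolding Q_def using fr' A by (intro continuous_on_preimage_borel[OF D']) (auto simp: dir_frag_def)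
    have PIb: "P \<inter> ?I \<in> sets borel" using Pb by simp
    have est: "ennreal c * emeasure lborel (P \<inter> ?I) \<le> ennreal (c * r + K * (1 / real (Suc n)))" if n: "max N0 n0 \<le> n" for n
    proof -
      define b where "b = c * r + K * (1 / real (Suc n))"
      have b0: "0 \<le> b" using c r K by (simp add: b_def)
      have w0: "0 \<le> w n j" for j using w[of n] by (simp add: tail_weights_def)
      have "ennreal c * emeasure lborel (P \<inter> ?I) = (\<integral>\<^sup>+ s. ennreal c * indicator (P \<inter> ?I) s \<partial>lborel)"
        by (rule nn_integral_cmult_indicator[symmetric]) (simp only: sets_lborel PIb)
      also have "\<dots> \<le> (\<integral>\<^sup>+ s. (\<Sum>j<m n. ennreal (w n j) * indicator (Q j) s) \<partial>lborel)"
      proof (rule nn_integral_mono)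
        fix s :: real
        show "ennreal c * indicator (P \<inter> ?I) s \<le> (\<Sum>j<m n. ennreal (w n j) * indicator (Q j) s)"
        proof (cases "s \<in> P \<inter> ?I")
          case True
          then have "c \<le> (\<Sum>j<m n. w n j * indicator (A j) (\<gamma> s))" using TA[of n "\<gamma> s"] n by (simp add: P_def)
          then have "ennreal c \<le> ennreal (\<Sum>j<m n. w n j * indicator (A j) (\<gamma> s))" by (rule ennreal_leI)
          also have "\<dots> = (\<Sum>j<m n. ennreal (w n j * indicator (A j) (\<gamma> s)))"
            using w0 by (intro sum_ennreal[symmetric]) auto
          also have "\<dots> = (\<Sum>j<m n. ennreal (w n j) * indicator (Q j) s)"
            using True by (intro sum.cong refl) (auto simp: indicator_def Q_def D'_def P_def)
          finally show ?thesis using True by simp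
        qed simp
      qed
      also have "\<dots> = (\<Sum>j<m n. \<integral>\<^sup>+ s. ennreal (w n j) * indicator (Q j) s \<partial>lborel)"
        by (rule nn_integral_sum) (intro borel_measurable_times_ennreal borel_measurable_const borel_measurable_indicator, simp only: sets_lborel Qb)
      also have "\<dots> = (\<Sum>j<m n. ennreal (w n j) * emeasure lborel (Q j))"
        by (intro sum.cong refl nn_integral_cmult_indicator) (simp only: sets_lborel Qb)
      also have "\<dots> \<le> (\<Sum>j<m n. ennreal (w n j) * ennreal b)"
      proof (rule sum_mono)
        fix j
        show "ennreal (w n j) * emeasure lborel (Q j) \<le> ennreal (w n j) * ennreal b"
        proof (cases "j < n")
          case True
          then show ?thesis using w[of n] by (simp add: tail_weights_def)
        next
          case False
          have "emeasure lborel (Q j) \<le> ennreal (c / 2 * (t + r - (t - r)) + K * (1 / real (Suc j)))"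
            unfolding Q_def using fr' D'sub
          proof (rule bound[where R = R])
            show "norm (\<gamma> s) \<le> R" if "s \<in> D'" for s using R that by (simp add: D'_def)
            show "R \<le> real j" using n0 n False by linarith
          qed (use r in simp)
          also have "\<dots> \<le> ennreal b"
          proof (rule ennreal_leI)
            have "1 / real (Suc j) \<le> 1 / real (Suc n)" using False by (intro divide_left_mono) auto
            then have "K * (1 / real (Suc j)) \<le> K * (1 / real (Suc n))" using K by (rule mult_left_mono)
            then show "c / 2 * (t + r - (t - r)) + K * (1 / real (Suc j)) \<le> b" by (simp add: b_def)
          qed
          finally show ?thesis by (rule mult_left_mono) simp
        qed
      qed
      also have "\<dots> = ennreal ((\<Sum>j<m n. w n j) * b)"
        using w0 b0 by (simp add: ennreal_mult[symmetric] sum_distrib_right sum_ennreal)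
      also have "(\<Sum>j<m n. w n j) * b = b" using w[of n] by (simp add: tail_weights_def)
      finally show ?thesis unfolding b_def .
    qed
    have fin: "emeasure lborel (P \<inter> ?I) < \<infinity>"
      using Pf emeasure_mono[of "P \<inter> ?I" P lborel] Pb by (auto intro: le_less_trans)
    define y where "y = measure lborel (P \<inter> ?I)"
    have y: "emeasure lborel (P \<inter> ?I) = ennreal y" using fin by (simp add: y_def emeasure_eq_ennreal_measure top.not_eq_extremum)
    have y0: "0 \<le> y" by (simp add: y_def)
    have "c * y \<le> c * r + K * (1 / real (Suc n))" if "max N0 n0 \<le> n" for n
    proof -
      have "ennreal (c * y) \<le> ennreal (c * r + K * (1 / real (Suc n)))"
        using est[OF that] c y0 unfolding y by (simp only: ennreal_mult[OF less_imp_le[OF c] y0])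
      then show ?thesis using c r K by (subst (asm) ennreal_le_iff) auto
    qed
    moreover have "(\<lambda>n. c * r + K * (1 / real (Suc n))) \<longlonglongrightarrow> c * r + K * 0"
      by (intro tendsto_intros LIMSEQ_Suc lim_1_over_n)
    ultimately have "c * y \<le> c * r + K * 0" by (intro LIMSEQ_le_const) blast+
    then have "y \<le> r" using c by simp
    then have "emeasure lborel (P \<inter> ?I) \<le> ennreal ((1 - 1/2) * (2 * r))" unfolding y by (intro ennreal_leI) simp
    moreover have "t \<in> ?I" using r by simp
    ultimately show "\<exists>c r. 0 < r \<and> r < e \<and> t \<in> cball c r \<and> emeasure lborel (P \<inter> cball c r) \<le> ennreal ((1 - 1/2) * (2 * r))"
      using r by blast
  qed simp
  then show "{t \<in> D. \<gamma> t \<in> T} \<in> null_sets lborel" unfolding P_def .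
qed (rule T)

lemma frame_null_cover:
  fixes \<mu> :: "'a::euclidean_space measure" and v :: "nat \<Rightarrow> 'a"
  assumes fin: "finite_measure \<mu>" and s\<mu>: "sets \<mu> = sets borel" and d: "1 \<le> d" "d \<le> DIM('b)"
    and dense: "\<And>f0 \<epsilon>. f0 \<in> (Lip1 :: ('a \<Rightarrow>\<^sub>C 'b::euclidean_space) set) \<Longrightarrow> 0 < \<epsilon> \<Longrightarrow>
      \<exists>f\<in>Lip1. dist f f0 < \<epsilon> \<and> Hausdorff_dim (distr \<mu> borel (apply_bcontfun f)) < of_nat d"
    and ind: "\<And>a. (\<Sum>i<d. a i *\<^sub>R v i) = 0 \<Longrightarrow> \<forall>i<d. a i = 0"
  shows "\<exists>\<rho>>0. \<exists>A. (\<forall>i<d. dir_null (\<lambda>x. x) (v i) \<rho> (A i)) \<and> emeasure \<mu> (UNIV - (\<Union>i<d. A i)) = 0"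
proof -
  have sp: "space \<mu> = UNIV" using sets_eq_imp_space_eq[OF s\<mu>] by simp
  obtain \<beta> where \<beta>: "0 < \<beta>" "\<And>a. \<beta> * (\<Sum>i<d. \<bar>a i\<bar>) \<le> norm (\<Sum>i<d. a i *\<^sub>R v i)"
    using independence_constant[OF ind] by blast
  obtain J :: "'a \<Rightarrow> 'b" where J: "linear J" "\<And>x. norm (J x) \<le> norm x"
    "\<And>x y. y \<in> span (v ` {..<d}) \<Longrightarrow> inner (J x) (J y) = inner x y"
    by (rule isometric_on_span[OF d(2), of v]) blast
  have Jv: "inner (J x) (J (v i)) = inner x (v i)" if "i < d" for x i
    by (rule J(3)) (use that in \<open>auto intro: span_base\<close>)
  have inde: "\<beta> * (\<Sum>i<d. \<bar>a i\<bar>) \<le> norm (\<Sum>i<d. a i *\<^sub>R J (v i))" for a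
  proof -
    let ?x = "\<Sum>i<d. a i *\<^sub>R v i"
    have "?x \<in> span (v ` {..<d})" by (intro span_sum span_scale span_base) auto
    then have "norm (J ?x) = norm ?x" using J(3)[of ?x ?x] by (simp add: norm_eq_sqrt_inner)
    moreover have "J ?x = (\<Sum>i<d. a i *\<^sub>R J (v i))" by (simp add: linear_sum[OF J(1)] linear_cmul[OF J(1)])
    ultimately show ?thesis using \<beta>(2)[of a] by simp
  qed
  define V where "V = 1 + (\<Sum>i<d. norm (v i))"
  have V: "0 < V" "norm (v i) \<le> V" if "i < d" for i
  proof -
    show "0 < V" unfolding V_def by (intro add_pos_nonneg sum_nonneg) auto
    have "norm (v i) \<le> (\<Sum>i<d. norm (v i))" using that by (intro member_le_sum) auto
    then show "norm (v i) \<le> V" by (simp add: V_def)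
  qed
  have V0: "0 < V" by (rule V(1)[of 0]) (use d in simp)
  \<comment> \<open>\<open>perturbed_fragment_bound\<close> requires a \<open>\<sigma>\<close>
    strictly below the radius \<open>\<beta> / 2\<close> supplied by
    \<open>cone_null_cover\<close>.\<close>
  define \<sigma> where "\<sigma> = \<beta> / 4"
  have \<sigma>: "0 < \<sigma>" "\<sigma> < \<beta> / 2" using \<beta> by (auto simp: \<sigma>_def)
  \<comment> \<open>The first bound gives \<open>3 * \<sigma>\<^sup>2 / 8 \<le> q\<close>; the
    second one turns this into \<open>2 * \<rho> * V / q \<le> c / 2\<close>.\<close>
  define \<rho> where "\<rho> = min (\<sigma> / 2) (3 * \<sigma>\<^sup>2 / (64 * real d * V))"
  have \<rho>: "0 < \<rho>" "\<rho> < \<sigma>" using \<sigma> V0 d by (auto simp: \<rho>_def min_less_iff_disj)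
  define q where "q = (\<sigma>\<^sup>2 - \<rho>\<^sup>2) / 2"
  have q: "3 * \<sigma>\<^sup>2 / 8 \<le> q" "0 < q"
  proof -
    have "\<rho>\<^sup>2 \<le> (\<sigma> / 2)\<^sup>2" using \<rho> by (intro power_mono) (auto simp: \<rho>_def)
    also have "\<dots> = \<sigma>\<^sup>2 / 4" by (simp add: power_divide)
    finally show "3 * \<sigma>\<^sup>2 / 8 \<le> q" by (simp add: q_def)
    moreover have "0 < \<sigma>\<^sup>2" using \<sigma> by simp
    ultimately show "0 < q" by linarith
  qed
  \<comment> \<open>Half of the pigeonhole value \<open>1 / d\<close>: the \<open>d\<close> averages
    at a point add up to at least 1, and the other half absorbs the oscillation of the Cauchy
    sequence.\<close>
  define c where "c = 1 / (2 * real d)"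
  have c: "0 < c" using d by (simp add: c_def)
  have key: "2 * \<rho> * V / q \<le> c / 2"
  proof -
    have "2 * \<rho> * V \<le> 2 * (3 * \<sigma>\<^sup>2 / (64 * real d * V)) * V"
      using V0 by (intro mult_right_mono mult_left_mono) (auto simp: \<rho>_def)
    also have "\<dots> = c / 2 * (3 * \<sigma>\<^sup>2 / 8)" using V0 d by (simp add: c_def)
    also have "\<dots> \<le> c / 2 * q" using q c by (intro mult_left_mono) auto
    finally show ?thesis using q by (simp add: pos_divide_le_eq)
  qed
  define PP where "PP n f s0 N \<longleftrightarrow> 1-lipschitz_on UNIV f \<and> (\<forall>x. norm x \<le> real n \<longrightarrow> norm (f x - J x) \<le> 1 / real (Suc n)) \<and>
    0 \<le> s0 \<and> s0 < real d \<and> N \<in> null_sets (distr \<mu> borel f) \<and> Hausdorff_measure s0 (UNIV - N) < \<infinity>" for n f s0 N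
  have "\<exists>f s0 N. PP n f s0 N" for n
    unfolding PP_def by (rule low_dimensional_approximation[OF dense J(1,2)]) auto
  then obtain f s0 N where PP: "\<And>n. PP n (f n) (s0 n) (N n)" by metis
  have f: "\<And>n. 1-lipschitz_on UNIV (f n)" "\<And>n x. norm x \<le> real n \<Longrightarrow> norm (f n x - J x) \<le> 1 / real (Suc n)"
    and s0: "\<And>n. 0 \<le> s0 n" "\<And>n. s0 n < real d"
    and N: "\<And>n. N n \<in> null_sets (distr \<mu> borel (f n))" "\<And>n. Hausdorff_measure (s0 n) (UNIV - N n) < \<infinity>"
    using PP unfolding PP_def by blast+
  have "\<exists>G. (\<forall>j<d. dir_null (\<lambda>x. x) (J (v j)) (\<beta> / 2) (G j)) \<and> UNIV - N n \<subseteq> (\<Union>j<d. G j)" for n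
    by (rule cone_null_cover[OF d(1) s0 N(2) \<beta>(1) inde])
  then obtain G where G: "\<And>n j. j < d \<Longrightarrow> dir_null (\<lambda>x. x) (J (v j)) (\<beta> / 2) (G n j)" "\<And>n. UNIV - N n \<subseteq> (\<Union>j<d. G n j)"
    by metis
  define A where "A n i = f n -` G n i" for n i
  have fm: "f n \<in> borel_measurable borel" for n
    by (rule borel_measurable_continuous_onI[OF lipschitz_on_continuous_on[OF f(1)]])
  have Ab: "A n i \<in> sets borel" if "i < d" for n i
    using measurable_sets[OF fm, of "G n i" n] G(1)[OF that, of n] unfolding A_def dir_null_def by simp
  obtain \<kappa> where \<kappa>: "\<kappa> ` {..<d} \<subseteq> (Basis :: 'b set)" "inj_on \<kappa> {..<d}"
    using card_le_inj[of "{..<d}" "Basis :: 'b set"] d by auto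
  \<comment> \<open>The \<open>d\<close> indicators are packed into one vector-valued function, so
    that the same convex weights serve all of them.\<close>
  define g where "g n x = (\<Sum>i<d. indicator (A n i) x *\<^sub>R \<kappa> i)" for n x
  have gm: "g n \<in> borel_measurable \<mu>" for n
  proof -
    have "g n \<in> borel_measurable borel"
      unfolding g_def using Ab by (intro borel_measurable_sum borel_measurable_scaleR borel_measurable_indicator borel_measurable_const) auto
    then show ?thesis by (simp only: measurable_cong_sets[OF s\<mu> refl])
  qed
  have gb: "norm (g n x) \<le> real d" for n x
  proof -
    have "norm (g n x) \<le> (\<Sum>i<d. 1)"
      unfolding g_def using \<kappa>(1) by (intro sum_norm_le) (auto simp: indicator_def)
    then show ?thesis by simp
  qed
  obtain m w where w: "\<And>n. tail_weights n (m n) (w n)"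
    and conv: "AE x in \<mu>. Cauchy (\<lambda>n. \<Sum>j<m n. w n j *\<^sub>R g j x)"
    using tail_combination_AE_Cauchy[where g = g, OF fin gm gb] by blast
  define \<xi> where "\<xi> n i x = (\<Sum>j<m n. w n j * indicator (A j i) x)" for n i and x :: 'a
  have gi: "inner (\<Sum>j<m n. w n j *\<^sub>R g j x) (\<kappa> i) = \<xi> n i x" if i: "i < d" for n i x
  proof -
    have "inner (g j x) (\<kappa> i) = indicator (A j i) x" for j
    proof -
      have "inner (g j x) (\<kappa> i) = (\<Sum>l<d. indicator (A j l) x * inner (\<kappa> l) (\<kappa> i))" by (simp add: g_def inner_sum_left)
      also have "\<dots> = (\<Sum>l<d. if l = i then indicator (A j l) x else 0)"
      proof (rule sum.cong[OF refl])
        fix l assume l: "l \<in> {..<d}"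
        have "inner (\<kappa> l) (\<kappa> i) = (if \<kappa> l = \<kappa> i then 1 else 0)" using \<kappa>(1) l i by (intro inner_Basis) auto
        then show "indicator (A j l) x * inner (\<kappa> l) (\<kappa> i) = (if l = i then indicator (A j l) x else 0)"
          using inj_on_eq_iff[OF \<kappa>(2) l, of i] i by simp
      qed
      also have "\<dots> = indicator (A j i) x" using i by simp
      finally show ?thesis .
    qed
    then show ?thesis by (simp add: inner_sum_left \<xi>_def)
  qed
  define T where "T i N0 = {x. \<forall>n\<in>{N0..}. c \<le> \<xi> n i x}" for i N0
  have Tb: "T i N0 \<in> sets borel" if i: "i < d" for i N0
  proof -
    have "\<xi> n i \<in> borel_measurable borel" for n
      unfolding \<xi>_def using Ab[OF i] by (intro borel_measurable_sum borel_measurable_times borel_measurable_indicator borel_measurable_const)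
    then have "\<xi> n i -` {c..} \<inter> space borel \<in> sets borel" for n by (rule measurable_sets) simp
    then have X: "{x. c \<le> \<xi> n i x} \<in> sets borel" for n by (simp add: vimage_def)
    have "(\<Inter>n\<in>{N0..}. {x. c \<le> \<xi> n i x}) \<in> sets borel"
    proof (rule sets.countable_INT')
      show "(\<lambda>n. {x. c \<le> \<xi> n i x}) ` {N0..} \<subseteq> sets borel" by (rule image_subsetI) (rule X)
    qed auto
    moreover have "(\<Inter>n\<in>{N0..}. {x. c \<le> \<xi> n i x}) = T i N0" by (auto simp: T_def)
    ultimately show ?thesis by (simp only:)
  qed
  define As where "As i = (\<Union>N0. T i N0)" for i
  have "dir_null (\<lambda>x. x) (v i) \<rho> (T i N0)" if i: "i < d" for i N0
  proof (rule density_of_weak_limit_null[where A = "\<lambda>j. A j i" and c = c and K = "2 * V / q" and m = m and w = w and ?N0.0 = N0, OF Tb[OF i] Ab[OF i]])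
    show "c \<le> (\<Sum>j<m n. w n j * indicator (A j i) x)" if "N0 \<le> n" "x \<in> T i N0" for n x
      using that by (simp add: T_def \<xi>_def)
    fix D \<gamma> a b R j
    assume fr: "dir_frag (\<lambda>x. x) (v i) \<rho> D \<gamma>" and D: "D \<subseteq> {a..b}" "a \<le> b" and R: "\<And>t. t \<in> D \<Longrightarrow> norm (\<gamma> t) \<le> R" "R \<le> real j"
    have "emeasure lborel {t \<in> D. f j (\<gamma> t) \<in> G j i}
      \<le> ennreal ((2 * \<rho> * norm (v i) * (b - a) + 2 * (1 / real (Suc j)) * norm (v i)) / ((\<sigma>\<^sup>2 - \<rho>\<^sup>2) / 2))"
    proof (rule perturbed_fragment_bound[OF f(1) fr _ \<rho>(2) \<sigma>(2) D J(1) Jv[OF i] _ _ G(1)[OF i]])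
      show "norm (f j (\<gamma> t) - J (\<gamma> t)) \<le> 1 / real (Suc j)" if "t \<in> D" for t
        by (rule f(2)) (use R that in force)
    qed (use \<rho> in auto)
    also have "\<dots> \<le> ennreal (c / 2 * (b - a) + 2 * V / q * (1 / real (Suc j)))"
    proof (rule ennreal_leI)
      have "(2 * \<rho> * norm (v i) * (b - a) + 2 * (1 / real (Suc j)) * norm (v i)) / q
        \<le> (2 * \<rho> * V * (b - a) + 2 * (1 / real (Suc j)) * V) / q"
        using V(2)[OF i] \<rho> D q by (intro divide_right_mono add_mono mult_right_mono mult_left_mono) auto
      also have "\<dots> = 2 * \<rho> * V / q * (b - a) + 2 * V / q * (1 / real (Suc j))"
        by (simp add: add_divide_distrib del: of_nat_Suc)
      also have "\<dots> \<le> c / 2 * (b - a) + 2 * V / q * (1 / real (Suc j))"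
        using key D by (intro add_right_mono mult_right_mono) auto
      finally show "(2 * \<rho> * norm (v i) * (b - a) + 2 * (1 / real (Suc j)) * norm (v i)) / ((\<sigma>\<^sup>2 - \<rho>\<^sup>2) / 2)
        \<le> c / 2 * (b - a) + 2 * V / q * (1 / real (Suc j))" unfolding q_def .
    qed
    finally show "emeasure lborel {t \<in> D. \<gamma> t \<in> A j i} \<le> ennreal (c / 2 * (b - a) + 2 * V / q * (1 / real (Suc j)))"
      by (simp only: A_def vimage_eq)
  qed (use \<rho> c V0 q w in auto)
  then have dn: "dir_null (\<lambda>x. x) (v i) \<rho> (As i)" if "i < d" for i
    unfolding As_def using that by (intro dir_null_UN) auto
  have Asb: "As i \<in> sets borel" if "i < d" for i using dn[OF that] by (simp add: dir_null_def)
  have "AE x in \<mu>. f n x \<notin> N n" for n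
  proof -
    have fm': "f n \<in> measurable \<mu> borel" using fm by (simp only: measurable_cong_sets[OF s\<mu> refl])
    have "emeasure \<mu> (f n -` N n \<inter> space \<mu>) = 0"
      using N(1)[of n] emeasure_distr[OF fm', of "N n"] by (auto simp: null_sets_def)
    moreover have "f n -` N n \<inter> space \<mu> \<in> sets \<mu>" using measurable_sets[OF fm', of "N n"] N(1)[of n] by (auto simp: null_sets_def)
    ultimately have "f n -` N n \<inter> space \<mu> \<in> null_sets \<mu>" by (simp add: null_sets_def)
    then show ?thesis by (rule AE_I') auto
  qed
  then have "AE x in \<mu>. \<forall>n. f n x \<notin> N n" by (simp add: AE_all_countable)
  then have ae: "AE x in \<mu>. x \<in> (\<Union>i<d. As i)"
    using conv
  proof eventually_elim
    case (elim x)
    obtain N0 where N0: "\<And>n n'. N0 \<le> n \<Longrightarrow> N0 \<le> n' \<Longrightarrow> norm ((\<Sum>j<m n. w n j *\<^sub>R g j x) - (\<Sum>j<m n'. w n' j *\<^sub>R g j x)) < c"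
      using CauchyD[OF elim(2) c] by blast
    have "1 \<le> (\<Sum>i<d. \<xi> N0 i x)"
    proof -
      have "1 = (\<Sum>j<m N0. w N0 j * 1)" using w[of N0] by (simp add: tail_weights_def)
      also have "\<dots> \<le> (\<Sum>j<m N0. w N0 j * (\<Sum>i<d. indicator (A j i) x))"
      proof (intro sum_mono mult_left_mono)
        fix j
        have "f j x \<in> UNIV - N j" using elim(1) by blast
        then obtain i where i: "i < d" "x \<in> A j i" using G(2)[of j] unfolding A_def by blast
        have "indicator (A j i) x \<le> (\<Sum>i<d. indicator (A j i) x :: real)" using i by (intro member_le_sum) auto
        then show "1 \<le> (\<Sum>i<d. indicator (A j i) x :: real)" using i by simp
        show "0 \<le> w N0 j" using w[of N0] by (simp add: tail_weights_def)
      qed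
      also have "\<dots> = (\<Sum>i<d. \<xi> N0 i x)"
        unfolding \<xi>_def sum_distrib_left by (rule sum.swap)
      finally show ?thesis .
    qed
    have "\<exists>i<d. 1 / real d \<le> \<xi> N0 i x"
    proof (rule ccontr)
      assume "\<not> ?thesis"
      then have "(\<Sum>i<d. \<xi> N0 i x) < (\<Sum>i<d. 1 / real d)" using d by (intro sum_strict_mono) (auto simp: not_le lessThan_empty_iff)
      then show False using \<open>1 \<le> (\<Sum>i<d. \<xi> N0 i x)\<close> d by simp
    qed
    then obtain i where i: "i < d" "1 / real d \<le> \<xi> N0 i x" by blast
    have "c \<le> \<xi> n i x" if n: "N0 \<le> n" for n
    proof -
      have "\<bar>\<xi> n i x - \<xi> N0 i x\<bar> = \<bar>inner ((\<Sum>j<m n. w n j *\<^sub>R g j x) - (\<Sum>j<m N0. w N0 j *\<^sub>R g j x)) (\<kappa> i)\<bar>"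
        by (simp add: inner_diff_left gi[OF i(1)])
      also have "\<dots> \<le> norm ((\<Sum>j<m n. w n j *\<^sub>R g j x) - (\<Sum>j<m N0. w N0 j *\<^sub>R g j x))"
        by (rule Basis_le_norm) (use \<kappa>(1) i in auto)
      also have "\<dots> < c" by (rule N0[OF n order_refl])
      finally have "\<xi> N0 i x - c \<le> \<xi> n i x" by linarith
      moreover have "1 / real d = 2 * c" by (simp add: c_def)
      ultimately show ?thesis using i(2) by linarith
    qed
    then have "x \<in> T i N0" by (simp add: T_def)
    then show ?case using i(1) by (auto simp: As_def)
  qed
  have c1: "UNIV - (\<Union>i<d. As i) \<in> sets \<mu>" unfolding s\<mu> using Asb by (intro sets.compl_sets[of _ borel, simplified space_borel] sets.finite_UN) auto
  have c2: "{x \<in> space \<mu>. \<not> x \<in> (\<Union>i<d. As i)} = UNIV - (\<Union>i<d. As i)" by (auto simp: sp)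
  have "emeasure \<mu> (UNIV - (\<Union>i<d. As i)) = 0" using ae by (rule AE_iff_measurable[OF c1 c2, THEN iffD1])
  with dn \<rho>(1) show ?thesis by (intro exI[of _ \<rho>] exI[of _ As] conjI allI impI)
qed

section \<open>The Grassmannian and measurable selection\<close>

lemma orthonormal_family_exists:
  fixes B :: "'a::real_inner set"
  assumes "finite B"
  shows "\<exists>C. finite C \<and> (\<forall>x\<in>C. norm x = 1) \<and> (\<forall>x\<in>C. \<forall>y\<in>C. x \<noteq> y \<longrightarrow> inner x y = 0) \<and> span C = span B"
  using assms
proof (induction B rule: finite_induct)
  case empty
  then show ?case by (intro exI[of _ "{}"]) auto
next
  case (insert a B)
  then obtain C where C: "finite C" "\<forall>x\<in>C. norm x = 1" "\<forall>x\<in>C. \<forall>y\<in>C. x \<noteq> y \<longrightarrow> inner x y = 0" "span C = span B"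
    by blast
  obtain p where p: "p \<in> span C" "\<And>b. b \<in> span C \<Longrightarrow> inner (a - p) b = 0"
    using orthogonal_projection_exists[OF C(1), of a] by blast
  define e where "e = a - p"
  have pB: "p \<in> span B" using p(1) C(4) by simp
  show ?case
  proof (cases "e = 0")
    case True
    then have "a \<in> span B" using pB by (simp add: e_def)
    then have "span (insert a B) = span B" by (rule span_redundant)
    then show ?thesis using C by (intro exI[of _ C]) simp
  next
    case False
    define u where "u = e /\<^sub>R norm e"
    have u1: "norm u = 1" using False by (simp add: u_def)
    have uC: "inner u x = 0" if "x \<in> C" for x
      using p(2)[OF span_base[OF that]] by (simp add: u_def e_def)
    have "span (insert u C) = span (insert a B)"
    proof (rule span_eq[THEN iffD2], rule conjI)
      have "a \<in> span (insert a B)" "p \<in> span (insert a B)" using pB span_mono[of B "insert a B"] by (auto intro: span_base)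
      then have "u \<in> span (insert a B)" unfolding u_def e_def by (intro span_scale span_diff)
      moreover have "C \<subseteq> span (insert a B)"
        using C(4) span_superset[of C] span_mono[of B "insert a B"] by blast
      ultimately show "insert u C \<subseteq> span (insert a B)" by blast
      have "u \<in> span (insert u C)" "p \<in> span (insert u C)" using p(1) span_mono[of C "insert u C"] by (auto intro: span_base)
      then have "norm e *\<^sub>R u + p \<in> span (insert u C)" by (intro span_add span_scale)
      then have "a \<in> span (insert u C)" using False by (simp add: u_def e_def)
      moreover have "B \<subseteq> span (insert u C)"
        using C(4) span_superset[of B] span_mono[of C "insert u C"] by blast
      ultimately show "insert a B \<subseteq> span (insert u C)" by blast
    qed
    then show ?thesis using C u1 uC by (intro exI[of _ "insert u C"]) (auto simp: inner_commute)
  qed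
qed

lemma bounded_family_convergent_subsequence:
  fixes a :: "nat \<Rightarrow> 'k \<Rightarrow> real"
  assumes "finite A" "\<And>k. k \<in> A \<Longrightarrow> \<exists>C. \<forall>l. \<bar>a l k\<bar> \<le> C"
  shows "\<exists>r. strict_mono r \<and> (\<forall>k\<in>A. convergent (\<lambda>l. a (r l) k))"
  using assms
proof (induction A rule: finite_induct)
  case empty
  then show ?case by (intro exI[of _ id]) (auto simp: strict_mono_def)
next
  case (insert k A)
  then obtain r where r: "strict_mono r" "\<forall>k\<in>A. convergent (\<lambda>l. a (r l) k)" by blast
  obtain C where C: "\<forall>l. \<bar>a l k\<bar> \<le> C" using insert.prems by blast
  have "compact {-C..C}" by simp
  then obtain l r' where r': "l \<in> {-C..C}" "strict_mono r'" "((\<lambda>l. a (r l) k) \<circ> r') \<longlonglongrightarrow> l"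
    using C unfolding compact_def by (metis (no_types, lifting) abs_le_iff atLeastAtMost_iff minus_le_iff)
  have "convergent (\<lambda>l. a ((r \<circ> r') l) k')" if k': "k' \<in> insert k A" for k'
  proof (cases "k' = k")
    case True
    then show ?thesis using r'(3) by (auto simp: convergent_def comp_def)
  next
    case False
    then have "convergent (\<lambda>l. a (r l) k')" using r(2) k' by blast
    from convergent_subseq_convergent[OF this r'(2)] show ?thesis by (simp add: comp_def)
  qed
  then show ?case using strict_mono_o[OF r(1) r'(2)] by blast
qed

lemma Rn_representation: "x \<in> Rn n \<Longrightarrow> x = (\<Sum>j<n. coord x j *\<^sub>R unit_rseq j)"
  by (rule rseq_eqI) (simp add: coord_sum Rn_def if_distrib sum.delta' cong: if_cong)

lemma norm_unit_rseq [simp]: "norm (unit_rseq j) = 1"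
  by (simp add: norm_eq_sqrt_inner inner_rseq_def)

lemma abs_coord_le_norm: "\<bar>coord x i\<bar> \<le> norm x"
proof -
  have "inner x (unit_rseq i) = coord x i"
    by (subst inner_commute) (simp add: inner_rseq_def)
  then show ?thesis using Cauchy_Schwarz_ineq2[of x "unit_rseq i"] by simp
qed

lemma Rn_bounded_convergent_subsequence:
  fixes u :: "nat \<Rightarrow> 'i \<Rightarrow> rseq"
  assumes I: "finite I" and u: "\<And>l i. i \<in> I \<Longrightarrow> u l i \<in> Rn n" "\<And>l i. i \<in> I \<Longrightarrow> norm (u l i) \<le> C"
  shows "\<exists>r v. strict_mono r \<and> (\<forall>i\<in>I. v i \<in> Rn n \<and> (\<lambda>l. u (r l) i) \<longlonglongrightarrow> v i)"
proof -
  have "\<exists>r. strict_mono r \<and> (\<forall>k\<in>I \<times> {..<n}. convergent (\<lambda>l. coord (u (r l) (fst k)) (snd k)))"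
  proof (intro bounded_family_convergent_subsequence[where a = "\<lambda>l k. coord (u l (fst k)) (snd k)"] finite_cartesian_product I finite_lessThan exI allI)
    fix k :: "'i \<times> nat" and l assume "k \<in> I \<times> {..<n}"
    then have "fst k \<in> I" by auto
    then show "\<bar>coord (u l (fst k)) (snd k)\<bar> \<le> C" by (rule order_trans[OF abs_coord_le_norm u(2)])
  qed
  then obtain r where r0: "strict_mono r" "\<forall>k\<in>I \<times> {..<n}. convergent (\<lambda>l. coord (u (r l) (fst k)) (snd k))" by blast
  have r: "strict_mono r" "convergent (\<lambda>l. coord (u (r l) i) j)" if "i \<in> I" "j < n" for i j
    using r0(1) bspec[OF r0(2), of "(i, j)"] that by simp_all
  define v where "v i = (\<Sum>j<n. lim (\<lambda>l. coord (u (r l) i) j) *\<^sub>R unit_rseq j)" for i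
  have "v i \<in> Rn n" for i
    unfolding v_def by (intro subspace_sum[OF subspace_Rn] subspace_scale[OF subspace_Rn]) (auto simp: Rn_def)
  moreover have "(\<lambda>l. u (r l) i) \<longlonglongrightarrow> v i" if i: "i \<in> I" for i
  proof -
    have "(\<lambda>l. \<Sum>j<n. coord (u (r l) i) j *\<^sub>R unit_rseq j) \<longlonglongrightarrow> v i"
      unfolding v_def using r(2)[OF i] by (intro tendsto_sum tendsto_scaleR tendsto_const) (auto simp: convergent_LIMSEQ_iff)
    then show ?thesis using Rn_representation[OF u(1)[OF i]] by (simp flip: )
  qed
  ultimately show ?thesis using r0(1) by blast
qed

definition on_frame :: "nat \<Rightarrow> (nat \<Rightarrow> rseq) \<Rightarrow> bool" where
  "on_frame d u \<longleftrightarrow> (\<forall>i<d. \<forall>j<d. inner (u i) (u j) = (if i = j then 1 else 0))"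

lemma on_frame_coeff:
  assumes "on_frame d u" "i < d"
  shows "inner (\<Sum>j<d. a j *\<^sub>R u j) (u i) = a i"
proof -
  have "inner (\<Sum>j<d. a j *\<^sub>R u j) (u i) = (\<Sum>j<d. a j * inner (u j) (u i))" by (simp add: inner_sum_left)
  also have "\<dots> = (\<Sum>j<d. if j = i then a j else 0)" using assms by (intro sum.cong) (auto simp: on_frame_def)
  finally show ?thesis using assms(2) by simp
qed

lemma on_frame_norm:
  assumes "on_frame d u"
  shows "(norm (\<Sum>j<d. a j *\<^sub>R u j))\<^sup>2 = (\<Sum>j<d. (a j)\<^sup>2)"
proof -
  have "(norm (\<Sum>j<d. a j *\<^sub>R u j))\<^sup>2 = (\<Sum>i<d. a i * inner (\<Sum>j<d. a j *\<^sub>R u j) (u i))"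
  proof -
    have "inner y (\<Sum>j<d. a j *\<^sub>R u j) = (\<Sum>i<d. a i * inner y (u i))" for y by (simp add: inner_sum_right)
    then show ?thesis unfolding power2_norm_eq_inner .
  qed
  also have "\<dots> = (\<Sum>j<d. (a j)\<^sup>2)" by (intro sum.cong refl) (simp add: on_frame_coeff[OF assms] power2_eq_square)
  finally show ?thesis .
qed

lemma on_frame_Grassmannian:
  assumes u: "on_frame d u" "\<And>i. i < d \<Longrightarrow> u i \<in> Rn n"
  shows "span (u ` {..<d}) \<in> Grassmannian d n"
proof -
  have inj: "inj_on u {..<d}"
  proof (rule inj_onI)
    fix i j assume ij: "i \<in> {..<d}" "j \<in> {..<d}" "u i = u j"
    then have "inner (u i) (u j) = 1" using u(1) by (auto simp: on_frame_def)
    then show "i = j" using u(1) ij unfolding on_frame_def by (metis lessThan_iff zero_neq_one)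
  qed
  have "independent (u ` {..<d})"
  proof (rule pairwise_orthogonal_independent)
    show "pairwise orthogonal (u ` {..<d})"
      using u(1) by (auto simp: pairwise_def orthogonal_def on_frame_def)
    show "0 \<notin> u ` {..<d}"
    proof
      assume "0 \<in> u ` {..<d}"
      then obtain i where "i < d" "u i = 0" by auto
      then have "inner (u i) (u i) = (if i = i then 1 else 0)" using u(1) unfolding on_frame_def by blast
      then show False using \<open>u i = 0\<close> by simp
    qed
  qed
  then have "dim (span (u ` {..<d})) = d"
    using card_image[OF inj] by (simp add: dim_eq_card_independent)
  moreover have "span (u ` {..<d}) \<subseteq> Rn n"
    using u(2) by (intro span_minimal subspace_Rn) auto
  ultimately show ?thesis by (simp add: Grassmannian_def)
qed

lemma Grassmannian_frame:
  assumes W: "W \<in> Grassmannian d n"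
  shows "\<exists>u. on_frame d u \<and> (\<forall>i<d. u i \<in> Rn n) \<and> span (u ` {..<d}) = W"
proof -
  have W': "subspace W" "W \<subseteq> Rn n" "dim W = d" using W by (auto simp: Grassmannian_def)
  obtain B where B: "finite B" "span B = W" by (rule finite_basis_Rn[OF W'(1,2)])
  obtain C where C: "finite C" "\<forall>x\<in>C. norm x = 1" "\<forall>x\<in>C. \<forall>y\<in>C. x \<noteq> y \<longrightarrow> inner x y = 0" "span C = W"
    using orthonormal_family_exists[OF B(1)] B(2) by metis
  have "independent C"
  proof (rule pairwise_orthogonal_independent)
    show "pairwise orthogonal C" using C(3) by (auto simp: pairwise_def orthogonal_def)
    show "0 \<notin> C" using C(2) by force
  qed
  then have "card C = d" using dim_span_eq_card_independent[of C] C(4) W'(3) by simp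
  then obtain u where u: "bij_betw u {..<d} C" using ex_bij_betw_nat_finite[OF C(1)] by (auto simp: atLeast0LessThan)
  have uC: "u i \<in> C" if "i < d" for i using u that by (auto simp: bij_betw_def)
  have "on_frame d u"
    unfolding on_frame_def
  proof (intro allI impI)
    fix i j assume ij: "i < d" "j < d"
    show "inner (u i) (u j) = (if i = j then 1 else 0)"
    proof (cases "i = j")
      case True
      then show ?thesis using C(2) uC[OF ij(1)] by (simp add: norm_eq_1)
    next
      case False
      then have "u i \<noteq> u j" using u ij by (auto simp: bij_betw_def inj_on_def)
      then show ?thesis using C(3) uC[OF ij(1)] uC[OF ij(2)] False by simp
    qed
  qed
  moreover have "u ` {..<d} = C" using u by (simp add: bij_betw_def)
  moreover have "C \<subseteq> Rn n" using span_superset[of C] C(4) W'(2) by blast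
  ultimately show ?thesis using C(4) uC by (intro exI[of _ u]) auto
qed

lemma infdist_le_infdist_add:
  assumes "A \<noteq> {}" "\<And>a. a \<in> A \<Longrightarrow> \<exists>b\<in>B. dist a b \<le> \<eta>"
  shows "infdist x B \<le> infdist x A + \<eta>"
proof -
  have "infdist x B - \<eta> \<le> dist x a" if a: "a \<in> A" for a
  proof -
    obtain b where b: "b \<in> B" "dist a b \<le> \<eta>" using assms(2)[OF a] by blast
    have "infdist x B \<le> dist x b" by (rule infdist_le[OF b(1)])
    also have "\<dots> \<le> dist x a + dist a b" by (rule dist_triangle)
    finally show ?thesis using b(2) by simp
  qed
  then have "infdist x B - \<eta> \<le> infdist x A"
    unfolding infdist_notempty[OF assms(1)] by (intro cINF_greatest[OF assms(1)])
  then show ?thesis by simp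
qed

text \<open>Keeping the coefficients preserves the norm, since both frames are orthonormal, so the
  partner stays in the unit ball. The coefficients are at most 1 in absolute value.\<close>

lemma frame_ball_near:
  assumes u: "on_frame d u" and u': "on_frame d u'" and w: "w \<in> span (u ` {..<d}) \<inter> cball 0 1"
  shows "\<exists>w'\<in>span (u' ` {..<d}) \<inter> cball 0 1. dist w w' \<le> (\<Sum>i<d. norm (u i - u' i))"
proof -
  obtain a where a: "w = (\<Sum>i<d. a i *\<^sub>R u i)" using span_image_sum[of "{..<d}" w u] w by auto
  define w' where "w' = (\<Sum>i<d. a i *\<^sub>R u' i)"
  have "w' \<in> span (u' ` {..<d})" unfolding w'_def by (intro span_sum span_scale span_base) auto
  moreover have "norm w' = norm w"
    by (rule power2_eq_imp_eq[OF _ norm_ge_zero norm_ge_zero]) (simp only: a w'_def on_frame_norm[OF u] on_frame_norm[OF u'])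
  moreover have "dist w w' \<le> (\<Sum>i<d. norm (u i - u' i))"
  proof -
    have "w - w' = (\<Sum>i<d. a i *\<^sub>R (u i - u' i))" by (simp add: a w'_def sum_subtractf scaleR_diff_right)
    moreover have "norm (a i *\<^sub>R (u i - u' i)) \<le> norm (u i - u' i)" if i: "i < d" for i
    proof -
      have "\<bar>a i\<bar> \<le> norm w * norm (u i)" using on_frame_coeff[OF u i, of a] Cauchy_Schwarz_ineq2[of w "u i"] a by simp
      also have "norm (u i) = 1" using u i by (simp add: on_frame_def norm_eq_1)
      finally have "\<bar>a i\<bar> \<le> 1" using w by simp
      then show ?thesis by (simp add: mult_left_le_one_le)
    qed
    ultimately show ?thesis unfolding dist_norm by (simp only:) (rule sum_norm_le, simp only: lessThan_iff)
  qed
  ultimately show ?thesis using w by (intro bexI[of _ w']) auto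
qed

lemma grass_dist_frames:
  assumes u: "on_frame d u" and u': "on_frame d u'"
  shows "grass_dist (span (u ` {..<d})) (span (u' ` {..<d})) \<le> (\<Sum>i<d. norm (u i - u' i))"
proof (rule grass_dist_leI)
  fix x :: rseq
  let ?A = "span (u ` {..<d}) \<inter> cball 0 1" and ?B = "span (u' ` {..<d}) \<inter> cball 0 1"
  have ne: "?A \<noteq> {}" "?B \<noteq> {}" using span_zero by force+
  have "infdist x ?B \<le> infdist x ?A + (\<Sum>i<d. norm (u i - u' i))"
    by (rule infdist_le_infdist_add[OF ne(1) frame_ball_near[OF u u']])
  moreover have "infdist x ?A \<le> infdist x ?B + (\<Sum>i<d. norm (u' i - u i))"
    by (rule infdist_le_infdist_add[OF ne(2) frame_ball_near[OF u' u]])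
  ultimately show "\<bar>infdist x ?A - infdist x ?B\<bar> \<le> (\<Sum>i<d. norm (u i - u' i))"
    by (simp add: norm_minus_commute abs_le_iff)
qed

lemma Grassmannian_sequentially_compact:
  assumes W: "\<And>l :: nat. W l \<in> Grassmannian d n"
  shows "\<exists>V\<in>Grassmannian d n. \<exists>r. strict_mono r \<and> (\<lambda>l. grass_dist (W (r l)) V) \<longlonglongrightarrow> 0"
proof -
  obtain u where u: "\<And>l. on_frame d (u l)" "\<And>l i. i < d \<Longrightarrow> u l i \<in> Rn n" "\<And>l. span (u l ` {..<d}) = W l"
    using Grassmannian_frame[OF W] by metis
  have "norm (u l i) \<le> 1" if "i < d" for l i
    using u(1)[of l] that by (simp add: on_frame_def norm_eq_1[THEN iffD2])
  then have "\<exists>r v. strict_mono r \<and> (\<forall>i\<in>{..<d}. v i \<in> Rn n \<and> (\<lambda>l. u (r l) i) \<longlonglongrightarrow> v i)"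
    using u(2) by (intro Rn_bounded_convergent_subsequence[where C = 1]) simp_all
  then obtain r v where r: "strict_mono r" and v': "\<forall>i\<in>{..<d}. v i \<in> Rn n \<and> (\<lambda>l. u (r l) i) \<longlonglongrightarrow> v i"
    by (elim exE conjE) (rule that)
  have v: "v i \<in> Rn n" "(\<lambda>l. u (r l) i) \<longlonglongrightarrow> v i" if "i < d" for i
    using v' that by (simp_all add: Ball_def)
  have fv: "on_frame d v"
    unfolding on_frame_def
  proof (intro allI impI)
    fix i j assume ij: "i < d" "j < d"
    have "(\<lambda>l. inner (u (r l) i) (u (r l) j)) \<longlonglongrightarrow> inner (v i) (v j)" by (intro tendsto_inner v ij)
    moreover have "(\<lambda>l. inner (u (r l) i) (u (r l) j)) = (\<lambda>l. if i = j then 1 else 0)"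
      using u(1) ij by (auto simp: on_frame_def)
    ultimately have "(\<lambda>l. if i = j then 1 else 0) \<longlonglongrightarrow> inner (v i) (v j)" by simp
    then show "inner (v i) (v j) = (if i = j then 1 else 0)" by (metis LIMSEQ_unique tendsto_const)
  qed
  have V: "span (v ` {..<d}) \<in> Grassmannian d n" by (rule on_frame_Grassmannian[OF fv v(1)])
  have "(\<lambda>l. \<Sum>i<d. norm (u (r l) i - v i)) \<longlonglongrightarrow> (\<Sum>i<d. 0)"
    by (intro tendsto_sum tendsto_norm_zero LIM_zero v(2)) auto
  then have l0: "(\<lambda>l. \<Sum>i<d. norm (u (r l) i - v i)) \<longlonglongrightarrow> 0" by simp
  have "(\<lambda>l. grass_dist (W (r l)) (span (v ` {..<d}))) \<longlonglongrightarrow> 0"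
  proof (rule tendsto_sandwich[OF _ _ tendsto_const l0])
    show "\<forall>\<^sub>F l in sequentially. 0 \<le> grass_dist (W (r l)) (span (v ` {..<d}))" by (simp add: grass_dist_nonneg)
    show "\<forall>\<^sub>F l in sequentially. grass_dist (W (r l)) (span (v ` {..<d})) \<le> (\<Sum>i<d. norm (u (r l) i - v i))"
      using grass_dist_frames[OF u(1) fv] unfolding u(3) by simp
  qed
  then show ?thesis using V r by blast
qed

text \<open>The distance of \<open>x\<close> from its orthogonal projection to \<open>W\<close> is a
  lower bound for its distance from all of \<open>W\<close>.\<close>

lemma infdist_ball_zero_imp_mem:
  assumes W: "W \<in> Grassmannian d n" and 0: "infdist x (W \<inter> cball 0 1) = 0"
  shows "x \<in> W"
proof -
  have W': "subspace W" "W \<subseteq> Rn n" using W by (auto simp: Grassmannian_def)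
  obtain B where B: "finite B" "span B = W" by (rule finite_basis_Rn[OF W'])
  obtain p where p: "p \<in> W" "\<And>b. b \<in> W \<Longrightarrow> inner (x - p) b = 0"
    using orthogonal_projection_exists[OF B(1), of x] B(2) by blast
  have ne: "W \<inter> cball 0 1 \<noteq> {}" using subspace_0[OF W'(1)] by force
  have "norm (x - p) \<le> dist x w" if "w \<in> W" for w
  proof -
    have "p - w \<in> W" using p(1) that W'(1) by (simp add: subspace_diff)
    then have "orthogonal (x - p) (p - w)" using p(2) by (simp add: orthogonal_def)
    then have "(norm ((x - p) + (p - w)))\<^sup>2 = (norm (x - p))\<^sup>2 + (norm (p - w))\<^sup>2"
      by (rule norm_add_Pythagorean)
    then have "(norm (x - p))\<^sup>2 \<le> (norm (x - w))\<^sup>2" by simp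
    then show ?thesis by (simp add: dist_norm)
  qed
  then have "norm (x - p) \<le> infdist x (W \<inter> cball 0 1)"
    unfolding infdist_notempty[OF ne] by (intro cINF_greatest[OF ne]) auto
  then show ?thesis using 0 p(1) by simp
qed

text \<open>The selection is the limit of points of successively finer nets, where each time the first
  net point whose ball still meets the value of the multifunction is taken.\<close>

lemma compact_valued_selection:
  fixes \<Phi> :: "'x::topological_space \<Rightarrow> 'w set"
  assumes MS: "Metric_space G dst"
    and cpt: "\<And>W. (\<And>l :: nat. W l \<in> G) \<Longrightarrow> \<exists>V\<in>G. \<exists>r. strict_mono r \<and> (\<lambda>l. dst (W (r l)) V) \<longlonglongrightarrow> 0"
    and S: "S \<in> sets borel" and \<Phi>: "\<And>x. x \<in> S \<Longrightarrow> \<Phi> x \<subseteq> G" "\<And>x. x \<in> S \<Longrightarrow> \<Phi> x \<noteq> {}"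
    and closed: "\<And>x W V. x \<in> S \<Longrightarrow> (\<And>l :: nat. W l \<in> \<Phi> x) \<Longrightarrow> V \<in> G \<Longrightarrow> (\<lambda>l. dst (W l) V) \<longlonglongrightarrow> 0 \<Longrightarrow> V \<in> \<Phi> x"
    and meas: "\<And>K. K \<subseteq> G \<Longrightarrow> (\<And>W V. (\<And>l :: nat. W l \<in> K) \<Longrightarrow> V \<in> G \<Longrightarrow> (\<lambda>l. dst (W l) V) \<longlonglongrightarrow> 0 \<Longrightarrow> V \<in> K) \<Longrightarrow>
       {x \<in> S. \<Phi> x \<inter> K \<noteq> {}} \<in> sets borel"
  shows "\<exists>\<tau>. (\<forall>x\<in>S. \<tau> x \<in> \<Phi> x) \<and> \<tau> \<in> measurable (restrict_space borel S) (borel_of (Metric_space.mtopology G dst))"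
proof -
  interpret Metric_space G dst by (rule MS)
  have net: "\<exists>z :: nat \<Rightarrow> 'w. \<forall>W\<in>G. \<exists>j. z j \<in> G \<and> dst (z j) W \<le> (1/2) ^ l" for l :: nat
  proof (cases "G = {}")
    case False
    have "mtotally_bounded G"
    proof -
      have "compactin mtopology G"
        unfolding compactin_sequentially
      proof (intro conjI allI impI)
        fix \<sigma> :: "nat \<Rightarrow> 'w" assume "range \<sigma> \<subseteq> G"
        then obtain V r where V: "V \<in> G" "strict_mono r" "(\<lambda>l. dst (\<sigma> (r l)) V) \<longlonglongrightarrow> 0"
          using cpt[of \<sigma>] by blast
        have "limitin mtopology (\<sigma> \<circ> r) V sequentially"
          unfolding limitin_metric_dist_null using V \<open>range \<sigma> \<subseteq> G\<close>
          by (auto intro!: always_eventually)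
        then show "\<exists>l r. l \<in> G \<and> strict_mono r \<and> limitin mtopology (\<sigma> \<circ> r) l sequentially" using V by blast
      qed simp
      then show ?thesis by (rule compactin_imp_mtotally_bounded)
    qed
    then obtain F where F: "finite F" "F \<subseteq> G" "G \<subseteq> (\<Union>x\<in>F. mball x ((1/2) ^ l))"
      unfolding mtotally_bounded_def by (meson half_gt_zero_iff zero_less_one zero_less_power)
    have Fne: "F \<noteq> {}" using F(3) False by auto
    have "\<exists>j. from_nat_into F j \<in> G \<and> dst (from_nat_into F j) W \<le> (1/2) ^ l" if W: "W \<in> G" for W
    proof -
      obtain x where x: "x \<in> F" "W \<in> mball x ((1/2) ^ l)" using F(3) W by blast
      obtain j where "from_nat_into F j = x" using from_nat_into_surj[OF countable_finite[OF F(1)] x(1)] by blast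
      then show ?thesis using x F(2) by (intro exI[of _ j]) (auto simp: in_mball)
    qed
    then show ?thesis by blast
  qed simp
  have "\<exists>z :: nat \<Rightarrow> nat \<Rightarrow> 'w. \<forall>l. \<forall>W\<in>G. \<exists>j. z l j \<in> G \<and> dst (z l j) W \<le> (1/2) ^ l"
    using net by (intro choice allI)
  then obtain z :: "nat \<Rightarrow> nat \<Rightarrow> 'w" where z: "\<And>l W. W \<in> G \<Longrightarrow> \<exists>j. z l j \<in> G \<and> dst (z l j) W \<le> (1/2) ^ l" by blast
  define cb where "cb l j = {W \<in> G. z l j \<in> G \<and> dst (z l j) W \<le> (1/2) ^ l}" for l j
  define sc where "sc K \<longleftrightarrow> (\<forall>W V. (\<forall>l :: nat. W l \<in> K) \<longrightarrow> V \<in> G \<longrightarrow> (\<lambda>l. dst (W l) V) \<longlonglongrightarrow> 0 \<longrightarrow> V \<in> K)" for K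
  have sc_Int: "sc (A \<inter> B)" if "sc A" "sc B" for A B using that unfolding sc_def by blast
  have sc_cb: "sc (cb l j)" for l j
    unfolding sc_def
  proof (intro allI impI)
    fix W V assume W: "\<forall>i :: nat. W i \<in> cb l j" and V: "V \<in> G" and lim: "(\<lambda>i. dst (W i) V) \<longlonglongrightarrow> 0"
    have zG: "z l j \<in> G" using W by (simp add: cb_def)
    have "dst (z l j) V \<le> (1/2) ^ l + dst (W i) V" for i
    proof -
      have "W i \<in> G" "dst (z l j) (W i) \<le> (1/2) ^ l" using W by (auto simp: cb_def)
      then show ?thesis using triangle[OF zG, of "W i" V] V by linarith
    qed
    moreover have "(\<lambda>i. (1/2) ^ l + dst (W i) V) \<longlonglongrightarrow> (1/2) ^ l + 0" by (intro tendsto_intros lim)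
    ultimately have "dst (z l j) V \<le> (1/2) ^ l + 0" by (intro LIMSEQ_le_const) blast+
    then show "V \<in> cb l j" using V zG by (simp add: cb_def)
  qed
  \<comment> \<open>The list holds the net indices chosen so far, the latest first; the length of
    the remaining list is the level of its head.\<close>
  define K where "K = rec_list G (\<lambda>j ls A. A \<inter> cb (length ls) j)"
  have K: "K [] = G" "K (j # ls) = K ls \<inter> cb (length ls) j" for j ls by (simp_all add: K_def)
  have KG: "K ls \<subseteq> G" and Ksc: "sc (K ls)" for ls
  proof -
    show "K ls \<subseteq> G" by (induction ls) (auto simp: K)
    show "sc (K ls)"
    proof (induction ls)
      case Nil show ?case by (simp add: K sc_def)
    next
      case (Cons j ls) show ?case unfolding K by (rule sc_Int[OF Cons sc_cb])
    qed
  qed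
  define H where "H A = {x \<in> S. \<Phi> x \<inter> A \<noteq> {}}" for A
  have Hb: "H A \<in> sets borel" if "A \<subseteq> G" "sc A" for A
    unfolding H_def by (rule meas[OF that(1)]) (use that(2) in \<open>unfold sc_def, blast\<close>)
  define js where "js x = rec_nat [] (\<lambda>l ls. (LEAST j. \<Phi> x \<inter> (K ls \<inter> cb l j) \<noteq> {}) # ls)" for x
  have js: "js x 0 = []" "js x (Suc l) = (LEAST j. \<Phi> x \<inter> (K (js x l) \<inter> cb l j) \<noteq> {}) # js x l" for x l
    by (simp_all add: js_def)
  have len: "length (js x l) = l" for x l by (induction l) (simp_all add: js)
  have step: "\<exists>j. \<Phi> x \<inter> (A \<inter> cb l j) \<noteq> {}" if x: "x \<in> S" and xA: "\<Phi> x \<inter> A \<noteq> {}" for x A l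
  proof -
    obtain W where W: "W \<in> \<Phi> x" "W \<in> A" using xA by blast
    have WG: "W \<in> G" using W(1) \<Phi>(1)[OF x] by blast
    obtain j where "z l j \<in> G" "dst (z l j) W \<le> (1/2) ^ l" using z[OF WG] by blast
    then have "W \<in> cb l j" using WG by (simp add: cb_def)
    then show ?thesis using W by blast
  qed
  have ne: "\<Phi> x \<inter> K (js x l) \<noteq> {}" if x: "x \<in> S" for x l
  proof (induction l)
    case 0
    show ?case using \<Phi>[OF x] by (simp add: js K Int_absorb2)
  next
    case (Suc l)
    from LeastI_ex[OF step[OF x Suc]] show ?case by (simp add: js K len)
  qed
  have jsb: "{x \<in> S. js x l = ls} \<in> sets borel" for l ls
  proof (induction l arbitrary: ls)
    case 0
    show ?case using S by (cases "ls = []") (auto simp: js)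
  next
    case (Suc l)
    show ?case
    proof (cases ls)
      case Nil
      then have "{x \<in> S. js x (Suc l) = ls} = {}" by (auto simp: js)
      then show ?thesis by (simp only: sets.empty_sets)
    next
      case (Cons j ls')
      \<comment> \<open>\<open>j\<close> is the least index iff the current part of
        \<open>\<Phi> x\<close> meets the ball with index \<open>j\<close> and none with a smaller
        index; the sets where such a ball is met are Borel by \<open>meas\<close>.\<close>
      have "{x \<in> S. js x (Suc l) = ls} = {x \<in> S. js x l = ls'} \<inter> (H (K ls' \<inter> cb l j) - (\<Union>i\<in>{..<j}. H (K ls' \<inter> cb l i)))"
        (is "?L = ?R")
      proof (intro set_eqI iffI)
        fix x assume "x \<in> ?L"
        then have x: "x \<in> S" "js x l = ls'" "(LEAST j. \<Phi> x \<inter> (K ls' \<inter> cb l j) \<noteq> {}) = j" by (auto simp: js Cons)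
        have "\<Phi> x \<inter> (K ls' \<inter> cb l j) \<noteq> {}" using LeastI_ex[OF step[OF x(1) ne[OF x(1)], of l l]] x by simp
        moreover have "\<not> \<Phi> x \<inter> (K ls' \<inter> cb l i) \<noteq> {}" if "i < j" for i
          using not_less_Least[of i "\<lambda>j. \<Phi> x \<inter> (K ls' \<inter> cb l j) \<noteq> {}"] x(3) that by simp
        ultimately show "x \<in> ?R" using x(1,2) unfolding H_def by blast
      next
        fix x assume x: "x \<in> ?R"
        have "(LEAST j. \<Phi> x \<inter> (K ls' \<inter> cb l j) \<noteq> {}) = j"
        proof (rule Least_equality)
          show "\<Phi> x \<inter> (K ls' \<inter> cb l j) \<noteq> {}" using x unfolding H_def by blast
          fix i assume "\<Phi> x \<inter> (K ls' \<inter> cb l i) \<noteq> {}"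
          then have "\<not> i < j" using x unfolding H_def by blast
          then show "j \<le> i" by simp
        qed
        then show "x \<in> ?L" using x by (simp add: js Cons)
      qed
      moreover have "?R \<in> sets borel"
        by (intro sets.Int sets.Diff sets.finite_UN Suc Hb sc_Int Ksc sc_cb le_infI1 KG finite_lessThan)
      ultimately show ?thesis by (simp only:)
    qed
  qed
  \<comment> \<open>A common point of all selected sets exists by sequential compactness. The radii
    tend to 0, so the indices determine it, and measurability can be read off from the
    indices.\<close>
  define \<tau> where "\<tau> x = (SOME W. W \<in> \<Phi> x \<and> (\<forall>l. W \<in> K (js x l)))" for x
  have \<tau>: "\<tau> x \<in> \<Phi> x \<and> (\<forall>l. \<tau> x \<in> K (js x l))" if x: "x \<in> S" for x
  proof -
    have "\<forall>l. \<exists>W. W \<in> \<Phi> x \<inter> K (js x l)" using ne[OF x] by blast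
    then obtain W where W: "\<And>l. W l \<in> \<Phi> x \<inter> K (js x l)" by metis
    have "W l \<in> G" for l using W[of l] KG by blast
    from cpt[of W, OF this] obtain V r where V: "V \<in> G" "strict_mono r" "(\<lambda>l. dst (W (r l)) V) \<longlonglongrightarrow> 0" by blast
    have "V \<in> \<Phi> x" by (rule closed[OF x _ V(1,3)]) (use W in blast)
    moreover have "V \<in> K (js x l)" for l
    proof -
      have anti: "K (js x i) \<subseteq> K (js x l)" if "l \<le> i" for i
        using that by (induction i rule: dec_induct) (auto simp: js K)
      have "W (r (i + l)) \<in> K (js x l)" for i
        using W[of "r (i + l)"] anti[of "r (i + l)"] seq_suble[OF V(2), of "i + l"] by auto
      moreover have "(\<lambda>i. dst (W (r (i + l))) V) \<longlonglongrightarrow> 0" using V(3) by (rule LIMSEQ_ignore_initial_segment)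
      ultimately show ?thesis
        using Ksc[of "js x l", unfolded sc_def, rule_format, of "\<lambda>i. W (r (i + l))" V] V(1) by blast
    qed
    ultimately have "V \<in> \<Phi> x \<and> (\<forall>l. V \<in> K (js x l))" by blast
    then show ?thesis unfolding \<tau>_def by (rule someI)
  qed
  have "\<tau> \<in> measurable (restrict_space borel S) (borel_of mtopology)"
    unfolding borel_of_def
  proof (rule measurable_measure_of)
    show "{U. openin mtopology U} \<subseteq> Pow (topspace mtopology)" using openin_subset[of mtopology] by auto
    show "\<tau> \<in> space (restrict_space borel S) \<rightarrow> topspace mtopology"
      using \<tau> \<Phi>(1) by (auto simp: space_restrict_space)
    fix U assume "U \<in> {U. openin mtopology U}"
    then have U: "U \<subseteq> G" "\<And>W. W \<in> U \<Longrightarrow> \<exists>r>0. mball W r \<subseteq> U" by (auto simp: openin_mtopology)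
    \<comment> \<open>If \<open>\<tau> x\<close> lies in the open set \<open>U\<close>, then some
      selected ball, which contains \<open>\<tau> x\<close> and is small, lies in \<open>U\<close>.
      \<open>Q\<close> lists the finitely many choices that certify this.\<close>
    define Q where "Q = {(l, ls). \<exists>j ls'. ls = j # ls' \<and> cb l j \<subseteq> U}"
    have eq: "\<tau> -` U \<inter> space (restrict_space borel S) = (\<Union>p\<in>Q. {x \<in> S. js x (Suc (fst p)) = snd p})" (is "?L = ?R")
    proof (intro set_eqI iffI)
      fix x assume "x \<in> ?L"
      then have x: "x \<in> S" "\<tau> x \<in> U" by (auto simp: space_restrict_space)
      obtain r where r: "r > 0" "mball (\<tau> x) r \<subseteq> U" using U(2)[OF x(2)] by blast
      obtain l where l: "(1/2) ^ l < r / 2" using real_arch_pow_inv[of "r / 2" "1/2"] r(1) by auto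
      define j where "j = (LEAST j. \<Phi> x \<inter> (K (js x l) \<inter> cb l j) \<noteq> {})"
      have jj: "js x (Suc l) = j # js x l" by (simp add: js j_def)
      have tc: "\<tau> x \<in> cb l j" using \<tau>[OF x(1)] jj K(2)[of j "js x l"] len[of x l] by (metis IntD2)
      have "cb l j \<subseteq> U"
      proof
        fix W assume W: "W \<in> cb l j"
        have G3: "\<tau> x \<in> G" "z l j \<in> G" "W \<in> G" using tc W by (auto simp: cb_def)
        have "dst (\<tau> x) W \<le> dst (\<tau> x) (z l j) + dst (z l j) W" by (rule triangle[OF G3])
        also have "\<dots> \<le> (1/2) ^ l + (1/2) ^ l" using tc W by (intro add_mono) (auto simp: cb_def commute)
        also have "\<dots> < r" using l by simp
        finally show "W \<in> U" using r(2) G3 by (auto simp: in_mball)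
      qed
      then have "(l, j # js x l) \<in> Q" by (auto simp: Q_def)
      then show "x \<in> ?R" using x jj by (intro UN_I[where a = "(l, j # js x l)"]) simp_all
    next
      fix x assume "x \<in> ?R"
      then obtain l j ls' where x: "x \<in> S" "js x (Suc l) = j # ls'" "cb l j \<subseteq> U" by (auto simp: Q_def)
      have "\<tau> x \<in> K (j # ls')" using \<tau>[OF x(1)] x(2) by metis
      moreover have "length ls' = l" using len[of x "Suc l"] x(2) by simp
      ultimately have "\<tau> x \<in> cb l j" by (simp add: K)
      then show "x \<in> ?L" using x by (auto simp: space_restrict_space)
    qed
    have "(\<Union>p\<in>Q. {x \<in> S. js x (Suc (fst p)) = snd p}) \<in> sets borel"
      by (intro sets.countable_UN' image_subsetI jsb countable_subset[OF subset_UNIV countableI_type])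
    moreover have "(\<Union>p\<in>Q. {x \<in> S. js x (Suc (fst p)) = snd p}) \<subseteq> S" by blast
    ultimately show "\<tau> -` U \<inter> space (restrict_space borel S) \<in> sets (restrict_space borel S)"
      unfolding eq using S by (simp only: sets_restrict_space_iff[of S borel] space_borel Int_UNIV_right)
  qed
  then show ?thesis using \<tau> by blast
qed

section \<open>Tangent fields from exclusion sets\<close>

text \<open>A null set is covered by countably many nonoverlapping intervals of total length at most
  \<open>min \<delta> \<epsilon>\<close>. The bound on the sum also bounds each diameter by
  \<open>\<delta>\<close>, so one choice meets both demands of the content.\<close>

lemma Hausdorff_measure_1_null:
  assumes N: "N \<in> null_sets lborel" and E: "E \<subseteq> N" "E \<subseteq> {a..b::real}"
  shows "Hausdorff_measure 1 E = 0"
proof -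
  have "Hausdorff_content \<delta> 1 E \<le> ennreal \<epsilon>" if \<delta>: "0 < \<delta>" and \<epsilon>: "0 < \<epsilon>" for \<delta> \<epsilon>
  proof -
    define N' where "N' = N \<inter> {a..b}"
    have "N' \<in> null_sets lborel" unfolding N'_def using N by (intro null_set_Int2) auto
    then have N'0: "N' \<in> lmeasurable" "measure lebesgue N' = 0"
      by (auto simp: fmeasurable_def null_sets_def measure_def)
    define e where "e = min \<delta> \<epsilon>"
    have e: "0 < e" using \<delta> \<epsilon> by (simp add: e_def)
    obtain \<D> where \<D>: "countable \<D>" "\<And>K. K \<in> \<D> \<Longrightarrow> K \<subseteq> cbox a b \<and> K \<noteq> {} \<and> (\<exists>c d. K = cbox c d)"
      "pairwise (\<lambda>A B. interior A \<inter> interior B = {}) \<D>" "N' \<subseteq> \<Union>\<D>" "\<Union>\<D> \<in> lmeasurable"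
      "measure lebesgue (\<Union>\<D>) \<le> measure lebesgue N' + e"
  proof (rule measurable_outer_intervals_bounded[OF N'0(1), of a b e])
    show "N' \<subseteq> cbox a b" by (auto simp: N'_def)
  next
    fix \<D> :: "real set set"
    assume *: "countable \<D>" "\<And>K. K \<in> \<D> \<Longrightarrow> K \<subseteq> cbox a b \<and> K \<noteq> {} \<and> (\<exists>c d. K = cbox c d)"
      "pairwise (\<lambda>A B. interior A \<inter> interior B = {}) \<D>" "N' \<subseteq> \<Union>\<D>" "\<Union>\<D> \<in> lmeasurable"
      "measure lebesgue (\<Union>\<D>) \<le> measure lebesgue N' + e"
    show thesis by (rule that[OF *])
  qed (rule e)
    define f where "f i = (if i \<in> to_nat_on \<D> ` \<D> then from_nat_into \<D> i else {})" for i
    have f: "f i = {} \<or> (f i \<in> \<D> \<and> to_nat_on \<D> (f i) = i)" for i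
      using \<D>(1) by (auto simp: f_def)
    have cov: "\<Union>\<D> \<subseteq> (\<Union>i. f i)"
    proof
      fix x assume "x \<in> \<Union>\<D>"
      then obtain K where K: "K \<in> \<D>" "x \<in> K" by blast
      then have "f (to_nat_on \<D> K) = K" using \<D>(1) by (simp add: f_def)
      then show "x \<in> (\<Union>i. f i)" using K(2) by blast
    qed
    \<comment> \<open>The intervals may share end points; passing to interiors keeps the lengths and
      makes them disjoint.\<close>
    have disj: "disjoint_family (\<lambda>i. interior (f i))"
      unfolding disjoint_family_on_def
    proof (intro ballI impI)
      fix i j :: nat assume "i \<noteq> j"
      then show "interior (f i) \<inter> interior (f j) = {}"
        using f[of i] f[of j] \<D>(3) unfolding pairwise_def by (metis inf_bot_left inf_bot_right interior_empty)
    qed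
    have len: "emeasure lborel (interior (f i)) = ennreal (diameter (f i)) \<and> bounded (f i)" for i
    proof (cases "f i = {}")
      case False
      then obtain c d where cd: "f i = {c..d}" "c \<le> d" using f[of i] \<D>(2)[of "f i"] by (auto simp: cbox_interval)
      then show ?thesis by simp
    qed simp
    have "(\<Sum>i. ennreal (diameter (f i))) = emeasure lborel (\<Union>i. interior (f i))"
      using suminf_emeasure[of "\<lambda>i. interior (f i)" lborel] disj len by (auto intro!: borel_open)
    also have "\<dots> \<le> emeasure lebesgue (\<Union>\<D>)"
    proof -
      have "emeasure lborel (\<Union>i. interior (f i)) = emeasure lebesgue (\<Union>i. interior (f i))"
        by (simp add: borel_open open_UN)
      also have "\<dots> \<le> emeasure lebesgue (\<Union>\<D>)"
        using \<D>(5) f interior_subset by (intro emeasure_mono) (fastforce simp: fmeasurable_def)+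
      finally show ?thesis .
    qed
    also have "\<dots> \<le> ennreal e" using \<D>(5,6) N'0(2) by (simp add: emeasure_eq_measure2 ennreal_leI)
    finally have sum: "(\<Sum>i. ennreal (diameter (f i))) \<le> ennreal e" .
    have small: "diameter (f i) \<le> \<delta>" for i
    proof -
      have "ennreal (diameter (f i)) \<le> (\<Sum>i. ennreal (diameter (f i)))"
        using sum_le_suminf[of "\<lambda>i. ennreal (diameter (f i))" "{i}"] by (simp add: summableI)
      then have "ennreal (diameter (f i)) \<le> ennreal e" using sum by (rule order_trans)
      then show ?thesis using e by (subst (asm) ennreal_le_iff) (auto simp: e_def)
    qed
    have "Hausdorff_content \<delta> 1 E \<le> (\<Sum>i. diam_powr 1 (f i))"
      unfolding Hausdorff_content_def
      by (rule INF_lower) (use E cov \<D>(4) small len in \<open>force simp: N'_def\<close>)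
    also have "\<dots> = (\<Sum>i. ennreal (diameter (f i)))"
    proof (rule suminf_cong)
      fix i
      have "0 \<le> diameter (f i)" using len by (intro diameter_ge_0) blast
      then show "diam_powr 1 (f i) = ennreal (diameter (f i))" by (simp add: diam_powr_def)
    qed
    also have "\<dots> \<le> ennreal \<epsilon>" using sum by (rule order_trans) (simp add: e_def ennreal_leI)
    finally show ?thesis .
  qed
  note content = this
  have zero: "Hausdorff_content \<delta> 1 E = 0" if \<delta>: "0 < \<delta>" for \<delta>
  proof -
    have "Hausdorff_content \<delta> 1 E \<le> 0"
    proof (rule ennreal_le_epsilon)
      fix e :: real assume "0 < e"
      then show "Hausdorff_content \<delta> 1 E \<le> 0 + ennreal e" unfolding add_0_left by (rule content[OF \<delta>])
    qed
    then show ?thesis by (simp only: le_zero_eq)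
  qed
  have "Hausdorff_measure 1 E \<le> 0"
    unfolding Hausdorff_measure_def by (rule SUP_least) (simp only: greaterThan_iff zero order_refl)
  then show ?thesis by (simp only: le_zero_eq)
qed

text \<open>Around each \<open>y\<close> one of the countably many balls fits into any prescribed
  ball about \<open>y\<close>. The two inequalities are in the form that
  \<open>dir_null_mono\<close> takes.\<close>

lemma rational_balls_exist:
  "\<exists>(bc :: nat \<Rightarrow> 'a::euclidean_space \<times> rseq) br. (\<forall>k. 0 < br k) \<and>
     (\<forall>y \<rho>. snd y \<in> Rn n \<longrightarrow> 0 < \<rho> \<longrightarrow> (\<exists>k. dist y (bc k) < br k \<and> dist y (bc k) + br k \<le> \<rho>))"
proof -
  obtain D :: "'a set" where D: "countable D" "\<And>X. open X \<Longrightarrow> X \<noteq> {} \<Longrightarrow> \<exists>d\<in>D. d \<in> X"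
    using countable_dense_exists by blast
  define pt where "pt l = (\<Sum>j<n. real_of_rat (l ! j) *\<^sub>R unit_rseq j)" for l :: "rat list"
  define Q where "Q = D \<times> (UNIV :: rat list set) \<times> (UNIV :: nat set)"
  have cQ: "countable Q" unfolding Q_def using D(1) by (intro countable_SIGMA countableI_type)
  obtain d0 where "d0 \<in> D" using D(2)[of UNIV] by auto
  then have neQ: "Q \<noteq> {}" by (auto simp: Q_def)
  define q where "q = from_nat_into Q"
  define bc where "bc k = (fst (q k), pt (fst (snd (q k))))" for k
  define br where "br k = 1 / real (Suc (snd (snd (q k))))" for k
  have "\<exists>k. dist y (bc k) < br k \<and> dist y (bc k) + br k \<le> \<rho>" if y: "snd y \<in> Rn n" and \<rho>: "0 < \<rho>" for y \<rho>
  proof -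
    obtain N where N: "1 / real (Suc N) < \<rho> / 2" using nat_approx_posE[of "\<rho> / 2"] \<rho> by auto
    define \<epsilon> where "\<epsilon> = 1 / real (Suc N)"
    have \<epsilon>: "0 < \<epsilon>" by (simp add: \<epsilon>_def)
    obtain p where p: "p \<in> D" "p \<in> ball (fst y) (\<epsilon> / 2)" using D(2)[of "ball (fst y) (\<epsilon> / 2)"] \<epsilon> by auto
    define \<eta> where "\<eta> = \<epsilon> / 2 / (real n + 1)"
    have \<eta>: "0 < \<eta>" using \<epsilon> by (simp add: \<eta>_def)
    have "\<exists>r. \<bar>coord (snd y) j - real_of_rat r\<bar> < \<eta>" for j
    proof -
      obtain r where "coord (snd y) j - \<eta> < real_of_rat r" "real_of_rat r < coord (snd y) j + \<eta>"
        using of_rat_dense[of "coord (snd y) j - \<eta>" "coord (snd y) j + \<eta>"] \<eta> by auto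
      then show ?thesis by (intro exI[of _ r]) (simp add: abs_less_iff)
    qed
    then obtain r where r: "\<And>j. \<bar>coord (snd y) j - real_of_rat (r j)\<bar> < \<eta>" by metis
    define l where "l = map r [0..<n]"
    have "snd y - pt l = (\<Sum>j<n. (coord (snd y) j - real_of_rat (r j)) *\<^sub>R unit_rseq j)"
    proof -
      have "pt l = (\<Sum>j<n. real_of_rat (r j) *\<^sub>R unit_rseq j)" by (simp add: pt_def l_def)
      then show ?thesis by (subst Rn_representation[OF y]) (simp add: sum_subtractf scaleR_diff_left)
    qed
    also have "norm \<dots> \<le> (\<Sum>j<n. \<eta>)" using r by (intro sum_norm_le) (auto intro: less_imp_le)
    also have "\<dots> = real n * \<eta>" by simp
    also have "\<dots> < (real n + 1) * \<eta>" using \<eta> by simp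
    also have "\<dots> = \<epsilon> / 2"
    proof -
      have "x * (z / x) = z" if "x \<noteq> 0" for x z :: real using that by simp
      moreover have "real n + 1 \<noteq> 0" by linarith
      ultimately show ?thesis unfolding \<eta>_def .
    qed
    finally have d2: "dist (snd y) (pt l) < \<epsilon> / 2" by (simp add: dist_norm)
    have d1: "dist (fst y) p < \<epsilon> / 2" using p(2) by simp
    have dd: "dist y (p, pt l) < \<epsilon>"
    proof -
      have "dist y (p, pt l) \<le> dist (fst y) p + dist (snd y) (pt l)"
        unfolding dist_prod_def using sqrt_sum_squares_le_sum[of "dist (fst y) p" "dist (snd y) (pt l)"] by simp
      then show ?thesis using d1 d2 by linarith
    qed
    obtain k where k: "q k = (p, l, N)"
      unfolding q_def using from_nat_into_surj[OF cQ, of "(p, l, N)"] p(1) by (auto simp: Q_def)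
    have "bc k = (p, pt l)" "br k = \<epsilon>" by (simp_all add: bc_def br_def k \<epsilon>_def)
    then show ?thesis using dd N by (intro exI[of _ k]) (simp add: \<epsilon>_def)
  qed
  moreover have "0 < br k" for k by (simp add: br_def)
  ultimately show ?thesis by blast
qed

lemma dir_null_graph:
  assumes "dir_null (\<lambda>x. x) v \<rho> A"
  shows "dir_null (\<lambda>x. (x, F x)) (v, w) \<rho> A"
proof -
  have "dir_frag (\<lambda>x. x) v \<rho> D \<gamma>" if f: "dir_frag (\<lambda>x. (x, F x)) (v, w) \<rho> D \<gamma>" for D \<gamma>
    unfolding dir_frag_def
  proof (intro conjI ballI)
    fix s t assume st: "s \<in> D" "t \<in> D"
    have "norm ((\<gamma> t, F (\<gamma> t)) - (\<gamma> s, F (\<gamma> s)) - (t - s) *\<^sub>R (v, w)) \<le> \<rho> * \<bar>t - s\<bar>"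
      using f st unfolding dir_frag_def by blast
    then have "norm (\<gamma> t - \<gamma> s - (t - s) *\<^sub>R v, F (\<gamma> t) - F (\<gamma> s) - (t - s) *\<^sub>R w) \<le> \<rho> * \<bar>t - s\<bar>" by simp
    then show "norm (\<gamma> t - \<gamma> s - (t - s) *\<^sub>R v) \<le> \<rho> * \<bar>t - s\<bar>" by (rule order_trans[OF norm_fst_le])
  qed (use f in \<open>auto simp: dir_frag_def\<close>)
  then show ?thesis using assms unfolding dir_null_def by blast
qed

text \<open>Exclusion sets: a fragment meets \<open>X k\<close> in a null set as long as its derivative lies in the
  \<open>k\<close>-th ball, and at every point of \<open>S\<close> each independent tuple contains an excluded vector.\<close>

lemma exclusion_sets_exist:
  fixes S :: "'a::euclidean_space set" and F :: "'a \<Rightarrow> rseq" and d :: nat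
  assumes F: "L-lipschitz_on UNIV F"
    and PS: "\<And>v. (\<And>a. (\<Sum>i<d. a i *\<^sub>R v i) = 0 \<Longrightarrow> \<forall>i<d. a i = 0) \<Longrightarrow>
      \<exists>\<rho>>0. \<exists>A. (\<forall>i<d. dir_null (\<lambda>x. x) (v i) \<rho> (A i)) \<and> S \<subseteq> (\<Union>i<d. A i)"
  shows "\<exists>bc br X. (\<forall>k :: nat. dir_null (\<lambda>x. (x, F x)) (bc k) (br k) (X k)) \<and>
    (\<forall>x\<in>S. \<forall>y. (\<forall>i<d. snd (y i) \<in> Rn n) \<longrightarrow> (\<forall>a. (\<Sum>i<d. a i *\<^sub>R snd (y i)) = 0 \<longrightarrow> (\<forall>i<d. a i = 0)) \<longrightarrow>
      (\<exists>i<d. \<exists>k. dist (y i) (bc k) < br k \<and> x \<in> X k))"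
proof -
  let ?G = "\<lambda>x. (x, F x)"
  have loc: "\<exists>\<rho>>0. \<exists>A. (\<forall>i<d. dir_null ?G (y i) \<rho> (A i)) \<and> S \<subseteq> (\<Union>i<d. A i)"
    if ind: "\<forall>a. (\<Sum>i<d. a i *\<^sub>R snd (y i)) = 0 \<longrightarrow> (\<forall>i<d. a i = 0)" for y :: "nat \<Rightarrow> 'a \<times> rseq"
  \<comment> \<open>If the domain parts are independent, the sets of \<open>PS\<close> serve for the
    graph map too. Otherwise a dependence among them is not shared by the independent parts
    \<open>snd (y i)\<close>, and \<open>circuit_null_cover\<close> applies.\<close>
  proof (cases "\<forall>a. (\<Sum>i<d. a i *\<^sub>R fst (y i)) = 0 \<longrightarrow> (\<forall>i<d. a i = 0)")
    case True
    then obtain \<rho> A where "\<rho> > 0" "\<forall>i<d. dir_null (\<lambda>x. x) (fst (y i)) \<rho> (A i)" "S \<subseteq> (\<Union>i<d. A i)"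
      using PS[of "\<lambda>i. fst (y i)"] by blast
    moreover have "dir_null ?G (y i) \<rho> (A i)" if "dir_null (\<lambda>x. x) (fst (y i)) \<rho> (A i)" for i
      using dir_null_graph[OF that, of F "snd (y i)"] by simp
    ultimately show ?thesis by blast
  next
    case False
    then obtain a where a: "(\<Sum>i<d. a i *\<^sub>R fst (y i)) = 0" "\<not> (\<forall>i<d. a i = 0)" by blast
    then have "(\<Sum>i<d. a i *\<^sub>R snd (y i)) \<noteq> 0" using ind by blast
    from circuit_null_cover[OF F a(1) this] obtain \<rho> A where "\<rho> > 0"
      "\<forall>i<d. dir_null ?G (fst (y i), snd (y i)) \<rho> (A i)" "(\<Union>i<d. A i) = UNIV" by blast
    then show ?thesis by (intro exI[of _ \<rho>] conjI exI[of _ A]) auto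
  qed
  obtain bc :: "nat \<Rightarrow> 'a \<times> rseq" and br where b: "\<And>y \<rho>. snd y \<in> Rn n \<Longrightarrow> 0 < \<rho> \<Longrightarrow> \<exists>k. dist y (bc k) < br k \<and> dist y (bc k) + br k \<le> \<rho>"
    using rational_balls_exist[of n] by blast
  define good where "good ks A \<longleftrightarrow> (\<forall>i<d. dir_null ?G (bc (ks ! i)) (br (ks ! i)) (A i)) \<and> S \<subseteq> (\<Union>i<d. A i)" for ks A
  \<comment> \<open>One cover per tuple of ball indices keeps the family countable; an exact tuple
    \<open>y\<close> is handled through balls fitted around the \<open>y i\<close>.\<close>
  define NA where "NA ks = (SOME A. good ks A)" for ks
  have NA: "good ks (NA ks)" if "good ks A" for ks A unfolding NA_def by (rule someI[of "good ks" A, OF that])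
  define I where "I k = {(ks, i). good ks (NA ks) \<and> i < d \<and> ks ! i = k}" for k
  define X where "X k = (\<Union>p\<in>I k. NA (fst p) (snd p))" for k
  have "dir_null ?G (bc k) (br k) (X k)" for k
    unfolding X_def
  proof (rule dir_null_UN)
    show "countable (I k)" by (rule countable_subset[OF subset_UNIV countableI_type])
    show "dir_null ?G (bc k) (br k) (NA (fst p) (snd p))" if "p \<in> I k" for p
      using that by (auto simp: I_def good_def)
  qed
  moreover have "\<exists>i<d. \<exists>k. dist (y i) (bc k) < br k \<and> x \<in> X k"
    if x: "x \<in> S" and y: "\<forall>i<d. snd (y i) \<in> Rn n" and ind: "\<forall>a. (\<Sum>i<d. a i *\<^sub>R snd (y i)) = 0 \<longrightarrow> (\<forall>i<d. a i = 0)"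
    for x y
  proof -
    obtain \<rho> A where \<rho>: "\<rho> > 0" and A: "\<And>i. i < d \<Longrightarrow> dir_null ?G (y i) \<rho> (A i)" "S \<subseteq> (\<Union>i<d. A i)"
      using loc[OF ind] by blast
    have "\<exists>k. dist (y i) (bc k) < br k \<and> dist (y i) (bc k) + br k \<le> \<rho>" if "i < d" for i
      using b[of "y i" \<rho>] y \<rho> that by blast
    then obtain k where k: "\<And>i. i < d \<Longrightarrow> dist (y i) (bc (k i)) < br (k i)" "\<And>i. i < d \<Longrightarrow> dist (y i) (bc (k i)) + br (k i) \<le> \<rho>"
      by metis
    define ks where "ks = map k [0..<d]"
    have ki: "ks ! i = k i" if "i < d" for i using that by (simp add: ks_def)
    have "good ks A"
      unfolding good_def
    proof (intro conjI allI impI)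
      fix i assume i: "i < d"
      show "dir_null ?G (bc (ks ! i)) (br (ks ! i)) (A i)"
        unfolding ki[OF i] by (rule dir_null_mono[OF A(1)[OF i] k(2)[OF i]])
    qed (rule A(2))
    then have g: "good ks (NA ks)" by (rule NA)
    then obtain i where i: "i < d" "x \<in> NA ks i" using x unfolding good_def by blast
    have "(ks, i) \<in> I (k i)" using g i ki by (simp add: I_def)
    then have "x \<in> X (k i)" unfolding X_def using i(2) by (intro UN_I[of "(ks, i)"]) auto
    then show ?thesis using i(1) k(1) by blast
  qed
  ultimately show ?thesis by blast
qed

text \<open>By \<open>dep\<close> the span of \<open>T\<close> has dimension at most
  \<open>d - 1\<close>. A basis of \<open>Rn n\<close> extending a basis of this span supplies the
  vectors that raise the dimension to exactly \<open>d - 1\<close>.\<close>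

lemma Grassmannian_superspace:
  assumes T: "T \<subseteq> Rn n" and d: "1 \<le> d" "d - 1 \<le> n"
    and dep: "\<And>w. (\<And>i. i < d \<Longrightarrow> w i \<in> T) \<Longrightarrow> \<not> (\<forall>a. (\<Sum>i<d. a i *\<^sub>R w i) = 0 \<longrightarrow> (\<forall>i<d. a i = 0))"
  shows "\<exists>W\<in>Grassmannian (d - 1) n. T \<subseteq> W"
proof -
  obtain B where B: "B \<subseteq> T" "independent B" "T \<subseteq> span B"
    using basis_exists[of T] by metis
  have fin: "finite C \<and> card C \<le> n" if "independent C" "C \<subseteq> Rn n" for C
  proof -
    have "finite (unit_rseq ` {..<n})" by simp
    moreover have "C \<subseteq> span (unit_rseq ` {..<n})" using that(2) Rn_subset_span by blast
    ultimately have "finite C \<and> card C \<le> card (unit_rseq ` {..<n})" using independent_span_bound[OF _ that(1)] by blast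
    moreover have "card (unit_rseq ` {..<n}) \<le> n" using card_image_le[of "{..<n}" unit_rseq] by simp
    ultimately show ?thesis by linarith
  qed
  have fB: "finite B" using fin[OF B(2)] B(1) T by blast
  have cB: "card B \<le> d - 1"
  proof (rule ccontr)
    assume "\<not> card B \<le> d - 1"
    then have "d \<le> card B" by linarith
    then obtain B' where B': "B' \<subseteq> B" "card B' = d" "finite B'" using obtain_subset_with_card_n by metis
    obtain w where w: "bij_betw w {..<d} B'" using ex_bij_betw_nat_finite[OF B'(3)] B'(2) by (auto simp: atLeast0LessThan)
    have iB': "independent B'" using B(2) B'(1) by (rule independent_mono)
    have "\<forall>a. (\<Sum>i<d. a i *\<^sub>R w i) = 0 \<longrightarrow> (\<forall>i<d. a i = 0)"
    proof (intro allI impI)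
      fix a :: "nat \<Rightarrow> real" and i assume a: "(\<Sum>i<d. a i *\<^sub>R w i) = 0" and i: "i < d"
      define a' where "a' b = a (the_inv_into {..<d} w b)" for b
      have inv: "the_inv_into {..<d} w (w i) = i" if "i < d" for i
        using w that by (intro the_inv_into_f_f) (auto simp: bij_betw_def)
      have "(\<Sum>b\<in>B'. a' b *\<^sub>R b) = (\<Sum>i<d. a' (w i) *\<^sub>R w i)" by (rule sum.reindex_bij_betw[OF w, symmetric])
      also have "\<dots> = (\<Sum>i<d. a i *\<^sub>R w i)" by (intro sum.cong) (auto simp: a'_def inv)
      finally have "(\<Sum>b\<in>B'. a' b *\<^sub>R b) = 0" using a by simp
      then have "\<forall>b\<in>B'. a' b = 0" using independentD[OF iB' B'(3) subset_refl] by blast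
      then have "a' (w i) = 0" using w i by (auto simp: bij_betw_def)
      then show "a i = 0" by (simp add: a'_def inv[OF i])
    qed
    moreover have "w i \<in> T" if "i < d" for i using w that B'(1) B(1) by (auto simp: bij_betw_def)
    ultimately show False using dep by blast
  qed
  have BR: "B \<subseteq> Rn n" using B(1) T by blast
  obtain C where C: "B \<subseteq> C" "C \<subseteq> Rn n" "independent C" "Rn n \<subseteq> span C"
    using maximal_independent_subset_extend[OF BR B(2)] by blast
  have fC: "finite C" using fin[OF C(3,2)] by blast
  have "card C = dim (Rn n)" using C by (intro basis_card_eq_dim)
  then have "card C = n" by (simp add: dim_Rn)
  then obtain E where E: "B \<subseteq> E" "E \<subseteq> C" "card E = d - 1"
    using exists_subset_between[OF cB _ C(1) fC] d(2) by auto
  have iE: "independent E" using C(3) E(2) by (rule independent_mono)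
  have "span E \<in> Grassmannian (d - 1) n"
    unfolding Grassmannian_def mem_Collect_eq
  proof (intro conjI subspace_span)
    show "span E \<subseteq> Rn n" by (rule span_minimal[OF order_trans[OF E(2) C(2)] subspace_Rn])
    show "dim (span E) = d - 1" using dim_span_eq_card_independent[OF iE] E(3) by (simp only:)
  qed
  moreover have "T \<subseteq> span E" using B(3) span_mono[OF E(1)] by blast
  ultimately show ?thesis by blast
qed

text \<open>At almost every time of a fragment the pair of derivatives of \<open>\<gamma>\<close>
  and \<open>F \<circ> \<gamma>\<close> avoids the balls excluded at the point, so it lies in
  \<open>T\<close>. Any Borel choice of a subspace containing the second components of
  \<open>T x\<close> is thus a tangent field. The main work is to show that the sets where
  \<open>\<Phi>\<close> meets a closed set of subspaces are Borel.\<close>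

lemma weak_tangent_field_exists:
  fixes S :: "'a::euclidean_space set" and F :: "'a \<Rightarrow> rseq" and d :: nat
  assumes S: "S \<in> sets borel" and d: "1 \<le> d" "d - 1 \<le> n" and F: "L-lipschitz_on UNIV F" "range F \<subseteq> Rn n"
    and PS: "\<And>v. (\<And>a. (\<Sum>i<d. a i *\<^sub>R v i) = 0 \<Longrightarrow> \<forall>i<d. a i = 0) \<Longrightarrow>
      \<exists>\<rho>>0. \<exists>A. (\<forall>i<d. dir_null (\<lambda>x. x) (v i) \<rho> (A i)) \<and> S \<subseteq> (\<Union>i<d. A i)"
  shows "\<exists>\<tau>. weak_tangent_field (d - 1) n S F \<tau>"
proof -
  let ?Gr = "Grassmannian (d - 1) n"
  let ?G = "\<lambda>x. (x, F x)"
  have "\<exists>bc br X. (\<forall>k :: nat. dir_null ?G (bc k) (br k) (X k)) \<and>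
    (\<forall>x\<in>S. \<forall>y. (\<forall>i<d. snd (y i) \<in> Rn n) \<longrightarrow> (\<forall>a. (\<Sum>i<d. a i *\<^sub>R snd (y i)) = 0 \<longrightarrow> (\<forall>i<d. a i = 0)) \<longrightarrow>
      (\<exists>i<d. \<exists>k. dist (y i) (bc k) < br k \<and> x \<in> X k))"
    by (rule exclusion_sets_exist[OF F(1) PS])
  then obtain bc :: "nat \<Rightarrow> 'a \<times> rseq" and br X where X: "\<forall>k. dir_null ?G (bc k) (br k) (X k)"
    and exc: "\<forall>x\<in>S. \<forall>y. (\<forall>i<d. snd (y i) \<in> Rn n) \<longrightarrow> (\<forall>a. (\<Sum>i<d. a i *\<^sub>R snd (y i)) = 0 \<longrightarrow> (\<forall>i<d. a i = 0)) \<longrightarrow>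
      (\<exists>i<d. \<exists>k. dist (y i) (bc k) < br k \<and> x \<in> X k)"
    by (elim exE conjE) (rule that)
  have Xb: "X k \<in> sets borel" for k using X by (simp add: dir_null_def)
  define T where "T x = {y. snd y \<in> Rn n \<and> (\<forall>k. dist y (bc k) < br k \<longrightarrow> x \<notin> X k)}" for x
  define \<Phi> where "\<Phi> x = {W \<in> ?Gr. snd ` T x \<subseteq> W}" for x
  have \<Phi>ne: "\<Phi> x \<noteq> {}" if x: "x \<in> S" for x
  proof -
    have "\<exists>W\<in>?Gr. snd ` T x \<subseteq> W"
    proof (rule Grassmannian_superspace[OF _ d])
      show "snd ` T x \<subseteq> Rn n" by (auto simp: T_def)
      fix w assume w: "\<And>i. i < d \<Longrightarrow> w i \<in> snd ` T x"
      define y where "y i = (SOME z. z \<in> T x \<and> snd z = w i)" for i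
      have "y i \<in> T x \<and> snd (y i) = w i" if i: "i < d" for i
      proof -
        obtain z where z: "z \<in> T x" "w i = snd z" by (rule imageE[OF w[OF i]])
        show ?thesis unfolding y_def by (rule someI[of "\<lambda>z. z \<in> T x \<and> snd z = w i" z]) (simp only: z simp_thms)
      qed
      then have y: "\<And>i. i < d \<Longrightarrow> y i \<in> T x" "\<And>i. i < d \<Longrightarrow> snd (y i) = w i" by blast+
      show "\<not> (\<forall>a. (\<Sum>i<d. a i *\<^sub>R w i) = 0 \<longrightarrow> (\<forall>i<d. a i = 0))"
      proof
        assume ind: "\<forall>a. (\<Sum>i<d. a i *\<^sub>R w i) = 0 \<longrightarrow> (\<forall>i<d. a i = 0)"
        have "(\<Sum>i<d. a i *\<^sub>R snd (y i)) = (\<Sum>i<d. a i *\<^sub>R w i)" for a :: "nat \<Rightarrow> real"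
          by (rule sum.cong) (simp_all add: y(2))
        with ind have "\<forall>a. (\<Sum>i<d. a i *\<^sub>R snd (y i)) = 0 \<longrightarrow> (\<forall>i<d. a i = 0)" by simp
        moreover have "\<forall>i<d. snd (y i) \<in> Rn n" using y(1) by (simp add: T_def)
        ultimately obtain i k where "i < d" "dist (y i) (bc k) < br k" "x \<in> X k" using exc x by blast
        then show False using y(1)[of i] by (auto simp: T_def)
      qed
    qed
    then show ?thesis by (auto simp: \<Phi>_def)
  qed
  \<comment> \<open>\<open>grass_dist\<close> compares distance functions on the unit ball only.
    This rescaling into the ball is continuous and does not affect membership in a subspace.\<close>
  define sc where "sc w = (1 / (1 + norm w)) *\<^sub>R w" for w :: rseq
  define idb where "idb x W = infdist x (W \<inter> cball 0 1)" for x :: rseq and W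
  have n1: "0 < 1 + norm w" for w :: rseq using norm_ge_zero[of w] by linarith
  have scb: "sc w \<in> cball 0 1" for w using n1[of w] by (simp add: sc_def divide_simps)
  have scm: "sc w \<in> W \<longleftrightarrow> w \<in> W" if "W \<in> ?Gr" for w W
  proof
    have W: "subspace W" using that by (simp add: Grassmannian_def)
    assume "sc w \<in> W"
    then have "(1 + norm w) *\<^sub>R sc w \<in> W" by (rule subspace_scale[OF W])
    then show "w \<in> W" using n1[of w] by (simp add: sc_def)
  next
    have W: "subspace W" using that by (simp add: Grassmannian_def)
    assume "w \<in> W"
    then show "sc w \<in> W" unfolding sc_def by (rule subspace_scale[OF W])
  qed
  have idz: "idb (sc w) W = 0" if "W \<in> ?Gr" "w \<in> W" for w W
  proof -
    have "sc w \<in> W \<inter> cball 0 1" using scm[OF that(1)] that(2) scb by blast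
    then show ?thesis unfolding idb_def by (rule infdist_zero)
  qed
  have zid: "w \<in> W" if "W \<in> ?Gr" "idb (sc w) W = 0" for w W
    using infdist_ball_zero_imp_mem[OF that(1)] that(2) scm[OF that(1)] unfolding idb_def by blast
  have idlim: "(\<lambda>l. idb (sc w) (W l)) \<longlonglongrightarrow> idb (sc w) V" if "(\<lambda>l. grass_dist (W l) V) \<longlonglongrightarrow> 0" for w W V
  proof -
    have "(\<lambda>l. idb (sc w) (W l) - idb (sc w) V) \<longlonglongrightarrow> 0"
    proof (rule Lim_null_comparison[OF _ that])
      show "\<forall>\<^sub>F l in sequentially. norm (idb (sc w) (W l) - idb (sc w) V) \<le> grass_dist (W l) V"
        using grass_dist_upper[OF scb] unfolding idb_def by (simp add: real_norm_def)
    qed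
    then show ?thesis by (rule LIM_zero_cancel)
  qed
  have id0: "0 \<le> idb x W" for x W unfolding idb_def by (rule infdist_nonneg)
  \<comment> \<open>Approximation of \<open>T x\<close> by the first \<open>l\<close> exclusion sets
    and vectors of norm at most \<open>q\<close>. It depends on \<open>x\<close> only through the
    finite pattern of those \<open>X k\<close> with \<open>k < l\<close> that contain
    \<open>x\<close>, which makes the sets below Borel.\<close>
  define Tq where "Tq q l x = {y. norm y \<le> real q \<and> snd y \<in> Rn n \<and> (\<forall>k<l. dist y (bc k) < br k \<longrightarrow> x \<notin> X k)}" for q l :: nat and x
  define \<Psi> where "\<Psi> q l x W \<longleftrightarrow> (\<forall>y\<in>Tq q l x. idb (sc (snd y)) W \<le> 1 / real (Suc q))" for q l x W
  \<comment> \<open>By compactness: if for every \<open>l\<close> some vector of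
    \<open>Tq q l x\<close> were far from \<open>W\<close>, a limit of these vectors would lie in
    \<open>T x\<close>, because the excluded balls are open, and hence its second component in
    \<open>W\<close>.\<close>
  have sub: "\<exists>l. \<Psi> q l x W" if W: "W \<in> \<Phi> x" for q x W
  proof (rule ccontr)
    assume "\<not> ?thesis"
    note no = this
    have "\<exists>y. y \<in> Tq q l x \<and> 1 / real (Suc q) < idb (sc (snd y)) W" for l
    proof -
      have "\<not> \<Psi> q l x W" using no by blast
      then obtain y where y: "y \<in> Tq q l x" "\<not> idb (sc (snd y)) W \<le> 1 / real (Suc q)" unfolding \<Psi>_def by blast
      show ?thesis by (rule exI[of _ y]) (rule conjI[OF y(1) y(2)[unfolded not_le]])
    qed
    then obtain y where y: "\<And>l. y l \<in> Tq q l x" "\<And>l. 1 / real (Suc q) < idb (sc (snd (y l))) W" by metis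
    have ny: "norm (y l) \<le> real q" "snd (y l) \<in> Rn n" for l using y(1)[of l] by (auto simp: Tq_def)
    have nf: "norm (fst (y l)) \<le> real q" "norm (snd (y l)) \<le> real q" for l
      using ny(1)[of l] norm_fst_le[of "fst (y l)" "snd (y l)"] norm_snd_le[of "snd (y l)" "fst (y l)"] by auto
    have "compact (cball (0::'a) (real q))" by simp
    then obtain v r1 where v: "strict_mono r1" "((\<lambda>l. fst (y l)) \<circ> r1) \<longlonglongrightarrow> v"
      unfolding compact_def using nf(1) by (metis (no_types, lifting) mem_cball_0)
    have "\<exists>r u. strict_mono r \<and> (\<forall>i\<in>{0::nat}. u i \<in> Rn n \<and> (\<lambda>l. snd (y (r1 (r l)))) \<longlonglongrightarrow> u i)"
      using Rn_bounded_convergent_subsequence[of "{0::nat}" "\<lambda>l i. snd (y (r1 l))" n "real q"] ny(2) nf(2) by simp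
    then obtain r2 w where w: "strict_mono r2" "w \<in> Rn n" "(\<lambda>l. snd (y (r1 (r2 l)))) \<longlonglongrightarrow> w" by auto
    define r where "r = r1 \<circ> r2"
    have r: "strict_mono r" unfolding r_def by (rule strict_mono_o[OF v(1) w(1)])
    have "(\<lambda>l. fst (y (r l))) \<longlonglongrightarrow> v"
      using LIMSEQ_subseq_LIMSEQ[OF v(2) w(1)] by (simp add: r_def comp_def)
    then have lim: "(\<lambda>l. y (r l)) \<longlonglongrightarrow> (v, w)"
      using tendsto_Pair[of "\<lambda>l. fst (y (r l))" v sequentially "\<lambda>l. snd (y (r l))" w] w(3) by (simp add: r_def)
    have "(v, w) \<in> T x"
      unfolding T_def
    proof (intro CollectI conjI allI impI)
      show "snd (v, w) \<in> Rn n" using w(2) by simp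
      fix k assume "dist (v, w) (bc k) < br k"
      moreover have "(\<lambda>l. dist (y (r l)) (bc k)) \<longlonglongrightarrow> dist (v, w) (bc k)" by (intro tendsto_intros lim)
      ultimately have "\<forall>\<^sub>F l in sequentially. dist (y (r l)) (bc k) < br k" by (intro order_tendstoD(2))
      moreover have "\<forall>\<^sub>F l in sequentially. k < l" by (rule eventually_gt_at_top)
      ultimately have "\<forall>\<^sub>F l in sequentially. dist (y (r l)) (bc k) < br k \<and> k < l" by (rule eventually_conj)
      from eventually_happens'[OF sequentially_bot this]
      obtain l where l: "dist (y (r l)) (bc k) < br k" "k < l" by blast
      have "k < r l" using l(2) seq_suble[OF r, of l] by linarith
      then show "x \<notin> X k" using y(1)[of "r l"] l(1) by (simp add: Tq_def)
    qed
    then have "w \<in> W" using W by (force simp: \<Phi>_def)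
    then have z: "idb (sc w) W = 0" using W by (intro idz) (auto simp: \<Phi>_def)
    have "(\<lambda>l. sc (snd (y (r l)))) \<longlonglongrightarrow> sc w"
      unfolding sc_def using n1[of w] tendsto_snd[OF lim] by (intro tendsto_intros) auto
    then have "(\<lambda>l. idb (sc (snd (y (r l)))) W) \<longlonglongrightarrow> idb (sc w) W"
      unfolding idb_def by (rule tendsto_infdist)
    then have "1 / real (Suc q) \<le> idb (sc w) W" using y(2) by (intro LIMSEQ_le_const) (auto intro: less_imp_le)
    moreover have "0 < 1 / real (Suc q)" by simp
    ultimately show False using z by linarith
  qed
  have meas: "{x \<in> S. \<Phi> x \<inter> K \<noteq> {}} \<in> sets borel"
    if K: "K \<subseteq> ?Gr" and Kc: "\<And>W V. (\<And>l :: nat. W l \<in> K) \<Longrightarrow> V \<in> ?Gr \<Longrightarrow> (\<lambda>l. grass_dist (W l) V) \<longlonglongrightarrow> 0 \<Longrightarrow> V \<in> K" for K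
  proof -
    \<comment> \<open>For the inclusion from right to left, subspaces in \<open>K\<close> that
      contain the approximations up to \<open>1 / Suc q\<close> have a limit, which stays in the
      closed set \<open>K\<close> and contains all second components of \<open>T x\<close>.\<close>
    have eq: "{x \<in> S. \<Phi> x \<inter> K \<noteq> {}} = S \<inter> (\<Inter>q. \<Union>l. {x. \<exists>W\<in>K. \<Psi> q l x W})" (is "?L = ?R")
    proof (intro set_eqI iffI)
      fix x assume "x \<in> ?L"
      then obtain W where "x \<in> S" "W \<in> \<Phi> x" "W \<in> K" by blast
      then show "x \<in> ?R" using sub by blast
    next
      fix x assume x: "x \<in> ?R"
      then have "\<forall>q. \<exists>W. W \<in> K \<and> (\<exists>l. \<Psi> q l x W)" by blast
      then obtain W where W: "\<And>q. W q \<in> K" "\<And>q. \<exists>l. \<Psi> q l x (W q)" by metis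
      have "W l \<in> ?Gr" for l using W(1) K by blast
      from Grassmannian_sequentially_compact[of W, OF this]
      obtain V r where V: "V \<in> ?Gr" "strict_mono r" "(\<lambda>l. grass_dist (W (r l)) V) \<longlonglongrightarrow> 0" by blast
      have VK: "V \<in> K" by (rule Kc[OF W(1) V(1,3)])
      have "snd y \<in> V" if y: "y \<in> T x" for y
      proof (rule zid[OF V(1)])
        obtain q0 :: nat where q0: "norm y \<le> real q0" using real_arch_simple by blast
        have up: "idb (sc (snd y)) (W (r l)) \<le> 1 / real (Suc l)" if l: "q0 \<le> l" for l
        proof -
          obtain l' where l': "\<Psi> (r l) l' x (W (r l))" using W(2) by blast
          have rl: "l \<le> r l" by (rule seq_suble[OF V(2)])
          have "y \<in> Tq (r l) l' x" using y q0 l rl by (auto simp: Tq_def T_def)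
          then have "idb (sc (snd y)) (W (r l)) \<le> 1 / real (Suc (r l))" using l' by (simp add: \<Psi>_def)
          also have "\<dots> \<le> 1 / real (Suc l)" using rl by (intro divide_left_mono) auto
          finally show ?thesis .
        qed
        have "(\<lambda>l. 1 / real (Suc l)) \<longlonglongrightarrow> 0" by (rule LIMSEQ_Suc[OF lim_1_over_n])
        then have "idb (sc (snd y)) V \<le> 0" using up by (intro LIMSEQ_le[OF idlim[OF V(3)]]) blast+
        then show "idb (sc (snd y)) V = 0" using id0[of "sc (snd y)" V] by linarith
      qed
      then have "V \<in> \<Phi> x" using V(1) by (auto simp: \<Phi>_def)
      then show "x \<in> ?L" using VK x by blast
    qed
    have pat: "{x. {k \<in> {..<l}. x \<in> X k} = P} \<in> sets borel" for l P
    proof (cases "P \<subseteq> {..<l}")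
      case True
      have "{x. {k \<in> {..<l}. x \<in> X k} = P} = UNIV \<inter> (\<Inter>k\<in>{..<l}. if k \<in> P then X k else UNIV - X k)"
        using True by (auto split: if_splits)
      moreover have "UNIV \<inter> (\<Inter>k\<in>{..<l}. if k \<in> P then X k else UNIV - X k) \<in> sets borel"
      proof (cases "l = 0")
        case False
        have "(if k \<in> P then X k else UNIV - X k) \<in> sets borel" for k
          using Xb[of k] sets.compl_sets[OF Xb[of k]] by (simp only: space_borel split: if_split) simp
        then show ?thesis using False by (intro sets.Int sets.finite_INT) auto
      qed simp
      ultimately show ?thesis by (simp only:)
    next
      case False
      then have "{x. {k \<in> {..<l}. x \<in> X k} = P} = {}" by blast
      then show ?thesis by (simp only: sets.empty_sets)
    qed
    have "{x. \<exists>W\<in>K. \<Psi> q l x W} \<in> sets borel" for q l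
    proof -
      define TP where "TP P = {y. norm y \<le> real q \<and> snd y \<in> Rn n \<and> (\<forall>k<l. dist y (bc k) < br k \<longrightarrow> k \<notin> P)}" for P :: "nat set" and y :: "'a \<times> rseq"
      define C where "C P \<longleftrightarrow> (\<exists>W\<in>K. \<forall>y\<in>TP P. idb (sc (snd y)) W \<le> 1 / real (Suc q))" for P
      have "Tq q l x = TP {k \<in> {..<l}. x \<in> X k}" for x by (auto simp: Tq_def TP_def)
      then have \<Psi>C: "(\<exists>W\<in>K. \<Psi> q l x W) \<longleftrightarrow> C {k \<in> {..<l}. x \<in> X k}" for x
        unfolding \<Psi>_def C_def by (simp only:)
      have fibres: "{x. C (f x)} = (\<Union>P\<in>{P \<in> B. C P}. {x. f x = P})" if "\<And>x. f x \<in> B" for f :: "'a \<Rightarrow> nat set" and B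
        using that by blast
      have "{x. \<exists>W\<in>K. \<Psi> q l x W} = (\<Union>P\<in>{P \<in> Pow {..<l}. C P}. {x. {k \<in> {..<l}. x \<in> X k} = P})"
        unfolding \<Psi>C by (rule fibres) (rule PowI, rule Collect_subset)
      moreover have "(\<Union>P\<in>{P \<in> Pow {..<l}. C P}. {x. {k \<in> {..<l}. x \<in> X k} = P}) \<in> sets borel"
        by (rule sets.finite_UN[OF _ pat]) simp
      ultimately show ?thesis by (simp only:)
    qed
    then show ?thesis unfolding eq
      by (intro sets.Int S sets.countable_INT'' sets.countable_UN' image_subsetI countableI_type) auto
  qed
  have "\<exists>\<tau>. (\<forall>x\<in>S. \<tau> x \<in> \<Phi> x) \<and> \<tau> \<in> measurable (restrict_space borel S) (borel_of (Metric_space.mtopology ?Gr grass_dist))"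
  proof (rule compact_valued_selection[OF Metric_space_Grassmannian _ S])
    fix W :: "nat \<Rightarrow> rseq set" assume "\<And>l. W l \<in> ?Gr"
    from Grassmannian_sequentially_compact[of W, OF this]
    show "\<exists>V\<in>?Gr. \<exists>r. strict_mono r \<and> (\<lambda>l. grass_dist (W (r l)) V) \<longlonglongrightarrow> 0" by blast
  next
    fix K :: "rseq set set"
    assume K: "K \<subseteq> ?Gr" "\<And>W V. (\<And>l :: nat. W l \<in> K) \<Longrightarrow> V \<in> ?Gr \<Longrightarrow> (\<lambda>l. grass_dist (W l) V) \<longlonglongrightarrow> 0 \<Longrightarrow> V \<in> K"
    show "{x \<in> S. \<Phi> x \<inter> K \<noteq> {}} \<in> sets borel" by (rule meas[OF K])
  next
    show "\<Phi> x \<noteq> {}" if "x \<in> S" for x using that by (rule \<Phi>ne)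
  next
    show "\<Phi> x \<subseteq> ?Gr" for x by (auto simp: \<Phi>_def)
  next
    fix x W V assume W: "\<And>l :: nat. W l \<in> \<Phi> x" and V: "V \<in> ?Gr" "(\<lambda>l. grass_dist (W l) V) \<longlonglongrightarrow> 0"
    have "snd y \<in> V" if y: "y \<in> T x" for y
    proof (rule zid[OF V(1)])
      have "idb (sc (snd y)) (W l) = 0" for l
        using W[of l] y by (intro idz) (auto simp: \<Phi>_def)
      then have "(\<lambda>l. 0) \<longlonglongrightarrow> idb (sc (snd y)) V" using idlim[OF V(2), of "snd y"] by simp
      then show "idb (sc (snd y)) V = 0" by (simp add: LIMSEQ_const_iff)
    qed
    then show "V \<in> \<Phi> x" using V(1) by (auto simp: \<Phi>_def)
  qed
  then obtain \<tau> where \<tau>: "\<And>x. x \<in> S \<Longrightarrow> \<tau> x \<in> \<Phi> x"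
    "\<tau> \<in> measurable (restrict_space borel S) (borel_of (Metric_space.mtopology ?Gr grass_dist))" by blast
  have "weak_tangent_field (d - 1) n S F \<tau>"
    unfolding weak_tangent_field_def Grassmannian_topology_def
  proof (intro conjI \<tau>(2) ballI, clarify)
    fix D and \<gamma> :: "real \<Rightarrow> 'a" assume "(D, \<gamma>) \<in> curve_fragments"
    then obtain C where D: "compact D" "D \<subseteq> {0..1}" and C: "C-lipschitz_on D \<gamma>" by (auto simp: curve_fragments_def)
    have c\<gamma>: "continuous_on D \<gamma>" by (rule lipschitz_on_continuous_on[OF C])
    have cG: "continuous_on UNIV ?G"
      by (intro continuous_on_Pair continuous_on_id lipschitz_on_continuous_on[OF F(1)])
    obtain N1 where N1: "N1 \<in> null_sets lborel" "\<forall>t\<in>D - N1. \<exists>v. (\<gamma> has_vector_derivative v) (at t within D)"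
      using lipschitz_euclidean_differentiable_AE[OF C] by (rule bexE)
    have "\<exists>N\<in>null_sets lborel. \<forall>t\<in>D - N. \<exists>y. ((\<lambda>t. F (\<gamma> t)) has_vector_derivative (\<Sum>j\<in>{..<n}. y j *\<^sub>R unit_rseq j)) (at t within D)"
    proof (rule lipschitz_sum_differentiable_AE[where c = "\<lambda>j t. coord (F (\<gamma> t)) j"])
      show "F (\<gamma> t) = (\<Sum>j\<in>{..<n}. coord (F (\<gamma> t)) j *\<^sub>R unit_rseq j)" for t
        using F(2) by (intro Rn_representation) blast
      show "\<exists>L. L-lipschitz_on D (\<lambda>t. coord (F (\<gamma> t)) j)" for j
      proof (intro exI lipschitz_onI)
        fix s t assume st: "s \<in> D" "t \<in> D"
        have "dist (coord (F (\<gamma> s)) j) (coord (F (\<gamma> t)) j) \<le> dist (F (\<gamma> s)) (F (\<gamma> t))"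
          using abs_coord_le_norm[of "F (\<gamma> s) - F (\<gamma> t)" j] by (simp add: dist_real_def dist_norm)
        also have "\<dots> \<le> L * dist (\<gamma> s) (\<gamma> t)" by (rule lipschitz_onD[OF F(1)]) auto
        also have "\<dots> \<le> L * (C * dist s t)"
          by (rule mult_left_mono[OF lipschitz_onD[OF C st] lipschitz_on_nonneg[OF F(1)]])
        finally show "dist (coord (F (\<gamma> s)) j) (coord (F (\<gamma> t)) j) \<le> L * C * dist s t" by simp
      qed (use lipschitz_on_nonneg[OF F(1)] lipschitz_on_nonneg[OF C] in simp)
    qed simp
    then obtain N2 where N2: "N2 \<in> null_sets lborel"
      "\<forall>t\<in>D - N2. \<exists>y. ((\<lambda>t. F (\<gamma> t)) has_vector_derivative (\<Sum>j\<in>{..<n}. y j *\<^sub>R unit_rseq j)) (at t within D)"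
      by (rule bexE)
    define Z where "Z k = {t \<in> D. \<gamma> t \<in> X k \<and> (\<exists>y. dist y (bc k) < br k \<and> ((\<lambda>t. ?G (\<gamma> t)) has_vector_derivative y) (at t within D))}" for k
    have "\<exists>M\<in>null_sets lborel. Z k \<subseteq> M" for k
      unfolding Z_def by (rule dir_null_deriv[OF X[rule_format] D(1) c\<gamma> cG])
    then obtain M where M: "\<And>k. M k \<in> null_sets lborel" "\<And>k. Z k \<subseteq> M k" by metis
    define N where "N = N1 \<union> N2 \<union> (\<Union>k. M k)"
    have N: "N \<in> null_sets lborel"
      unfolding N_def by (intro null_sets.Un N1(1) N2(1) null_sets_UN' M(1) countableI_type)
    let ?E = "{t \<in> D. \<gamma> t \<in> S \<and> \<not> (\<exists>v\<in>\<tau> (\<gamma> t). (F \<circ> \<gamma> has_vector_derivative v) (at t within D))}"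
    have "?E \<subseteq> N"
    proof (rule subsetI, rule ccontr)
      fix t assume t: "t \<in> ?E" and tN: "t \<notin> N"
      have tD: "t \<in> D - N1" "t \<in> D - N2" using t tN unfolding N_def by blast+
      obtain v where v: "(\<gamma> has_vector_derivative v) (at t within D)" using N1(2) tD(1) by blast
      obtain y where y: "((\<lambda>t. F (\<gamma> t)) has_vector_derivative (\<Sum>j\<in>{..<n}. y j *\<^sub>R unit_rseq j)) (at t within D)"
        using N2(2) tD(2) by blast
      define w where "w = (\<Sum>j\<in>{..<n}. y j *\<^sub>R unit_rseq j)"
      have w: "w \<in> Rn n"
        unfolding w_def by (intro subspace_sum[OF subspace_Rn] subspace_scale[OF subspace_Rn]) (auto simp: Rn_def)
      have Gd: "((\<lambda>t. ?G (\<gamma> t)) has_vector_derivative (v, w)) (at t within D)"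
        by (rule has_vector_derivative_Pair[OF v y[folded w_def]])
      have "(v, w) \<in> T (\<gamma> t)"
        unfolding T_def
      proof (intro CollectI conjI allI impI)
        show "snd (v, w) \<in> Rn n" using w by simp
        fix k assume k: "dist (v, w) (bc k) < br k"
        show "\<gamma> t \<notin> X k"
        proof
          assume "\<gamma> t \<in> X k"
          then have "t \<in> Z k" unfolding Z_def using t k Gd by blast
          then show False using M(2)[of k] tN unfolding N_def by blast
        qed
      qed
      then have "w \<in> \<tau> (\<gamma> t)" using \<tau>(1)[of "\<gamma> t"] t by (force simp: \<Phi>_def)
      moreover have "(F \<circ> \<gamma> has_vector_derivative w) (at t within D)" using y by (simp add: w_def comp_def)
      ultimately show False using t by blast
    qed
    moreover have "?E \<subseteq> {0..1}" using D(2) by blast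
    ultimately show "Hausdorff_measure 1 ?E = 0" by (rule Hausdorff_measure_1_null[OF N])
  qed
  then show ?thesis by blast
qed

section \<open>Reduction to countably many frames and conclusion\<close>

theorem corollary1p6:
  fixes d :: nat
    and \<mu> :: "(real ^ 'k) measure"
  assumes "d \<le> CARD('m)"
    and "finite_measure \<mu>"
    and "sets \<mu> = sets borel"
    and "tangential_dim \<mu> \<ge> enat d"
  shows "top_of_set (Lip1 :: ((real ^ 'k) \<Rightarrow>\<^sub>C (real ^ 'm)) set) interior_of
           {f \<in> Lip1. Hausdorff_dim (distr \<mu> borel (apply_bcontfun f)) \<ge> of_nat d} \<noteq> {}"
proof
  let ?L = "Lip1 :: ((real ^ 'k) \<Rightarrow>\<^sub>C (real ^ 'm)) set"
  let ?A = "{f \<in> ?L. Hausdorff_dim (distr \<mu> borel (apply_bcontfun f)) \<ge> of_nat d}"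
  assume empty: "top_of_set ?L interior_of ?A = {}"
  have dense: "\<exists>f\<in>?L. dist f f0 < \<epsilon> \<and> Hausdorff_dim (distr \<mu> borel (apply_bcontfun f)) < of_nat d"
    if f0: "f0 \<in> ?L" and \<epsilon>: "0 < \<epsilon>" for f0 \<epsilon>
  proof (rule ccontr)
    assume no: "\<not> ?thesis"
    have "?L \<inter> ball f0 \<epsilon> \<subseteq> ?A" using no by (auto simp: dist_commute not_less)
    moreover have "openin (top_of_set ?L) (?L \<inter> ball f0 \<epsilon>)" by (intro openin_open_Int open_ball)
    ultimately have "?L \<inter> ball f0 \<epsilon> \<subseteq> top_of_set ?L interior_of ?A" by (rule interior_of_maximal)
    moreover have "f0 \<in> ?L \<inter> ball f0 \<epsilon>" using f0 \<epsilon> by simp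
    ultimately show False using empty by blast
  qed
  have sp: "space \<mu> = UNIV" using sets_eq_imp_space_eq[OF assms(3)] by simp
  \<comment> \<open>No dimension is below 0, so for \<open>d = 0\<close> density already fails at
    the zero map. From here on \<open>d - 1\<close> is a genuine predecessor.\<close>
  have d1: "1 \<le> d"
  proof (rule ccontr)
    assume "\<not> 1 \<le> d"
    then have d0: "d = 0" by simp
    have "(0 :: (real ^ 'k) \<Rightarrow>\<^sub>C (real ^ 'm)) \<in> ?L"
      by (simp add: Lip1_def lipschitz_on_def)
    from dense[OF this, of 1] show False by (simp add: d0)
  qed
  define ind where "ind v \<longleftrightarrow> (\<forall>a. (\<Sum>i<d. a i *\<^sub>R v i) = 0 \<longrightarrow> (\<forall>i<d. a i = 0))" for v :: "nat \<Rightarrow> real ^ 'k"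
  define good where "good v \<rho> A \<longleftrightarrow> (\<forall>i<d. dir_null (\<lambda>x. x) (v i) \<rho> (A i)) \<and> emeasure \<mu> (UNIV - (\<Union>i<d. A i)) = 0"
    for v \<rho> and A :: "nat \<Rightarrow> (real ^ 'k) set"
  have frame: "\<exists>\<rho>>0. \<exists>A. good v \<rho> A" if v: "ind v" for v
    unfolding good_def
    by (rule frame_null_cover[where 'b = "real ^ 'm", OF assms(2,3) d1 _ dense]) (use v assms(1) in \<open>auto simp: ind_def\<close>)
  obtain Q :: "(real ^ 'k) set" where Q: "countable Q" "\<And>X. open X \<Longrightarrow> X \<noteq> {} \<Longrightarrow> \<exists>q\<in>Q. q \<in> X"
    using countable_dense_exists by blast
  define TT where "TT = {..<d} \<rightarrow>\<^sub>E Q"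
  have cTT: "countable TT" unfolding TT_def by (intro countable_PiE finite_lessThan Q(1))
  \<comment> \<open>One cover is fixed for every pair of a tuple from the countable dense set
    \<open>Q\<close> and a radius that admits a cover at all, so \<open>N\<close> is a countable
    union of null sets.\<close>
  define \<A> where "\<A> p = (SOME A. good (fst p) (1 / real (Suc (snd p))) A)" for p :: "(nat \<Rightarrow> real ^ 'k) \<times> nat"
  define I where "I = {p \<in> TT \<times> UNIV. good (fst p) (1 / real (Suc (snd p))) (\<A> p)}"
  have cI: "countable I" unfolding I_def using cTT by (intro countable_subset[OF _ countable_SIGMA[OF cTT countableI_type]]) auto
  define N where "N = (\<Union>p\<in>I. UNIV - (\<Union>i<d. \<A> p i))"
  have Np: "UNIV - (\<Union>i<d. \<A> p i) \<in> null_sets \<mu>" if "p \<in> I" for p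
  proof -
    have g: "good (fst p) (1 / real (Suc (snd p))) (\<A> p)" using that by (simp add: I_def)
    then have "(\<Union>i<d. \<A> p i) \<in> sets borel" by (intro sets.finite_UN) (auto simp: good_def dir_null_def)
    then have "UNIV - (\<Union>i<d. \<A> p i) \<in> sets borel" using sets.compl_sets[of _ borel] by fastforce
    then show ?thesis using g by (simp add: null_sets_def assms(3) good_def)
  qed
  have N: "N \<in> null_sets \<mu>" unfolding N_def by (rule null_sets_UN'[OF cI Np])
  have Nb: "N \<in> sets borel" using N assms(3) by auto
  have PS: "\<exists>\<rho>>0. \<exists>A. (\<forall>i<d. dir_null (\<lambda>x. x) (v i) \<rho> (A i)) \<and> UNIV - N \<subseteq> (\<Union>i<d. A i)"
    if v: "\<And>a. (\<Sum>i<d. a i *\<^sub>R v i) = 0 \<Longrightarrow> \<forall>i<d. a i = 0" for v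
  proof -
    obtain \<rho> A where \<rho>: "0 < \<rho>" "good v \<rho> A" using frame[of v] v unfolding ind_def by blast
    \<comment> \<open>The radius shrinks twice: to \<open>\<epsilon>\<close> when passing from
      \<open>v\<close> to the nearby tuple \<open>q\<close>, which makes the fixed cover available,
      and to \<open>\<epsilon> / 2\<close> on the way back to \<open>v\<close>.\<close>
    obtain m where m: "1 / real (Suc m) < \<rho> / 2" using nat_approx_posE[of "\<rho> / 2"] \<rho>(1) by auto
    define \<epsilon> where "\<epsilon> = 1 / real (Suc m)"
    have \<epsilon>: "0 < \<epsilon>" by (simp add: \<epsilon>_def)
    have m\<epsilon>: "\<epsilon> < \<rho> / 2" unfolding \<epsilon>_def by (rule m)
    have "\<exists>q\<in>Q. q \<in> ball (v i) (\<epsilon> / 2)" for i using \<epsilon> by (intro Q(2)) auto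
    then obtain q where q: "\<And>i. q i \<in> Q" "\<And>i. dist (v i) (q i) < \<epsilon> / 2" by (metis mem_ball)
    define p where "p = (restrict q {..<d}, m)"
    have "good (fst p) \<epsilon> A"
      unfolding good_def
    proof (intro conjI allI impI)
      fix i assume i: "i < d"
      have "dir_null (\<lambda>x. x) (v i) \<rho> (A i)" using \<rho>(2) i by (simp add: good_def)
      moreover have "dist (v i) (q i) + \<epsilon> \<le> \<rho>" using q(2)[of i] m\<epsilon> \<rho>(1) by linarith
      ultimately have "dir_null (\<lambda>x. x) (q i) \<epsilon> (A i)" by (rule dir_null_mono)
      then show "dir_null (\<lambda>x. x) (fst p i) \<epsilon> (A i)" using i by (simp add: p_def)
    qed (use \<rho>(2) in \<open>simp add: good_def\<close>)
    then have "good (fst p) (1 / real (Suc (snd p))) A" by (simp add: p_def \<epsilon>_def)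
    then have g: "good (fst p) (1 / real (Suc (snd p))) (\<A> p)"
      unfolding \<A>_def by (rule someI[of "good (fst p) (1 / real (Suc (snd p)))" A])
    then have pI: "p \<in> I" using q(1) by (auto simp: I_def p_def TT_def)
    show ?thesis
    proof (intro exI[of _ "\<epsilon> / 2"] conjI exI[of _ "\<A> p"] allI impI)
      fix i assume i: "i < d"
      have "dir_null (\<lambda>x. x) (q i) \<epsilon> (\<A> p i)" using g i by (simp add: good_def p_def \<epsilon>_def)
      moreover have "dist (q i) (v i) + \<epsilon> / 2 \<le> \<epsilon>" using q(2)[of i] by (simp add: dist_commute)
      ultimately show "dir_null (\<lambda>x. x) (v i) (\<epsilon> / 2) (\<A> p i)" by (rule dir_null_mono)
    next
      show "UNIV - N \<subseteq> (\<Union>i<d. \<A> p i)" unfolding N_def using pI by blast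
    qed (use \<epsilon> in simp)
  qed
  \<comment> \<open>\<open>N\<close> is fixed before \<open>n\<close> and \<open>F\<close>, as the
    order of quantifiers in the tangential dimension of a measure demands.\<close>
  have "admits_weak_tangent_field (d - 1) (UNIV - N)"
    unfolding admits_weak_tangent_field_def
  proof (intro allI impI)
    fix n and F :: "real ^ 'k \<Rightarrow> rseq"
    assume n: "d - 1 \<le> n" and "range F \<subseteq> Rn n \<and> (\<exists>L. L-lipschitz_on UNIV F)"
    then obtain L where F: "range F \<subseteq> Rn n" "L-lipschitz_on UNIV F" by blast
    have "UNIV - N \<in> sets borel" using sets.compl_sets[OF Nb] by simp
    then show "\<exists>\<tau>. weak_tangent_field (d - 1) n (UNIV - N) F \<tau>"
      by (rule weak_tangent_field_exists[OF _ d1 n F(2,1) PS])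
  qed
  then have "tangential_dim_set (UNIV - N) \<le> enat (d - 1)"
    unfolding tangential_dim_set_def by (intro Inf_lower) blast
  then have "tangential_dim \<mu> \<le> enat (d - 1)"
    unfolding tangential_dim_def using Nb N by (intro Inf_lower) (auto simp: null_sets_def)
  then have "enat d \<le> enat (d - 1)" using assms(4) by (rule order_trans[rotated])
  then show False using d1 by simp
qed

end
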